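(* Suppose $V$ is a distribution of $k$-planes in $\mathbb{R}^n$ of class $C^1$ and let $q\in[1,\infty]$, $s,\alpha\in(0,1)$ be such that $s<1/2$ and $$\alpha<1-\Bigl(2-\frac1q\Bigr)s$$ (with $1/q=0$ if $q=\infty$). Then there exist an embedded $k$-dimensional submanifold $S$ of $\mathbb{R}^n$ of class $Y^{1+\alpha,q}$ and a Borel set $E$ with $\mathbf{1}_E\in W^{s,1}(S)$ such that $$E\subseteq\tau(S,V)\qquad\text{and}\qquad \mathscr{H}^k(E)>0 .$$
   Context: $\mathscr{H}^k$ is the $k$-dimensional Hausdorff measure. Fractional Sobolev spaces: for $U$ open in a $k$-dimensional Euclidean space, $\alpha\in(0,1)$, $q\in[1,\infty)$, $W^{\alpha,q}(U)$ is the set of $v\in L^q(U)$ with $[v]^q_{W^{\alpha,q}(U)}:=\int_U\int_U\frac{|v(x)-v(y)|^q}{|x-y|^{\alpha q+k}}\,dx\,dy<\infty$; for $q=\infty$, $W^{\alpha,\infty}(U)=C^{\alpha}(U)$ (bounded $\alpha$-Hölder functions). Class $Y^{1+\alpha,q}$: a closed set $S\subset\mathbb{R}^n$ is a $k$-dimensional submanifold of class $Y^{1+\alpha,q}$ if (i) $S$ is an embedded $k$-dimensional submanifold of class $C^1$, and (ii) there is an atlas of $S$ consisting of $C^1$ maps $\varphi_j:U_j\subseteq V_j\to V_j^\perp$, where $V_j$ is a $k$-dimensional linear subspace of $\mathbb{R}^n$, $U_j\subseteq V_j$ is relatively open, the graph of $\varphi_j$ is contained in $S$, and $D\varphi_j\in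 W^{\alpha,q}(U_j,\mathbb{R}^{k\times(n-k)})$. Sobolev functions on $S$: for $s\in(0,1]$, $p\in[1,\infty)$, a measurable $u:S\to\mathbb{R}$ is in $W^{s,p}(S)$ if $u\in L^p(\mathscr{H}^k\llcorner S)$ and $$[u]_{W^{s,p}(S)}^p:=\int_S\int_S\frac{|u(x)-u(y)|^p}{|x-y|^{sp+k}}\,d\mathscr{H}^k(x)\,d\mathscr{H}^k(y)<\infty .$$ Distributions: a distribution of $k$-planes $V$ on $\mathbb{R}^n$ assigns to each $x$ a $k$-dimensional linear subspace $V(x)\subset\mathbb{R}^n$; it is of class $C^1$ if it is locally spanned by $k$ vector fields of class $C^1$. The tangency set is $\tau(S,V):=\{x\in S:\mathrm{Tan}(S,x)=V(x)\}$, where $\mathrm{Tan}(S,x)$ is the classical tangent space of $S$ at $x$. *)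

theory Defs
  imports "HOL-Analysis.Analysis"
begin

section \<open>Hausdorff measure\<close>

text \<open>The case distinction makes the empty set weightless also for \<open>k = 0\<close>. The coverings consist
  of bounded sets since \<^const>\<open>diameter\<close> is unspecified on unbounded ones.\<close>

definition hausdorff_pre :: "nat \<Rightarrow> real \<Rightarrow> 'a::metric_space set \<Rightarrow> ennreal" where
  "hausdorff_pre k \<delta> A =
     (INF C \<in> {C :: nat \<Rightarrow> 'a set. A \<subseteq> (\<Union>i. C i) \<and> (\<forall>i. bounded (C i) \<and> diameter (C i) \<le> \<delta>)}.
        \<Sum>i. if C i = {} then 0
             else ennreal (unit_ball_vol (real k) * (diameter (C i) / 2) ^ k))"

definition hausdorff_outer :: "nat \<Rightarrow> 'a::metric_space set \<Rightarrow> ennreal" where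
  "hausdorff_outer k A = (SUP \<delta>\<in>{0<..}. hausdorff_pre k \<delta> A)"

text \<open>The sigma-algebra consists of all Caratheodory measurable sets; it contains the Borel sets.\<close>

definition hausdorff :: "nat \<Rightarrow> 'a::metric_space measure" where
  "hausdorff k =
     measure_of UNIV (lambda_system UNIV UNIV (hausdorff_outer k)) (hausdorff_outer k)"


section \<open>Fractional Sobolev spaces\<close>

text \<open>The space \<open>W\<^sup>s\<^sup>,\<^sup>p\<close> over the \<open>k\<close>-dimensional measure \<open>M\<close>, for finite \<open>p\<close>. On the diagonal the
  integrand is \<open>0 / 0 = 0\<close>.\<close>

definition frac_sobolev ::
  "'a::metric_space measure \<Rightarrow> nat \<Rightarrow> real \<Rightarrow> real \<Rightarrow> ('a \<Rightarrow> 'b::real_normed_vector) \<Rightarrow> bool" where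
  "frac_sobolev M k s p u \<longleftrightarrow>
     u \<in> borel_measurable M \<and>
     (\<integral>\<^sup>+ x. ennreal (norm (u x) powr p) \<partial>M) < \<infinity> \<and>
     (\<integral>\<^sup>+ x. \<integral>\<^sup>+ y. ennreal (norm (u x - u y) powr p / dist x y powr (s * p + real k)) \<partial>M \<partial>M) < \<infinity>"

text \<open>The \<open>k\<close>-dimensional Lebesgue measure on a \<open>k\<close>-dimensional linear subspace \<open>V\<close>, transported
  from orthonormal coordinates in the same way as \<^const>\<open>lborel\<close> and independent of the basis.
  As a measure on the ambient space it is concentrated on \<open>V\<close>.\<close>

definition lebesgue_subspace :: "'a::euclidean_space set \<Rightarrow> 'a measure" where
  "lebesgue_subspace V =
     (let B = (SOME B. B \<subseteq> V \<and> pairwise orthogonal B \<and> (\<forall>b\<in>B. norm b = 1) \<and> span B = V)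
      in completion (distr (\<Pi>\<^sub>M b\<in>B. (lborel :: real measure)) borel (\<lambda>f. \<Sum>b\<in>B. f b *\<^sub>R b)))"

text \<open>\<open>W\<^sup>\<alpha>\<^sup>,\<^sup>q(U)\<close> for a relatively open subset \<open>U\<close> of a linear subspace \<open>V\<close>.\<close>

definition frac_sobolev_flat ::
  "'a::euclidean_space set \<Rightarrow> 'a set \<Rightarrow> real \<Rightarrow> ennreal \<Rightarrow> ('a \<Rightarrow> 'b::real_normed_vector) \<Rightarrow> bool" where
  "frac_sobolev_flat V U \<alpha> q v \<longleftrightarrow>
     (if q = \<infinity>
      then bounded (v ` U) \<and> (\<exists>C. \<forall>x\<in>U. \<forall>y\<in>U. norm (v x - v y) \<le> C * dist x y powr \<alpha>)
      else frac_sobolev (restrict_space (lebesgue_subspace V) U) (dim V) \<alpha> (enn2real q) v)"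

definition frac_sobolev_surface ::
  "'a::metric_space set \<Rightarrow> nat \<Rightarrow> real \<Rightarrow> real \<Rightarrow> ('a \<Rightarrow> real) \<Rightarrow> bool" where
  "frac_sobolev_surface S k s p u \<longleftrightarrow> frac_sobolev (restrict_space (hausdorff k) S) k s p u"


section \<open>Submanifolds\<close>

definition C1_on :: "'a::real_normed_vector set \<Rightarrow> ('a \<Rightarrow> 'b::real_normed_vector) \<Rightarrow> bool" where
  "C1_on W f \<longleftrightarrow>
     (\<exists>D. (\<forall>x\<in>W. (f has_derivative blinfun_apply (D x)) (at x)) \<and> continuous_on W D)"

text \<open>Embedded submanifolds without boundary, described by \<open>C\<^sup>1\<close> slice charts.\<close>

definition embedded_C1_submanifold :: "nat \<Rightarrow> 'a::euclidean_space set \<Rightarrow> bool" where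
  "embedded_C1_submanifold k S \<longleftrightarrow>
     (\<forall>x\<in>S. \<exists>W W' \<Phi> \<Psi> L.
        open W \<and> x \<in> W \<and> open W' \<and> homeomorphism W W' \<Phi> \<Psi> \<and> C1_on W \<Phi> \<and> C1_on W' \<Psi> \<and>
        subspace (L :: 'a set) \<and> dim L = k \<and> \<Phi> ` (S \<inter> W) = L \<inter> W')"

definition graph_over :: "'a::real_vector set \<Rightarrow> ('a \<Rightarrow> 'a) \<Rightarrow> 'a set" where
  "graph_over U \<phi> = (\<lambda>x. x + \<phi> x) ` U"

text \<open>A map \<open>\<phi>\<close> from a relatively open \<open>U \<subseteq> V\<close> into the orthogonal complement of \<open>V\<close>, of class
  \<open>C\<^sup>1\<close> and with derivative in \<open>W\<^sup>\<alpha>\<^sup>,\<^sup>q(U)\<close>. The derivative at a point of \<open>U\<close>, a linear map on \<open>V\<close>,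
  is represented by its extension by zero on the orthogonal complement of \<open>V\<close>, which preserves
  the operator norm.\<close>

definition Y_chart ::
  "real \<Rightarrow> ennreal \<Rightarrow> 'a::euclidean_space set \<Rightarrow> 'a set \<Rightarrow> ('a \<Rightarrow> 'a) \<Rightarrow> bool" where
  "Y_chart \<alpha> q V U \<phi> \<longleftrightarrow>
     subspace V \<and> openin (top_of_set V) U \<and> \<phi> ` U \<subseteq> orthogonal_comp V \<and>
     (\<exists>D :: 'a \<Rightarrow> 'a \<Rightarrow>\<^sub>L 'a.
        (\<forall>x\<in>U. (\<phi> has_derivative blinfun_apply (D x)) (at x within V) \<and>
               (\<forall>w\<in>orthogonal_comp V. blinfun_apply (D x) w = 0)) \<and>
        continuous_on U D \<and>
        frac_sobolev_flat V U \<alpha> q D)"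

definition Y_submanifold :: "nat \<Rightarrow> real \<Rightarrow> ennreal \<Rightarrow> 'a::euclidean_space set \<Rightarrow> bool" where
  "Y_submanifold k \<alpha> q S \<longleftrightarrow>
     closed S \<and> embedded_C1_submanifold k S \<and>
     (\<exists>\<A> :: ('a set \<times> 'a set \<times> ('a \<Rightarrow> 'a)) set.
        (\<forall>(V, U, \<phi>)\<in>\<A>. dim V = k \<and> Y_chart \<alpha> q V U \<phi> \<and>
           graph_over U \<phi> \<subseteq> S \<and> openin (top_of_set S) (graph_over U \<phi>)) \<and>
        S = (\<Union>(V, U, \<phi>)\<in>\<A>. graph_over U \<phi>))"


section \<open>Distributions of planes and tangency sets\<close>

definition C1_distribution :: "nat \<Rightarrow> ('a::euclidean_space \<Rightarrow> 'a set) \<Rightarrow> bool" where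
  "C1_distribution k V \<longleftrightarrow>
     (\<forall>x. subspace (V x) \<and> dim (V x) = k) \<and>
     (\<forall>x. \<exists>N (X :: nat \<Rightarrow> 'a \<Rightarrow> 'a). open N \<and> x \<in> N \<and> (\<forall>i<k. C1_on N (X i)) \<and>
        (\<forall>y\<in>N. V y = span ((\<lambda>i. X i y) ` {..<k})))"

text \<open>The velocities at \<open>x\<close> of \<open>C\<^sup>1\<close> curves in \<open>S\<close> through \<open>x\<close>.\<close>

definition tangent_space :: "'a::euclidean_space set \<Rightarrow> 'a \<Rightarrow> 'a set" where
  "tangent_space S x =
     {v. \<exists>\<gamma> \<epsilon>. 0 < \<epsilon> \<and> \<gamma> C1_differentiable_on {-\<epsilon><..<\<epsilon>} \<and> \<gamma> ` {-\<epsilon><..<\<epsilon>} \<subseteq> S \<and>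
               \<gamma> 0 = x \<and> (\<gamma> has_vector_derivative v) (at 0)}"

definition tangency_set :: "'a::euclidean_space set \<Rightarrow> ('a \<Rightarrow> 'a set) \<Rightarrow> 'a set" where
  "tangency_set S V = {x\<in>S. tangent_space S x = V x}"

end

theory Submission
  imports Defs
begin

text \<open>The surface is the graph of a map \<open>f\<close> over the plane \<open>W = V(0)\<close>, and \<open>E\<close> is the part of the graph
  above a compact set \<open>K\<close>, the core. Near the origin \<open>V(x)\<close> is itself the graph of a linear map
  \<open>A(x) : W \<rightarrow> W\<^sup>\<bottom>\<close> that depends on \<open>x\<close> in a Lipschitz way (\<open>distribution_slopes\<close>), so tangency above \<open>K\<close>
  means \<open>Df(z) = A(z + f(z))\<close> for \<open>z \<in> K\<close>. In general no open set carries a solution of this equation,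
  but a set with many small gaps does.

  Divide a cube of side \<open>l\<^sub>0\<close> into dyadic cells of side \<open>l\<^sub>j = l\<^sub>0 / 2\<^sup>j\<close>. The \<open>j\<close>-th correction adds, in every
  cell of generation \<open>j\<close>, an affine map whose slope is the difference between the slope prescribed at
  that cell and the one prescribed at its parent; since \<open>A\<close> is Lipschitz, this slope is of order \<open>l\<^sub>j\<close>. The
  affine map is switched off in a gap of width \<open>d\<^sub>j = l\<^sub>j\<^sup>\<beta>\<close> along the faces of the cell, where \<open>1 < \<beta> < 2\<close>.
  The prescribed slopes are computed from the cells alone, with the height of the graph replaced by the
  one that the affine maps of the previous cells predict; no correction therefore has to be known before
  the next one is defined, and all estimates are uniform. The core \<open>K\<close> is what remains of the cube
  outside the gaps of all generations. There no correction is switched off, their slopes telescope, and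
  the limit has the prescribed derivative (\<open>limit_deriv_core\<close>).

  The derivative of the \<open>j\<close>-th correction has size \<open>l\<^sub>j\<^sup>2 / d\<^sub>j = l\<^sub>j\<^sup>2\<^sup>-\<^sup>\<beta>\<close> in the gaps, which fill the
  fraction \<open>d\<^sub>j / l\<^sub>j\<close> of the volume, has size \<open>l\<^sub>j\<close> elsewhere, and varies at the scale \<open>d\<^sub>j\<close>
  (\<open>dbump_bounds\<close>). This decides everything:

  \<^item> The graph is of class \<open>C\<^sup>1\<close> because \<open>\<beta> < 2\<close>, and \<open>K\<close> has positive measure because \<open>\<beta> > 1\<close> and \<open>l\<^sub>0\<close> is
    small (\<open>emeasure_core_pos\<close>).
  \<^item> The gaps of generation \<open>j\<close> are of the order of \<open>2\<^sup>j\<close> slabs of width \<open>d\<^sub>j\<close> and contribute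
    \<open>d\<^sub>j\<^sup>1\<^sup>-\<^sup>s / l\<^sub>j\<close> to the fractional perimeter of \<open>K\<close>, which is finite if \<open>\<beta> (1 - s) > 1\<close>
    (\<open>core_perimeter_finite\<close>).
  \<^item> The \<open>W\<^sup>\<alpha>\<^sup>,\<^sup>q\<close> energy of the \<open>j\<close>-th derivative is a power of \<open>l\<^sub>j\<close> with the exponent
    \<open>q (2 - \<beta> - \<alpha> \<beta>) + \<beta> - 1\<close>, which has to be positive (\<open>dbump_energy_le\<close>); for \<open>q = \<infinity>\<close> the Hoelder
    constants are summable if \<open>2 - \<beta> - \<alpha> \<beta> > 0\<close> (\<open>limit_deriv_Hoelder\<close>).

  A number \<open>\<beta>\<close> slightly above \<open>1 / (1 - s)\<close> meets all these conditions precisely because of the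
  hypotheses \<open>s < 1 / 2\<close> and \<open>\<alpha> < 1 - (2 - 1 / q) s\<close> (\<open>ex_gap_exponent\<close>).

  All estimates are made for Lebesgue measure on the plane. They carry over to the Hausdorff measure of
  the graph since the two measures are comparable: grids of cells give coverings of Lipschitz images
  (\<open>hausdorff_graph_le\<close>), and coverings of the graph project to coverings by balls
  (\<open>hausdorff_outer_ge\<close>).\<close>


section \<open>Metric outer measures\<close>

lemma lambda_system_UNIV_I:
  fixes f :: "'a set \<Rightarrow> ennreal"
  assumes "\<And>T. f T < \<infinity> \<Longrightarrow> f (T \<inter> C) + f (T - C) \<le> f T"
    and "\<And>A B. f (A \<union> B) \<le> f A + f B"
  shows "C \<in> lambda_system UNIV UNIV f"
proof -
  have "f (C \<inter> T) + f ((UNIV - C) \<inter> T) = f T" for T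
  proof (rule antisym)
    have "(UNIV - C) \<inter> T = T - C" "C \<inter> T = T \<inter> C" by auto
    then show "f (C \<inter> T) + f ((UNIV - C) \<inter> T) \<le> f T"
      using assms(1)[of T] by (cases "f T < \<infinity>") (auto simp: not_less top_unique)
    have "f T = f ((C \<inter> T) \<union> ((UNIV - C) \<inter> T))" by (rule arg_cong[of _ _ f]) auto
    also have "\<dots> \<le> f (C \<inter> T) + f ((UNIV - C) \<inter> T)" by (rule assms(2))
    finally show "f T \<le> f (C \<inter> T) + f ((UNIV - C) \<inter> T)" .
  qed
  then show ?thesis by (simp add: lambda_system_def)
qed

lemma ennreal_suminf_tail_tendsto_0:
  fixes f :: "nat \<Rightarrow> ennreal"
  assumes "(\<Sum>k. f k) < \<infinity>"
  shows "(\<lambda>n. \<Sum>k. f (k + n)) \<longlonglongrightarrow> 0"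
proof -
  define g where "g k = enn2real (f k)" for k
  have "f k < \<infinity>" for k
    using assms ennreal_suminf_lessD by (metis infinity_ennreal_def)
  then have f: "f k = ennreal (g k)" and g: "0 \<le> g k" for k
    by (auto simp: g_def less_top)
  have "summable g"
    using assms unfolding f by (intro summable_suminf_not_top g) auto
  then have "(\<lambda>n. \<Sum>k. g (k + n)) \<longlonglongrightarrow> 0" by (rule suminf_exist_split2)
  then have "(\<lambda>n. ennreal (\<Sum>k. g (k + n))) \<longlonglongrightarrow> ennreal 0" by (rule tendsto_ennrealI)
  moreover have "(\<Sum>k. f (k + n)) = ennreal (\<Sum>k. g (k + n))" for n
    unfolding f using g \<open>summable g\<close> by (intro suminf_ennreal2) (auto simp: summable_iff_shift)
  ultimately show ?thesis by simp
qed

text \<open>Caratheodory's criterion. The points of \<open>T\<close> at distance at least \<open>r\<^sub>n\<close> from \<open>C\<close> are separated from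
  \<open>T \<inter> C\<close>, so additivity on separated sets gives the claim up to the measure of the bands
  \<open>D\<^sub>i\<close>, \<open>i \<ge> n\<close>, between consecutive distances. Bands of the same parity are separated from each other,
  hence the measures of all bands have a sum of at most \<open>2 f(T)\<close>, and the remainder tends to zero.\<close>

lemma metric_outer_measure_closed:
  fixes f :: "'a::metric_space set \<Rightarrow> ennreal"
  assumes oms: "outer_measure_space UNIV f"
    and metric: "\<And>A B \<epsilon>. 0 < \<epsilon> \<Longrightarrow> (\<And>x y. x \<in> A \<Longrightarrow> y \<in> B \<Longrightarrow> \<epsilon> \<le> dist x y)
                  \<Longrightarrow> f A + f B \<le> f (A \<union> B)"
    and "closed C"
  shows "C \<in> lambda_system UNIV UNIV f"
proof -
  have pos: "f {} = 0" and mono: "\<And>A B. A \<subseteq> B \<Longrightarrow> f A \<le> f B"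
    using oms by (auto simp: outer_measure_space_def positive_def increasing_def)
  have csub: "f (\<Union>i. A i) \<le> (\<Sum>i. f (A i))" for A :: "nat \<Rightarrow> 'a set"
  proof -
    have "f (\<Union>i. disjointed A i) \<le> (\<Sum>i. f (disjointed A i))"
      using oms disjoint_family_disjointed[of A]
      by (auto simp: outer_measure_space_def countably_subadditive_def)
    also have "\<dots> \<le> (\<Sum>i. f (A i))"
      by (intro suminf_le mono) (auto simp: disjointed_subset)
    finally show ?thesis by (simp add: UN_disjointed_eq)
  qed
  have sub: "f (A \<union> B) \<le> f A + f B" for A B
  proof -
    have "f (A \<union> B) = f (\<Union>i. (\<lambda>i::nat. if i = 0 then A else if i = 1 then B else {}) i)"
      by (rule arg_cong[of _ _ f]) (auto split: if_splits)
    also have "\<dots> \<le> (\<Sum>i::nat. f (if i = 0 then A else if i = 1 then B else {}))"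
      by (rule csub)
    also have "\<dots> = (\<Sum>i\<in>{0,1::nat}. f (if i = 0 then A else if i = 1 then B else {}))"
      by (rule suminf_finite) (auto simp: pos)
    finally show ?thesis by simp
  qed
  show ?thesis
  proof (rule lambda_system_UNIV_I[OF _ sub])
    fix T assume fin: "f T < \<infinity>"
    show "f (T \<inter> C) + f (T - C) \<le> f T"
    proof (cases "C = {}")
      case True then show ?thesis by (simp add: pos)
    next
      case False
      define r where "r n = 1 / (real n + 1)" for n
      have r: "0 < r n" "r (Suc n) < r n" for n by (auto simp: r_def field_simps)
      have rmono: "r n \<le> r m" if "m \<le> n" for m n
        using that by (auto simp: r_def field_simps)
      define Cn where "Cn n = {x\<in>T. r n \<le> infdist x C}" for n
      define D where "D n = Cn (Suc n) - Cn n" for n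
      have infd: "infdist x C \<le> infdist y C + dist x y" for x y
        by (metis infdist_triangle)
      have Cn_mono: "Cn m \<subseteq> Cn n" if "m \<le> n" for m n
        using rmono[OF that] by (auto simp: Cn_def)
      have sep: "f A + f B \<le> f (A \<union> B)" if "A \<subseteq> Cn n" "B \<subseteq> T - Cn (Suc n)" "B \<subseteq> T" for A B n
      proof (rule metric[of "r n - r (Suc n)"])
        fix x y assume "x \<in> A" "y \<in> B"
        then have "r n \<le> infdist x C" "infdist y C < r (Suc n)" using that by (auto simp: Cn_def)
        then show "r n - r (Suc n) \<le> dist x y" using infd[of x y] by linarith
      qed (use r in auto)
      have part: "(\<Sum>i<n. f (D (2*i+e))) \<le> f (\<Union>i<n. D (2*i+e))" for n e
      proof (induction n)
        case 0 then show ?case by simp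
      next
        case (Suc n)
        have "f (\<Union>i<n. D (2*i+e)) + f (D (2*n+e)) \<le> f ((\<Union>i<n. D (2*i+e)) \<union> D (2*n+e))"
        proof (cases n)
          case 0 then show ?thesis by (simp add: pos)
        next
          case (Suc m)
          show ?thesis
          proof (rule sep[of _ "2*m+e+1"])
            have "D (2*i+e) \<subseteq> Cn (2*m+e+1)" if "i < n" for i
              using Cn_mono[of "Suc (2*i+e)" "2*m+e+1"] that Suc by (auto simp: D_def)
            then show "(\<Union>i<n. D (2*i+e)) \<subseteq> Cn (2*m+e+1)" by blast
          qed (use Suc in \<open>auto simp: D_def Cn_def\<close>)
        qed
        also have "(\<Union>i<n. D (2*i+e)) \<union> D (2*n+e) = (\<Union>i<Suc n. D (2*i+e))"
          by (auto simp: lessThan_Suc)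
        finally have "f (\<Union>i<n. D (2*i+e)) + f (D (2*n+e)) \<le> f (\<Union>i<Suc n. D (2*i+e))" .
        moreover have "(\<Sum>i<Suc n. f (D (2*i+e))) \<le> f (\<Union>i<n. D (2*i+e)) + f (D (2*n+e))"
          unfolding sum.lessThan_Suc using Suc.IH by (rule add_right_mono)
        ultimately show ?case by (rule order_trans[rotated])
      qed
      have DT: "D n \<subseteq> T" for n by (auto simp: D_def Cn_def)
      have half: "(\<Sum>i. f (D (2*i+e))) \<le> f T" for e
        by (intro suminf_le_const[OF summableI] order_trans[OF part] mono UN_least DT)
      have fsum: "(\<Sum>k. f (D k)) < \<infinity>"
      proof -
        have "(\<Sum>k<n. f (D k)) \<le> f T + f T" for n
        proof -
          have "(\<Sum>k<n. f (D k)) \<le> (\<Sum>k<2*n. f (D k))"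
            by (rule sum_mono2) auto
          also have "\<dots> = (\<Sum>k<n. f (D (2*k+0))) + (\<Sum>k<n. f (D (2*k+1)))"
            by (induction n) (auto simp: algebra_simps)
          also have "\<dots> \<le> f T + f T"
            using half by (intro add_mono order_trans[OF sum_le_suminf[OF summableI] half]) auto
          finally show ?thesis .
        qed
        then have "(\<Sum>k. f (D k)) \<le> f T + f T" by (intro suminf_le_const[OF summableI])
        also have "\<dots> < \<infinity>" using fin by (simp add: ennreal_add_less_top)
        finally show ?thesis .
      qed
      have cover: "T - C \<subseteq> Cn n \<union> (\<Union>k. D (k + n))" for n
      proof
        fix x assume x: "x \<in> T - C"
        then have "infdist x C > 0"
          using \<open>closed C\<close> False by (metis DiffD2 in_closed_iff_infdist_zero infdist_nonneg less_eq_real_def)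
        then obtain m where "r m < infdist x C"
          unfolding r_def using reals_Archimedean by (metis add.commute inverse_eq_divide of_nat_Suc)
        then have xm: "x \<in> Cn m" using x by (auto simp: Cn_def)
        define p where "p = (LEAST m. x \<in> Cn m)"
        have p: "x \<in> Cn p" "\<And>l. l < p \<Longrightarrow> x \<notin> Cn l"
          unfolding p_def using LeastI[of "\<lambda>m. x \<in> Cn m", OF xm] not_less_Least by auto
        show "x \<in> Cn n \<union> (\<Union>k. D (k + n))"
        proof (cases "p \<le> n")
          case True then show ?thesis using p Cn_mono by blast
        next
          case False
          then have "x \<in> D ((p - 1 - n) + n)" using p by (auto simp: D_def)
          then show ?thesis by blast
        qed
      qed
      have bound: "f (T \<inter> C) + f (T - C) \<le> f T + (\<Sum>k. f (D (k + n)))" for n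
      proof -
        have "f (T - C) \<le> f (Cn n) + (\<Sum>k. f (D (k + n)))"
          by (rule order_trans[OF mono[OF cover] order_trans[OF sub add_left_mono[OF csub]]])
        then have "f (T \<inter> C) + f (T - C) \<le> (f (Cn n) + f (T \<inter> C)) + (\<Sum>k. f (D (k + n)))"
          by (subst add.commute[of "f (Cn n)"], subst add.assoc) (rule add_left_mono)
        also have "f (Cn n) + f (T \<inter> C) \<le> f (Cn n \<union> (T \<inter> C))"
          using r(1)[of "Suc n"] by (intro sep[of _ n]) (auto simp: Cn_def not_le)
        also have "\<dots> \<le> f T" by (rule mono) (auto simp: Cn_def)
        finally show ?thesis by (simp add: add_right_mono)
      qed
      have "(\<lambda>n. \<Sum>k. f (D (k + n))) \<longlonglongrightarrow> 0"
        using fsum by (rule ennreal_suminf_tail_tendsto_0)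
      then have "(\<lambda>n. f T + (\<Sum>k. f (D (k + n)))) \<longlonglongrightarrow> f T + 0"
        by (intro tendsto_add tendsto_const)
      then show ?thesis
        using bound by (intro LIMSEQ_le_const[where X="\<lambda>n. f T + (\<Sum>k. f (D (k + n)))"]) auto
    qed
  qed
qed


section \<open>Hausdorff measure\<close>

definition hausdorff_weight :: "nat \<Rightarrow> 'a::metric_space set \<Rightarrow> ennreal" where
  "hausdorff_weight k C =
     (if C = {} then 0 else ennreal (unit_ball_vol (real k) * (diameter C / 2) ^ k))"

lemma hausdorff_weight_empty [simp]: "hausdorff_weight k {} = 0"
  by (simp add: hausdorff_weight_def)

text \<open>The coverings over which the infimum in \<^const>\<open>hausdorff_pre\<close> is taken.\<close>

definition hausdorff_covers :: "real \<Rightarrow> 'a::metric_space set \<Rightarrow> (nat \<Rightarrow> 'a set) set" where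
  "hausdorff_covers \<delta> A = {C. A \<subseteq> (\<Union>i. C i) \<and> (\<forall>i. bounded (C i) \<and> diameter (C i) \<le> \<delta>)}"

lemma hausdorff_pre_covers:
  "hausdorff_pre k \<delta> A = (INF C \<in> hausdorff_covers \<delta> A. \<Sum>i. hausdorff_weight k (C i))"
  by (simp add: hausdorff_pre_def hausdorff_covers_def hausdorff_weight_def)

lemma hausdorff_pre_mono: "A \<subseteq> B \<Longrightarrow> hausdorff_pre k \<delta> A \<le> hausdorff_pre k \<delta> B"
  unfolding hausdorff_pre_covers by (rule INF_superset_mono) (auto simp: hausdorff_covers_def)

lemma hausdorff_pre_antimono:
  assumes "\<delta> \<le> \<epsilon>"
  shows "hausdorff_pre k \<epsilon> A \<le> hausdorff_pre k \<delta> A"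
proof -
  have "C \<in> hausdorff_covers \<epsilon> A" if "C \<in> hausdorff_covers \<delta> A" for C
    using that order_trans[OF _ assms] by (simp add: hausdorff_covers_def)
  then show ?thesis
    unfolding hausdorff_pre_covers by (intro INF_superset_mono subsetI) simp_all
qed

lemma hausdorff_pre_empty: "0 \<le> \<delta> \<Longrightarrow> hausdorff_pre k \<delta> {} = 0"
proof -
  assume "0 \<le> \<delta>"
  then have "hausdorff_pre k \<delta> {} \<le> (\<Sum>i::nat. hausdorff_weight k ({}::'a set))"
    unfolding hausdorff_pre_covers
    by (intro INF_lower2[of "\<lambda>_. {}"]) (auto simp: hausdorff_covers_def)
  then show ?thesis by simp
qed

lemma hausdorff_pre_subadditive:
  fixes A :: "nat \<Rightarrow> 'a::metric_space set"
  shows "hausdorff_pre k \<delta> (\<Union>i. A i) \<le> (\<Sum>i. hausdorff_pre k \<delta> (A i))"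
proof (rule ennreal_le_epsilon)
  fix e :: real assume e: "0 < e" and "(\<Sum>i. hausdorff_pre k \<delta> (A i)) < top"
  then have fin: "hausdorff_pre k \<delta> (A i) < top" for i using ennreal_suminf_lessD by blast
  have "\<exists>C. C \<in> hausdorff_covers \<delta> (A i) \<and>
          (\<Sum>n. hausdorff_weight k (C n)) \<le> hausdorff_pre k \<delta> (A i) + ennreal (e * (1/2)^Suc i)" for i
  proof -
    have "hausdorff_pre k \<delta> (A i) < hausdorff_pre k \<delta> (A i) + ennreal (e * (1/2)^Suc i)"
      using fin[of i] e by simp
    then obtain C where "C \<in> hausdorff_covers \<delta> (A i)"
      "(\<Sum>n. hausdorff_weight k (C n)) < hausdorff_pre k \<delta> (A i) + ennreal (e * (1/2)^Suc i)"
      unfolding hausdorff_pre_covers[of k \<delta> "A i"] INF_less_iff by (elim bexE)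
    then show ?thesis by (intro exI[of _ C] conjI less_imp_le)
  qed
  then have "\<exists>C. \<forall>i. C i \<in> hausdorff_covers \<delta> (A i) \<and>
    (\<Sum>n. hausdorff_weight k (C i n)) \<le> hausdorff_pre k \<delta> (A i) + ennreal (e * (1/2)^Suc i)"
    by (intro choice allI)
  then obtain C where C0: "\<forall>i. C i \<in> hausdorff_covers \<delta> (A i) \<and>
    (\<Sum>n. hausdorff_weight k (C i n)) \<le> hausdorff_pre k \<delta> (A i) + ennreal (e * (1/2)^Suc i)"
    by (elim exE)
  note C = conjunct1[OF C0[rule_format]] conjunct2[OF C0[rule_format]]
  have "(\<lambda>p. C (fst (prod_decode p)) (snd (prod_decode p))) \<in> hausdorff_covers \<delta> (\<Union>i. A i)"
  proof -
    have "x \<in> (\<Union>p. C (fst (prod_decode p)) (snd (prod_decode p)))" if x: "x \<in> A i" for x i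
    proof -
      obtain n where "x \<in> C i n" using C(1)[of i] x unfolding hausdorff_covers_def by blast
      then show ?thesis by (intro UN_I[of "prod_encode (i, n)"]) auto
    qed
    then show ?thesis using C(1) by (auto simp: hausdorff_covers_def)
  qed
  then have "hausdorff_pre k \<delta> (\<Union>i. A i)
      \<le> (\<Sum>p. hausdorff_weight k (C (fst (prod_decode p)) (snd (prod_decode p))))"
    unfolding hausdorff_pre_covers by (rule INF_lower)
  also have "\<dots> = (\<Sum>i. \<Sum>n. hausdorff_weight k (C i n))"
    by (rule suminf_ennreal_2dimen[of _ "\<lambda>(i, n). hausdorff_weight k (C i n)", simplified case_prod_beta]) simp
  also have "\<dots> \<le> (\<Sum>i. hausdorff_pre k \<delta> (A i) + ennreal (e * (1/2)^Suc i))"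
    by (intro suminf_le C summableI)
  also have "\<dots> = (\<Sum>i. hausdorff_pre k \<delta> (A i)) + (\<Sum>i. ennreal (e * (1/2)^Suc i))"
    by (simp add: suminf_add)
  also have "(\<Sum>i. ennreal (e * (1/2)^Suc i)) = ennreal e"
  proof -
    have "(\<lambda>i. e * (1/2)^Suc i) sums (e * 1)"
      by (intro sums_mult power_half_series)
    then show ?thesis using e by (intro suminf_ennreal_eq) auto
  qed
  finally show "hausdorff_pre k \<delta> (\<Union>i. A i) \<le> (\<Sum>i. hausdorff_pre k \<delta> (A i)) + ennreal e" .
qed

text \<open>No set of diameter less than \<open>\<epsilon>\<close> meets both \<open>A\<close> and \<open>B\<close>, so a covering of the union splits into
  a covering of \<open>A\<close> and one of \<open>B\<close>.\<close>

lemma hausdorff_pre_separated: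
  assumes sep: "\<And>x y. x \<in> A \<Longrightarrow> y \<in> B \<Longrightarrow> \<epsilon> \<le> dist x y" and "0 \<le> \<delta>" "\<delta> < \<epsilon>"
  shows "hausdorff_pre k \<delta> A + hausdorff_pre k \<delta> B \<le> hausdorff_pre k \<delta> (A \<union> B)"
  unfolding hausdorff_pre_covers[of k \<delta> "A \<union> B"]
proof (rule INF_greatest)
  fix C assume C: "C \<in> hausdorff_covers \<delta> (A \<union> B)"
  define C1 where "C1 i = (if C i \<inter> A = {} then {} else C i)" for i
  define C2 where "C2 i = (if C i \<inter> B = {} then {} else C i)" for i
  have "C1 \<in> hausdorff_covers \<delta> A" "C2 \<in> hausdorff_covers \<delta> B"
  proof -
    have C': "A \<union> B \<subseteq> (\<Union>i. C i)" "\<And>i. bounded (C i)" "\<And>i. diameter (C i) \<le> \<delta>"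
      using C by (auto simp: hausdorff_covers_def)
    have "A \<subseteq> (\<Union>i. C1 i)" "B \<subseteq> (\<Union>i. C2 i)"
      using C'(1) unfolding C1_def C2_def by fastforce+
    then show "C1 \<in> hausdorff_covers \<delta> A" "C2 \<in> hausdorff_covers \<delta> B"
      using C'(2,3) \<open>0 \<le> \<delta>\<close> by (simp_all add: hausdorff_covers_def C1_def C2_def)
  qed
  then have "hausdorff_pre k \<delta> A + hausdorff_pre k \<delta> B
      \<le> (\<Sum>i. hausdorff_weight k (C1 i)) + (\<Sum>i. hausdorff_weight k (C2 i))"
    unfolding hausdorff_pre_covers by (intro add_mono INF_lower)
  also have "\<dots> = (\<Sum>i. hausdorff_weight k (C1 i) + hausdorff_weight k (C2 i))"
    by (simp add: suminf_add)
  also have "\<dots> \<le> (\<Sum>i. hausdorff_weight k (C i))"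
  proof (intro suminf_le summableI)
    fix i
    have "C i \<inter> A = {} \<or> C i \<inter> B = {}"
    proof (rule ccontr)
      assume "\<not> ?thesis"
      then obtain x y where xy: "x \<in> C i" "x \<in> A" "y \<in> C i" "y \<in> B" by blast
      then have "dist x y \<le> diameter (C i)"
        using C by (intro diameter_bounded_bound) (auto simp: hausdorff_covers_def)
      also have "\<dots> \<le> \<delta>" using C by (auto simp: hausdorff_covers_def)
      finally show False using sep[OF xy(2,4)] \<open>\<delta> < \<epsilon>\<close> by linarith
    qed
    then show "hausdorff_weight k (C1 i) + hausdorff_weight k (C2 i) \<le> hausdorff_weight k (C i)"
      by (auto simp: C1_def C2_def)
  qed
  finally show "hausdorff_pre k \<delta> A + hausdorff_pre k \<delta> B \<le> (\<Sum>i. hausdorff_weight k (C i))" .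
qed

lemma hausdorff_pre_le_outer: "0 < \<delta> \<Longrightarrow> hausdorff_pre k \<delta> A \<le> hausdorff_outer k A"
  unfolding hausdorff_outer_def by (rule SUP_upper) auto

lemma outer_measure_space_hausdorff: "outer_measure_space UNIV (hausdorff_outer k)"
  unfolding outer_measure_space_def positive_def increasing_def countably_subadditive_def
proof (intro conjI ballI impI allI)
  show "hausdorff_outer k {} = 0"
    by (auto simp: hausdorff_outer_def hausdorff_pre_empty intro!: SUP_eq_const)
next
  fix A B :: "'a set" assume "A \<subseteq> B"
  then show "hausdorff_outer k A \<le> hausdorff_outer k B"
    unfolding hausdorff_outer_def by (intro SUP_mono') (rule hausdorff_pre_mono)
next
  fix A :: "nat \<Rightarrow> 'a set"
  show "hausdorff_outer k (\<Union>i. A i) \<le> (\<Sum>i. hausdorff_outer k (A i))"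
    unfolding hausdorff_outer_def[of k "\<Union>i. A i"]
  proof (rule SUP_least)
    fix \<delta> :: real assume "\<delta> \<in> {0<..}"
    then show "hausdorff_pre k \<delta> (\<Union>i. A i) \<le> (\<Sum>i. hausdorff_outer k (A i))"
      by (intro order_trans[OF hausdorff_pre_subadditive] suminf_le hausdorff_pre_le_outer) auto
  qed
qed

lemma hausdorff_outer_separated:
  assumes "0 < \<epsilon>" and sep: "\<And>x y. x \<in> A \<Longrightarrow> y \<in> B \<Longrightarrow> \<epsilon> \<le> dist x y"
  shows "hausdorff_outer k A + hausdorff_outer k B \<le> hausdorff_outer k (A \<union> B)"
proof -
  have "hausdorff_pre k \<delta> A + hausdorff_pre k \<eta> B \<le> hausdorff_outer k (A \<union> B)"
    if "0 < \<delta>" "0 < \<eta>" for \<delta> \<eta>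
  proof -
    define \<zeta> where "\<zeta> = Min {\<delta>, \<eta>, \<epsilon>/2}"
    have \<zeta>: "0 < \<zeta>" "\<zeta> \<le> \<delta>" "\<zeta> \<le> \<eta>" "\<zeta> < \<epsilon>" using that \<open>0 < \<epsilon>\<close> by (auto simp: \<zeta>_def)
    have "hausdorff_pre k \<delta> A + hausdorff_pre k \<eta> B \<le> hausdorff_pre k \<zeta> A + hausdorff_pre k \<zeta> B"
      using \<zeta> by (intro add_mono hausdorff_pre_antimono)
    also have "\<dots> \<le> hausdorff_pre k \<zeta> (A \<union> B)"
      using \<zeta> by (intro hausdorff_pre_separated[OF sep]) auto
    also have "\<dots> \<le> hausdorff_outer k (A \<union> B)" using \<zeta>(1) by (rule hausdorff_pre_le_outer)
    finally show ?thesis .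
  qed
  then have "hausdorff_outer k A + hausdorff_pre k \<eta> B \<le> hausdorff_outer k (A \<union> B)" if "0 < \<eta>" for \<eta>
    unfolding hausdorff_outer_def[of k A] using that
    by (subst ennreal_SUP_add_left[symmetric]) (auto intro!: SUP_least)
  then have "(SUP \<eta>\<in>{0<..}. hausdorff_outer k A + hausdorff_pre k \<eta> B) \<le> hausdorff_outer k (A \<union> B)"
    by (intro SUP_least) auto
  then show ?thesis
    by (simp add: ennreal_SUP_add_right hausdorff_outer_def[of k B])
qed

lemma
  shows sets_borel_le_hausdorff: "sets borel \<subseteq> sets (hausdorff k :: 'a::metric_space measure)"
    and space_hausdorff [simp]: "space (hausdorff k :: 'a measure) = UNIV"
    and emeasure_hausdorff: "A \<in> sets (hausdorff k) \<Longrightarrow> emeasure (hausdorff k) A = hausdorff_outer k (A :: 'a set)"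
proof -
  let ?L = "lambda_system UNIV UNIV (hausdorff_outer k :: 'a set \<Rightarrow> ennreal)"
  interpret P: sigma_algebra "UNIV :: 'a set" "UNIV :: 'a set set"
    using sigma_algebra_Pow[of "UNIV :: 'a set"] by simp
  have ms: "measure_space UNIV ?L (hausdorff_outer k)"
    by (rule P.caratheodory_lemma[OF outer_measure_space_hausdorff])
  then interpret L: sigma_algebra "UNIV :: 'a set" ?L by (simp add: measure_space_def)
  have sets: "sets (hausdorff k :: 'a measure) = ?L"
    unfolding hausdorff_def by (rule L.sets_measure_of_eq)
  show "space (hausdorff k :: 'a measure) = UNIV"
    unfolding hausdorff_def by (simp add: space_measure_of_conv)
  show "emeasure (hausdorff k) A = hausdorff_outer k A" if "A \<in> sets (hausdorff k)" for A :: "'a set"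
    using ms that unfolding sets
    unfolding hausdorff_def measure_space_def by (intro emeasure_measure_of_sigma) auto
  have "C \<in> ?L" if "closed C" for C
    by (rule metric_outer_measure_closed[OF outer_measure_space_hausdorff hausdorff_outer_separated that])
  then have "sigma_sets UNIV (Collect closed) \<subseteq> ?L"
    by (intro L.sigma_sets_subset) blast
  moreover have "sets borel = sigma_sets UNIV (Collect closed :: 'a set set)"
    unfolding borel_eq_closed by (rule sets_measure_of) simp
  ultimately show "sets borel \<subseteq> sets (hausdorff k :: 'a measure)"
    unfolding sets by simp
qed

text \<open>A finite covering is padded with empty sets, which have no weight. This is the form in which
  grids bound the measure from above.\<close>

lemma hausdorff_outer_le_finite_cover:
  fixes A :: "'a::metric_space set"
  assumes cov: "\<And>\<delta>. 0 < \<delta> \<Longrightarrow> \<exists>(I::'i set) C d. finite I \<and> A \<subseteq> (\<Union>i\<in>I. C i) \<and> 0 \<le> d \<and> d \<le> \<delta> \<and>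
       (\<forall>i\<in>I. bounded (C i) \<and> diameter (C i) \<le> d) \<and>
       of_nat (card I) * ennreal (unit_ball_vol (real k) * (d / 2) ^ k) \<le> c"
  shows "hausdorff_outer k A \<le> c"
  unfolding hausdorff_outer_def
proof (rule SUP_least)
  fix \<delta> :: real assume "\<delta> \<in> {0<..}"
  then have "0 < \<delta>" by simp
  from cov[OF this] obtain I :: "'i set" and C d where all: "finite I \<and> A \<subseteq> (\<Union>i\<in>I. C i) \<and> 0 \<le> d \<and> d \<le> \<delta> \<and>
       (\<forall>i\<in>I. bounded (C i) \<and> diameter (C i) \<le> d) \<and>
       of_nat (card I) * ennreal (unit_ball_vol (real k) * (d / 2) ^ k) \<le> c"
    by (elim exE) (rule that)
  then have I: "finite I" "A \<subseteq> (\<Union>i\<in>I. C i)" "0 \<le> d" "d \<le> \<delta>"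
    "\<And>i. i \<in> I \<Longrightarrow> bounded (C i)" "\<And>i. i \<in> I \<Longrightarrow> diameter (C i) \<le> d"
    "of_nat (card I) * ennreal (unit_ball_vol (real k) * (d / 2) ^ k) \<le> c"
    by simp_all
  obtain h where h: "bij_betw h {0..<card I} I" using ex_bij_betw_nat_finite[OF I(1)] by blast
  define C' where "C' n = (if n < card I then C (h n) else {})" for n
  have hI: "h n \<in> I" if "n < card I" for n using h that by (auto simp: bij_betw_def)
  have "C' \<in> hausdorff_covers \<delta> A"
  proof -
    have "x \<in> (\<Union>n. C' n)" if x: "x \<in> A" for x
    proof -
      obtain i where i: "i \<in> I" "x \<in> C i" using I(2) x by blast
      then have "i \<in> h ` {0..<card I}" using h by (simp add: bij_betw_def)
      then obtain n where "n < card I" "h n = i" by auto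
      then show ?thesis using i by (intro UN_I[of n]) (auto simp: C'_def)
    qed
    moreover have "bounded (C' n) \<and> diameter (C' n) \<le> \<delta>" for n
      using I(3,4) I(5,6)[OF hI[of n]] by (cases "n < card I") (simp_all add: C'_def)
    ultimately show ?thesis by (auto simp: hausdorff_covers_def)
  qed
  then have "hausdorff_pre k \<delta> A \<le> (\<Sum>n. hausdorff_weight k (C' n))"
    unfolding hausdorff_pre_covers by (rule INF_lower)
  also have "\<dots> = (\<Sum>n<card I. hausdorff_weight k (C' n))"
    by (rule suminf_finite) (auto simp: C'_def)
  also have "\<dots> \<le> (\<Sum>n<card I. ennreal (unit_ball_vol (real k) * (d / 2) ^ k))"
  proof (rule sum_mono)
    fix n assume "n \<in> {..<card I}"
    then have "diameter (C' n) \<le> d" "bounded (C' n)" using I(5,6)[OF hI[of n]] by (simp_all add: C'_def)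
    then show "hausdorff_weight k (C' n) \<le> ennreal (unit_ball_vol (real k) * (d / 2) ^ k)"
      unfolding hausdorff_weight_def
      by (cases "C' n = {}") (simp_all add: ennreal_leI mult_left_mono power_mono divide_right_mono diameter_ge_0)
  qed
  also have "\<dots> \<le> c" using I(7) by simp
  finally show "hausdorff_pre k \<delta> A \<le> c" .
qed

text \<open>The image of a covering set under the 1-Lipschitz map \<open>p\<close> lies in the ball around one of its
  points whose radius is the diameter of the set. The constant is not optimal.\<close>

lemma hausdorff_outer_ge:
  fixes A :: "'a::metric_space set" and M :: "'b::metric_space measure"
  assumes M: "sets M = sets borel" and growth: "\<And>x r. 0 \<le> r \<Longrightarrow> emeasure M (cball x r) \<le> ennreal (g * r ^ k)"
    and "0 < g" and p: "\<And>x y. dist (p x) (p y) \<le> dist x y" and K: "K \<subseteq> p ` A" "K \<in> sets M"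
  shows "ennreal (unit_ball_vol k / (g * 2 ^ k)) * emeasure M K \<le> hausdorff_outer k A"
proof -
  let ?c = "unit_ball_vol k / (g * 2 ^ k)"
  have c: "0 \<le> ?c" using \<open>0 < g\<close> by simp
  have "ennreal ?c * emeasure M K \<le> hausdorff_pre k 1 A"
    unfolding hausdorff_pre_covers
  proof (rule INF_greatest)
    fix C assume C: "C \<in> hausdorff_covers 1 A"
    define S where "S i = (if C i = {} then {} else cball (p (SOME x. x \<in> C i)) (diameter (C i)))" for i
    have Ssets: "S i \<in> sets M" for i by (simp add: M S_def)
    have "K \<subseteq> (\<Union>i. S i)"
    proof
      fix y assume "y \<in> K"
      then obtain x where x: "x \<in> A" "y = p x" using K by blast
      then obtain i where i: "x \<in> C i" using C by (auto simp: hausdorff_covers_def)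
      then have "(SOME x. x \<in> C i) \<in> C i" by (rule someI)
      then have "dist (SOME x. x \<in> C i) x \<le> diameter (C i)"
        using C i by (intro diameter_bounded_bound) (auto simp: hausdorff_covers_def)
      then have "y \<in> S i" using i x(2) p[of "SOME x. x \<in> C i" x] by (auto simp: S_def)
      then show "y \<in> (\<Union>i. S i)" by blast
    qed
    then have "emeasure M K \<le> emeasure M (\<Union>i. S i)"
      using Ssets by (intro emeasure_mono) auto
    also have "\<dots> \<le> (\<Sum>i. emeasure M (S i))"
      using Ssets by (intro emeasure_subadditive_countably) auto
    finally have "ennreal ?c * emeasure M K \<le> ennreal ?c * (\<Sum>i. emeasure M (S i))"
      by (rule mult_left_mono) simp
    also have "\<dots> = (\<Sum>i. ennreal ?c * emeasure M (S i))" by simp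
    also have "\<dots> \<le> (\<Sum>i. hausdorff_weight k (C i))"
    proof (intro suminf_le summableI)
      fix i
      have "bounded (C i)" using C by (simp add: hausdorff_covers_def)
      then have "emeasure M (S i) \<le> ennreal (g * diameter (C i) ^ k)"
        by (auto simp: S_def intro: growth diameter_ge_0)
      then have "ennreal ?c * emeasure M (S i) \<le> ennreal ?c * ennreal (g * diameter (C i) ^ k)"
        by (rule mult_left_mono) simp
      also have "ennreal ?c * ennreal (g * diameter (C i) ^ k) = ennreal (?c * (g * diameter (C i) ^ k))"
        using c by (rule ennreal_mult'[symmetric])
      also have "?c * (g * diameter (C i) ^ k) = unit_ball_vol (real k) * (diameter (C i) / 2) ^ k"
        using \<open>0 < g\<close> by (simp add: power_divide)
      finally show "ennreal ?c * emeasure M (S i) \<le> hausdorff_weight k (C i)"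
        by (cases "C i = {}") (simp_all add: S_def hausdorff_weight_def)
    qed
    finally show "ennreal ?c * emeasure M K \<le> (\<Sum>i. hausdorff_weight k (C i))" .
  qed
  also have "\<dots> \<le> hausdorff_outer k A" by (rule hausdorff_pre_le_outer) simp
  finally show ?thesis .
qed


section \<open>Lebesgue measure on a linear subspace\<close>

definition orthonormal :: "'a::euclidean_space set \<Rightarrow> bool" where
  "orthonormal B \<longleftrightarrow> pairwise orthogonal B \<and> (\<forall>b\<in>B. norm b = 1)"

text \<open>Lebesgue measure on \<open>span B\<close> as a Borel measure on the ambient space. The measure
  \<^const>\<open>lebesgue_subspace\<close> is the completion of this one for the basis chosen there.\<close>

definition plane_measure :: "'a::euclidean_space set \<Rightarrow> 'a measure" where
  "plane_measure B = distr (\<Pi>\<^sub>M b\<in>B. (lborel :: real measure)) borel (\<lambda>f. \<Sum>b\<in>B. f b *\<^sub>R b)"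

text \<open>Not contained in the plane: the other coordinates are unrestricted, which makes these sets Borel
  without further ado and does not change their measure.\<close>

definition slab_box :: "'a::euclidean_space set \<Rightarrow> ('a \<Rightarrow> real set) \<Rightarrow> 'a set" where
  "slab_box B I = {x. \<forall>b\<in>B. x \<bullet> b \<in> I b}"

lemma lebesgue_subspace_plane_measure:
  fixes V :: "'a::euclidean_space set"
  assumes "subspace V"
  shows "\<exists>B. orthonormal B \<and> span B = V \<and> card B = dim V \<and>
             lebesgue_subspace V = completion (plane_measure B)"
proof -
  let ?P = "\<lambda>B. B \<subseteq> V \<and> pairwise orthogonal B \<and> (\<forall>b\<in>B. norm b = 1) \<and> span B = V"
  define B where "B = (SOME B. ?P B)"
  have "\<exists>B. ?P B" using orthonormal_basis_subspace[OF assms] by metis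
  then have B: "?P B" unfolding B_def by (rule someI_ex)
  have "0 \<notin> B" using B by force
  then have "independent B" using B by (intro pairwise_orthogonal_independent) auto
  then have "card B = dim V" using B by (metis dim_span_eq_card_independent)
  moreover have "lebesgue_subspace V = completion (plane_measure B)"
    unfolding lebesgue_subspace_def plane_measure_def B_def Let_def by simp
  ultimately show ?thesis using B unfolding orthonormal_def by blast
qed

text \<open>Used to sort points into dyadic shells around a centre.\<close>

lemma ex_power_two_bracket:
  assumes "1 \<le> (x::real)"
  shows "\<exists>i::nat. 2 ^ i \<le> x \<and> x < 2 ^ Suc i"
proof -
  obtain n where "x < 2 ^ n" using real_arch_pow[of 2 x] by auto
  define m where "m = (LEAST n::nat. x < 2 ^ n)"
  have m: "x < 2 ^ m" unfolding m_def by (rule LeastI) fact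
  have "m \<noteq> 0" using m assms by (intro notI) simp
  then obtain i where i: "m = Suc i" using not0_implies_Suc by blast
  then have "\<not> x < 2 ^ i" using not_less_Least[of i "\<lambda>n. x < 2 ^ n"] unfolding m_def by simp
  then show ?thesis using m i by (intro exI[of _ i]) auto
qed


locale orthonormal_set =
  fixes B :: "'a::euclidean_space set"
  assumes onb: "orthonormal B"
begin

lemma inner_basis: "b \<in> B \<Longrightarrow> c \<in> B \<Longrightarrow> b \<bullet> c = (if b = c then 1 else 0)"
  using onb by (auto simp: orthonormal_def pairwise_def orthogonal_def norm_eq_1)

lemma norm_basis: "b \<in> B \<Longrightarrow> norm b = 1"
  using onb by (auto simp: orthonormal_def)

lemma independent_basis: "independent B"
  using onb by (intro pairwise_orthogonal_independent) (auto simp: orthonormal_def)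

lemma finite_basis: "finite B"
  using independent_basis by (rule finiteI_independent)

lemma inner_sum_basis: "c \<in> B \<Longrightarrow> (\<Sum>b\<in>B. f b *\<^sub>R b) \<bullet> c = f c"
proof -
  assume c: "c \<in> B"
  have "(\<Sum>b\<in>B. f b *\<^sub>R b) \<bullet> c = (\<Sum>b\<in>B. if b = c then f b else 0)"
    unfolding inner_sum_left using c by (intro sum.cong) (auto simp: inner_basis)
  then show ?thesis using c finite_basis by (simp add: sum.delta)
qed

lemma abs_inner_basis_le: "b \<in> B \<Longrightarrow> \<bar>x \<bullet> b\<bar> \<le> norm x"
  using Cauchy_Schwarz_ineq2[of x b] norm_basis[of b] by simp

abbreviation "k \<equiv> card B"

lemma norm_comb_le:
  assumes "\<And>b. b \<in> B \<Longrightarrow> \<bar>u b\<bar> \<le> K"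
  shows "norm (\<Sum>b\<in>B. u b *\<^sub>R b) \<le> real k * K"
proof -
  have "norm (\<Sum>b\<in>B. u b *\<^sub>R b) \<le> (\<Sum>b\<in>B. \<bar>u b\<bar>)"
    by (rule order_trans[OF norm_sum]) (simp add: norm_basis)
  also have "\<dots> \<le> (\<Sum>b\<in>B. K)" by (intro sum_mono assms)
  finally show ?thesis by simp
qed

definition proj :: "'a \<Rightarrow>\<^sub>L 'a" where
  "proj = Blinfun (\<lambda>x. \<Sum>b\<in>B. (x \<bullet> b) *\<^sub>R b)"

lemma proj_apply: "proj x = (\<Sum>b\<in>B. (x \<bullet> b) *\<^sub>R b)"
  unfolding proj_def by (subst bounded_linear_Blinfun_apply) (auto intro!: bounded_linear_intros)

lemma proj_inner: "b \<in> B \<Longrightarrow> proj x \<bullet> b = x \<bullet> b"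
  by (simp add: proj_apply inner_sum_basis)

lemma proj_in_span: "proj x \<in> span B"
  unfolding proj_apply by (intro span_sum span_scale span_base)

lemma proj_orthogonal: "w \<in> span B \<Longrightarrow> (x - proj x) \<bullet> w = 0"
proof (induction w rule: span_induct_alt)
  case (step c b y)
  then show ?case by (simp add: inner_add_right inner_diff_left proj_inner)
qed simp

lemma proj_span: "x \<in> span B \<Longrightarrow> proj x = x"
proof -
  assume "x \<in> span B"
  then have "x - proj x \<in> span B" by (intro span_diff proj_in_span)
  from proj_orthogonal[OF this, of x] show ?thesis by simp
qed

lemma proj_orthogonal_comp: "x \<in> orthogonal_comp (span B) \<Longrightarrow> proj x = 0"
  unfolding proj_apply
  by (intro sum.neutral ballI) (auto simp: orthogonal_comp_def orthogonal_def inner_commute dest: span_base)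

lemma diff_proj_orthogonal_comp: "x - proj x \<in> orthogonal_comp (span B)"
  using proj_orthogonal by (auto simp: orthogonal_comp_def orthogonal_def inner_commute)

lemma norm_proj_le: "norm (proj x) \<le> norm x"
proof -
  have "norm (proj x) ^ 2 \<le> norm (proj x) ^ 2 + norm (x - proj x) ^ 2" by simp
  also have "\<dots> = norm x ^ 2"
    using proj_orthogonal[OF proj_in_span, of x x]
    by (simp add: power2_norm_eq_inner inner_diff_left inner_diff_right inner_commute algebra_simps)
  finally show ?thesis by simp
qed

lemma norm_proj: "norm proj \<le> 1"
  by (rule norm_blinfun_bound) (use norm_proj_le in auto)

sublocale prods: finite_product_sigma_finite "\<lambda>_::'a. lborel :: real measure" B
  by standard (rule finite_basis)

lemma measurable_sum_basis [measurable]: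
  "(\<lambda>f. \<Sum>b\<in>B. f b *\<^sub>R b) \<in> (\<Pi>\<^sub>M b\<in>B. (lborel :: real measure)) \<rightarrow>\<^sub>M borel"
  by measurable

lemma sets_plane_measure [simp, measurable_cong]: "sets (plane_measure B) = sets borel"
  and space_plane_measure [simp]: "space (plane_measure B) = UNIV"
  by (simp_all add: plane_measure_def)

lemma slab_box_sets [measurable]:
  assumes "\<And>b. b \<in> B \<Longrightarrow> I b \<in> sets borel"
  shows "slab_box B I \<in> sets borel"
proof -
  have "slab_box B I = (\<Inter>b\<in>B. (\<lambda>x. x \<bullet> b) -` I b \<inter> space borel)" by (auto simp: slab_box_def)
  also have "\<dots> \<in> sets borel"
  proof (cases "B = {}")
    case False
    then show ?thesis using assms finite_basis
      by (intro sets.finite_INT measurable_sets[of _ borel borel]) auto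
  qed simp
  finally show ?thesis .
qed

lemma nn_integral_plane_prod:
  assumes "\<And>b. b \<in> B \<Longrightarrow> h b \<in> borel_measurable borel"
  shows "(\<integral>\<^sup>+x. (\<Prod>b\<in>B. h b (x \<bullet> b)) \<partial>plane_measure B) = (\<Prod>b\<in>B. \<integral>\<^sup>+t. h b t \<partial>lborel)"
proof -
  have "(\<lambda>x. h b (x \<bullet> b)) \<in> borel_measurable borel" if "b \<in> B" for b
    by (rule measurable_compose[OF _ assms[OF that]]) simp
  then have [measurable]: "(\<lambda>x. \<Prod>b\<in>B. h b (x \<bullet> b)) \<in> borel_measurable borel"
    by (rule borel_measurable_prod_ennreal)
  have "(\<integral>\<^sup>+x. (\<Prod>b\<in>B. h b (x \<bullet> b)) \<partial>plane_measure B)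
      = (\<integral>\<^sup>+f. (\<Prod>b\<in>B. h b (f b)) \<partial>(\<Pi>\<^sub>M b\<in>B. (lborel :: real measure)))"
    unfolding plane_measure_def by (subst nn_integral_distr) (simp_all add: inner_sum_basis)
  also have "\<dots> = (\<Prod>b\<in>B. \<integral>\<^sup>+t. h b t \<partial>lborel)"
    by (rule prods.product_nn_integral_prod[OF finite_basis]) (simp add: assms)
  finally show ?thesis .
qed

lemma emeasure_plane_box:
  assumes "\<And>b. b \<in> B \<Longrightarrow> I b \<in> sets borel"
  shows "emeasure (plane_measure B) (slab_box B I) = (\<Prod>b\<in>B. emeasure lborel (I b))"
proof -
  have "indicator (slab_box B I) x = (\<Prod>b\<in>B. indicator (I b) (x \<bullet> b) :: ennreal)" for x
  proof (cases "x \<in> slab_box B I")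
    case False
    then obtain b where "b \<in> B" "x \<bullet> b \<notin> I b" by (auto simp: slab_box_def)
    then show ?thesis using False finite_basis by (simp add: prod_zero_iff) (auto simp: indicator_def)
  qed (simp add: slab_box_def)
  then have "emeasure (plane_measure B) (slab_box B I)
      = (\<integral>\<^sup>+x. (\<Prod>b\<in>B. indicator (I b) (x \<bullet> b)) \<partial>plane_measure B)"
    using slab_box_sets[OF assms] by (simp flip: nn_integral_indicator)
  also have "\<dots> = (\<Prod>b\<in>B. emeasure lborel (I b))"
    using assms by (subst nn_integral_plane_prod) auto
  finally show ?thesis .
qed

lemma AE_plane_span: "AE x in plane_measure B. x \<in> span B"
proof -
  have "closed (span B)" by (simp add: closed_subspace)
  then have "span B \<in> sets borel" by (rule borel_closed)
  moreover have "(\<Sum>b\<in>B. f b *\<^sub>R b) \<in> span B" for f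
    by (intro span_sum span_scale span_base)
  ultimately show ?thesis
    unfolding plane_measure_def by (subst AE_distr_iff) simp_all
qed

lemma cball_subset_slab_box: "cball x r \<subseteq> slab_box B (\<lambda>b. {x \<bullet> b - r .. x \<bullet> b + r})"
proof
  fix y assume y: "y \<in> cball x r"
  have "\<bar>y \<bullet> b - x \<bullet> b\<bar> \<le> r" if "b \<in> B" for b
    using abs_inner_basis_le[OF that, of "y - x"] y by (simp add: dist_norm norm_minus_commute inner_diff_left)
  then show "y \<in> slab_box B (\<lambda>b. {x \<bullet> b - r .. x \<bullet> b + r})"
    by (fastforce simp: slab_box_def abs_le_iff)
qed

lemma plane_measure_cball:
  assumes "0 \<le> r"
  shows "emeasure (plane_measure B) (cball x r) \<le> ennreal (2 ^ k * r ^ k)"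
proof -
  have "emeasure (plane_measure B) (cball x r)
      \<le> emeasure (plane_measure B) (slab_box B (\<lambda>b. {x \<bullet> b - r .. x \<bullet> b + r}))"
    using slab_box_sets[of "\<lambda>b. {x \<bullet> b - r .. x \<bullet> b + r}"]
    by (intro emeasure_mono cball_subset_slab_box) simp
  also have "\<dots> = (\<Prod>b\<in>B. ennreal (2 * r))"
    using assms by (subst emeasure_plane_box) (auto intro!: prod.cong)
  also have "\<dots> = ennreal (2 ^ k * r ^ k)"
    using assms by (simp add: ennreal_power power_mult_distrib)
  finally show ?thesis .
qed

sublocale plane: sigma_finite_measure "plane_measure B"
proof
  let ?A = "range (\<lambda>n::nat. cball (0::'a) (real n))"
  have "emeasure (plane_measure B) a \<noteq> \<infinity>" if a: "a \<in> ?A" for a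
  proof -
    obtain n where an: "a = cball 0 (real n)" using a by auto
    have "emeasure (plane_measure B) a < \<infinity>"
      unfolding an by (rule le_less_trans[OF plane_measure_cball]) auto
    then show ?thesis by simp
  qed
  moreover have "\<exists>n. norm x \<le> real n" for x :: 'a using real_arch_simple by blast
  ultimately show "\<exists>A. countable A \<and> A \<subseteq> sets (plane_measure B) \<and> \<Union> A = space (plane_measure B) \<and>
       (\<forall>a\<in>A. emeasure (plane_measure B) a \<noteq> \<infinity>)"
    by (intro exI[of _ ?A]) auto
qed

end


section \<open>Singular integrals against measures of polynomial growth\<close>

text \<open>Upper Ahlfors regularity is all that the estimates of the kernels \<open>dist(x,y)\<^sup>\<gamma>\<^sup>-\<^sup>k\<close> use, so
  the same estimates serve for the planes and for the line.\<close>

locale growth_measure =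
  fixes M :: "'a::euclidean_space measure" and g :: real and k :: nat
  assumes sets_M [simp, measurable_cong]: "sets M = sets borel"
    and g_pos: "0 < g"
    and growth: "0 \<le> r \<Longrightarrow> emeasure M (cball x r) \<le> ennreal (g * r ^ k)"
begin

text \<open>On a dyadic shell the kernel is constant up to a factor, and the shell lies in a ball.\<close>

lemma shell_integral:
  fixes a \<gamma> :: real
  assumes "0 < a"
  shows "(\<integral>\<^sup>+y. indicator {y. a \<le> dist x y \<and> dist x y \<le> 2 * a} y * ennreal (dist x y powr (\<gamma> - k)) \<partial>M)
      \<le> ennreal (g * 2 ^ k * 2 powr \<bar>\<gamma>\<bar> * a powr \<gamma>)"
proof -
  have bound: "dist x y powr (\<gamma> - k) \<le> 2 powr \<bar>\<gamma>\<bar> * a powr \<gamma> * a powr (- real k)"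
    if "a \<le> dist x y" "dist x y \<le> 2 * a" for y
  proof -
    have "dist x y powr \<gamma> \<le> 2 powr \<bar>\<gamma>\<bar> * a powr \<gamma>"
    proof (cases "0 \<le> \<gamma>")
      case True
      then have "dist x y powr \<gamma> \<le> (2 * a) powr \<gamma>" using that by (intro powr_mono2) auto
      then show ?thesis using True assms by (simp add: powr_mult)
    next
      case False
      then have "dist x y powr \<gamma> \<le> a powr \<gamma>" using that assms by (intro powr_mono2') auto
      moreover have "1 \<le> (2::real) powr \<bar>\<gamma>\<bar>" by (rule ge_one_powr_ge_zero) auto
      ultimately show ?thesis using mult_right_mono[of 1 "2 powr \<bar>\<gamma>\<bar>" "a powr \<gamma>"] by simp
    qed
    moreover have "dist x y powr (- real k) \<le> a powr (- real k)"
      using that assms by (intro powr_mono2') auto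
    ultimately have "dist x y powr \<gamma> * dist x y powr (- real k) \<le> 2 powr \<bar>\<gamma>\<bar> * a powr \<gamma> * a powr (- real k)"
      by (intro mult_mono) auto
    then show ?thesis by (simp flip: powr_add)
  qed
  let ?c = "2 powr \<bar>\<gamma>\<bar> * a powr \<gamma> * a powr (- real k)"
  have "(\<integral>\<^sup>+y. indicator {y. a \<le> dist x y \<and> dist x y \<le> 2 * a} y * ennreal (dist x y powr (\<gamma> - k)) \<partial>M)
     \<le> (\<integral>\<^sup>+y. ennreal ?c * indicator (cball x (2 * a)) y \<partial>M)"
    using bound by (intro nn_integral_mono) (auto simp: indicator_def intro!: ennreal_leI)
  also have "\<dots> = ennreal ?c * emeasure M (cball x (2 * a))"
    by (intro nn_integral_cmult_indicator) simp
  also have "\<dots> \<le> ennreal ?c * ennreal (g * (2 * a) ^ k)"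
    using assms by (intro mult_left_mono growth) auto
  also have "\<dots> = ennreal (?c * (g * (2 * a) ^ k))"
    using g_pos assms by (simp add: ennreal_mult')
  also have "?c * (g * (2 * a) ^ k) = g * 2 ^ k * 2 powr \<bar>\<gamma>\<bar> * a powr \<gamma>"
    using assms by (simp add: powr_minus powr_realpow power_mult_distrib field_simps)
  finally show ?thesis .
qed

text \<open>The common part of the two integrals below. If the radii \<open>a\<^sub>i\<close> run through \<open>\<delta> 2\<^sup>-\<^sup>i\<close> and \<open>\<gamma> > 0\<close>, or through
  \<open>\<delta> 2\<^sup>i\<close> and \<open>\<gamma> < 0\<close>, the contributions of the shells decay geometrically. The centre itself does not
  count, since \<open>0 powr a = 0\<close>.\<close>

lemma shells_integral:
  fixes \<delta> \<gamma> :: real and a :: "nat \<Rightarrow> real"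
  assumes "\<gamma> \<noteq> 0" "0 < \<delta>"
    and cover: "\<And>y. y \<in> S \<Longrightarrow> y \<noteq> x \<Longrightarrow> \<exists>i::nat. a i \<le> dist x y \<and> dist x y \<le> 2 * a i"
    and a: "\<And>i. 0 < a i" "\<And>i. a i powr \<gamma> \<le> \<delta> powr \<gamma> * (2 powr (- \<bar>\<gamma>\<bar>)) ^ i"
  shows "(\<integral>\<^sup>+y. indicator S y * ennreal (dist x y powr (\<gamma> - k)) \<partial>M)
      \<le> ennreal (g * 2 ^ k * 2 powr \<bar>\<gamma>\<bar> / (1 - 2 powr (- \<bar>\<gamma>\<bar>)) * \<delta> powr \<gamma>)"
proof -
  let ?f = "\<lambda>y. ennreal (dist x y powr (\<gamma> - k))"
  let ?T = "\<lambda>i. {y. a i \<le> dist x y \<and> dist x y \<le> 2 * a i}"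
  let ?\<theta> = "2 powr (- \<bar>\<gamma>\<bar>)"
  let ?c = "g * 2 ^ k * 2 powr \<bar>\<gamma>\<bar> * \<delta> powr \<gamma>"
  have \<theta>: "0 \<le> ?\<theta>" "?\<theta> < 1" using assms(1) by (auto simp: powr_less_one)
  have "(\<integral>\<^sup>+y. indicator S y * ?f y \<partial>M) \<le> (\<integral>\<^sup>+y. (\<Sum>i. indicator (?T i) y * ?f y) \<partial>M)"
  proof (rule nn_integral_mono)
    fix y
    show "indicator S y * ?f y \<le> (\<Sum>i. indicator (?T i) y * ?f y)"
    proof (cases "y \<in> S \<and> y \<noteq> x")
      case True
      then obtain i where "y \<in> ?T i" using cover by blast
      then have "indicator S y * ?f y = (\<Sum>i\<in>{i}. indicator (?T i) y * ?f y)" using True by simp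
      also have "\<dots> \<le> (\<Sum>i. indicator (?T i) y * ?f y)" by (intro sum_le_suminf summableI) auto
      finally show ?thesis .
    qed auto
  qed
  also have "\<dots> = (\<Sum>i. \<integral>\<^sup>+y. indicator (?T i) y * ?f y \<partial>M)"
    by (intro nn_integral_suminf) measurable
  also have "\<dots> \<le> (\<Sum>i. ennreal (?c * ?\<theta> ^ i))"
  proof (intro suminf_le summableI order_trans[OF shell_integral] ennreal_leI a)
    fix i
    have "g * 2 ^ k * 2 powr \<bar>\<gamma>\<bar> * a i powr \<gamma> \<le> g * 2 ^ k * 2 powr \<bar>\<gamma>\<bar> * (\<delta> powr \<gamma> * ?\<theta> ^ i)"
      using g_pos by (intro mult_left_mono a) auto
    then show "g * 2 ^ k * 2 powr \<bar>\<gamma>\<bar> * a i powr \<gamma> \<le> ?c * ?\<theta> ^ i" by (simp add: mult.assoc)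
  qed
  also have "\<dots> = ennreal (?c * (1 / (1 - ?\<theta>)))"
    using \<theta> g_pos by (intro suminf_ennreal_eq sums_mult geometric_sums) auto
  finally show ?thesis by (simp add: mult.commute mult.left_commute)
qed

lemma near_integral:
  fixes \<gamma> :: real
  assumes "0 < \<gamma>"
  shows "\<exists>C\<ge>0. \<forall>x \<delta>. 0 < \<delta> \<longrightarrow>
    (\<integral>\<^sup>+y. indicator {y. dist x y < \<delta>} y * ennreal (dist x y powr (\<gamma> - k)) \<partial>M) \<le> ennreal (C * \<delta> powr \<gamma>)"
proof (intro exI conjI allI impI)
  show "0 \<le> g * 2 ^ k * 2 powr \<bar>\<gamma>\<bar> / (1 - 2 powr (- \<bar>\<gamma>\<bar>))"
    using g_pos assms by (intro divide_nonneg_nonneg) (auto intro!: less_imp_le[OF powr_less_one])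
next
  fix x :: 'a and \<delta> :: real assume \<delta>: "0 < \<delta>"
  show "(\<integral>\<^sup>+y. indicator {y. dist x y < \<delta>} y * ennreal (dist x y powr (\<gamma> - k)) \<partial>M)
      \<le> ennreal (g * 2 ^ k * 2 powr \<bar>\<gamma>\<bar> / (1 - 2 powr (- \<bar>\<gamma>\<bar>)) * \<delta> powr \<gamma>)"
  proof (rule shells_integral[where a="\<lambda>i. \<delta> / 2 ^ Suc i"])
    fix y assume y: "y \<in> {y. dist x y < \<delta>}" "y \<noteq> x"
    then have "1 \<le> \<delta> / dist x y" by simp
    from ex_power_two_bracket[OF this] obtain i where "2 ^ i \<le> \<delta> / dist x y" "\<delta> / dist x y < 2 ^ Suc i"
      by blast
    then show "\<exists>i. \<delta> / 2 ^ Suc i \<le> dist x y \<and> dist x y \<le> 2 * (\<delta> / 2 ^ Suc i)"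
      using y by (intro exI[of _ i]) (auto simp: field_simps)
  next
    fix i
    have "(\<delta> / 2 ^ Suc i) powr \<gamma> \<le> (\<delta> / 2 ^ i) powr \<gamma>"
      using \<delta> assms by (intro powr_mono2) (auto simp: field_simps)
    also have "\<dots> = \<delta> powr \<gamma> * (2 powr (- \<bar>\<gamma>\<bar>)) ^ i"
      using \<delta> assms by (simp add: powr_divide powr_minus_divide powr_power power_divide powr_powr
          flip: powr_realpow) (simp add: mult.commute)
    finally show "(\<delta> / 2 ^ Suc i) powr \<gamma> \<le> \<delta> powr \<gamma> * (2 powr (- \<bar>\<gamma>\<bar>)) ^ i" .
  qed (use assms \<delta> in auto)
qed

lemma tail_integral:
  fixes \<beta> :: real
  assumes "0 < \<beta>"
  shows "\<exists>C\<ge>0. \<forall>x \<delta>. 0 < \<delta> \<longrightarrow>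
    (\<integral>\<^sup>+y. indicator {y. \<delta> \<le> dist x y} y * ennreal (dist x y powr (- \<beta> - k)) \<partial>M) \<le> ennreal (C * \<delta> powr (- \<beta>))"
proof (intro exI conjI allI impI)
  show "0 \<le> g * 2 ^ k * 2 powr \<bar>- \<beta>\<bar> / (1 - 2 powr (- \<bar>- \<beta>\<bar>))"
    using g_pos assms by (intro divide_nonneg_nonneg) (auto intro!: less_imp_le[OF powr_less_one])
next
  fix x :: 'a and \<delta> :: real assume \<delta>: "0 < \<delta>"
  show "(\<integral>\<^sup>+y. indicator {y. \<delta> \<le> dist x y} y * ennreal (dist x y powr (- \<beta> - k)) \<partial>M)
      \<le> ennreal (g * 2 ^ k * 2 powr \<bar>- \<beta>\<bar> / (1 - 2 powr (- \<bar>- \<beta>\<bar>)) * \<delta> powr (- \<beta>))"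
  proof (rule shells_integral[where a="\<lambda>i. \<delta> * 2 ^ i"])
    fix y assume y: "y \<in> {y. \<delta> \<le> dist x y}" "y \<noteq> x"
    then have "1 \<le> dist x y / \<delta>" using \<delta> by simp
    from ex_power_two_bracket[OF this] obtain i where "2 ^ i \<le> dist x y / \<delta>" "dist x y / \<delta> < 2 ^ Suc i"
      by blast
    then show "\<exists>i. \<delta> * 2 ^ i \<le> dist x y \<and> dist x y \<le> 2 * (\<delta> * 2 ^ i)"
      using \<delta> by (intro exI[of _ i]) (auto simp: field_simps)
  next
    fix i
    show "(\<delta> * 2 ^ i) powr (- \<beta>) \<le> \<delta> powr (- \<beta>) * (2 powr (- \<bar>- \<beta>\<bar>)) ^ i"
      using \<delta> assms by (simp add: powr_mult powr_power powr_powr flip: powr_realpow)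
  qed (use assms \<delta> in auto)
qed

end


section \<open>Hausdorff measure of Lipschitz graphs\<close>

context orthonormal_set
begin

definition grid_index :: "real \<Rightarrow> 'a \<Rightarrow> 'a \<Rightarrow> int" where
  "grid_index h z = (\<lambda>b\<in>B. \<lfloor>z \<bullet> b / h\<rfloor>)"

lemma grid_cell_box:
  assumes "0 < h" "i \<in> extensional B"
  shows "{z. grid_index h z = i} = slab_box B (\<lambda>b. {h * i b ..< h * (i b + 1)})"
proof -
  have "grid_index h z = i \<longleftrightarrow> (\<forall>b\<in>B. \<lfloor>z \<bullet> b / h\<rfloor> = i b)" for z
    using assms(2) by (auto simp: grid_index_def fun_eq_iff extensional_def restrict_def)
  also have "\<dots>z \<longleftrightarrow> z \<in> slab_box B (\<lambda>b. {h * i b ..< h * (i b + 1)})" for z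
    using assms(1) by (auto simp: slab_box_def floor_eq_iff field_simps)
  finally show ?thesis by auto
qed

text \<open>The comparison with the sum of the coordinates costs a factor of at most \<open>k\<close> and saves the
  Euclidean norm.\<close>

lemma norm_le_sum_basis:
  assumes "z \<in> span B"
  shows "norm z \<le> (\<Sum>b\<in>B. \<bar>z \<bullet> b\<bar>)"
proof -
  obtain u where u: "z = (\<Sum>b\<in>B. u b *\<^sub>R b)" using assms finite_basis by (auto simp: span_finite)
  then have "z = (\<Sum>b\<in>B. (z \<bullet> b) *\<^sub>R b)"
    unfolding u by (intro sum.cong) (simp_all add: inner_sum_basis)
  then have "norm z \<le> (\<Sum>b\<in>B. norm ((z \<bullet> b) *\<^sub>R b))" by (metis norm_sum)
  also have "\<dots> = (\<Sum>b\<in>B. \<bar>z \<bullet> b\<bar>)" by (intro sum.cong) (auto simp: norm_basis)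
  finally show ?thesis .
qed

lemma same_grid_cell_dist:
  assumes "0 < h" "z \<in> span B" "w \<in> span B" "grid_index h z = grid_index h w"
  shows "dist z w \<le> real k * h"
proof -
  have "\<bar>(z - w) \<bullet> b\<bar> \<le> h" if "b \<in> B" for b
  proof -
    have "\<lfloor>z \<bullet> b / h\<rfloor> = \<lfloor>w \<bullet> b / h\<rfloor>"
      using fun_cong[OF assms(4), of b] that by (simp add: grid_index_def)
    then have "\<bar>z \<bullet> b / h - w \<bullet> b / h\<bar> \<le> 1" by linarith
    then show ?thesis using assms(1) by (simp add: inner_diff_left abs_divide flip: diff_divide_distrib)
  qed
  then have "(\<Sum>b\<in>B. \<bar>(z - w) \<bullet> b\<bar>) \<le> real k * h" 
    using sum_bounded_above[of B "\<lambda>b. \<bar>(z - w) \<bullet> b\<bar>" h] by auto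
  then show ?thesis
    using norm_le_sum_basis[of "z - w"] assms(2,3) by (simp add: dist_norm span_diff)
qed

lemma finite_grid_index:
  assumes "0 < h" "bounded Z"
  shows "finite (grid_index h ` Z)"
proof -
  obtain r where r: "\<And>z. z \<in> Z \<Longrightarrow> norm z \<le> r" using assms(2) by (auto simp: bounded_iff)
  have "grid_index h ` Z \<subseteq> (\<Pi>\<^sub>E b\<in>B. {\<lfloor>- r / h\<rfloor> .. \<lfloor>r / h\<rfloor>})"
  proof (clarsimp simp: PiE_iff grid_index_def)
    fix z b assume "z \<in> Z" "b \<in> B"
    then have "\<bar>z \<bullet> b\<bar> \<le> r" using abs_inner_basis_le[of b z] r[of z] by linarith
    then have "- r \<le> z \<bullet> b" "z \<bullet> b \<le> r" by auto
    then show "\<lfloor>- (r / h)\<rfloor> \<le> \<lfloor>z \<bullet> b / h\<rfloor> \<and> \<lfloor>z \<bullet> b / h\<rfloor> \<le> \<lfloor>r / h\<rfloor>"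
      using divide_right_mono[of "- r" "z \<bullet> b" h] divide_right_mono[of "z \<bullet> b" r h] assms(1)
      by (intro conjI floor_mono) auto
  qed
  then show ?thesis by (rule finite_subset) (intro finite_PiE finite_basis; simp)
qed

text \<open>The cells of side \<open>h\<close> that meet \<open>Z\<close> are disjoint, have measure \<open>h\<^sup>k\<close>, and lie in a thin
  neighbourhood of \<open>Z\<close>.\<close>

lemma card_grid_cells_le:
  assumes h: "0 < h" and Z: "bounded Z" "Z \<subseteq> span B"
  shows "of_nat (card (grid_index h ` Z)) * ennreal (h ^ k)
      \<le> emeasure (plane_measure B) {z. infdist z Z \<le> real k * h}"
proof -
  let ?I = "grid_index h ` Z" and ?cell = "\<lambda>i. {z. grid_index h z = i}"
  have box: "?cell i = slab_box B (\<lambda>b. {h * i b ..< h * (i b + 1)})" if "i \<in> ?I" for i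
    using that by (intro grid_cell_box h) (auto simp: grid_index_def)
  have cell_sets: "?cell i \<in> sets (plane_measure B)" if "i \<in> ?I" for i
    unfolding box[OF that] by (simp add: slab_box_sets)
  have "emeasure (plane_measure B) (?cell i) = ennreal (h ^ k)" if "i \<in> ?I" for i
  proof -
    have "emeasure lborel {h * i b ..< h * (i b + 1)} = ennreal h" for b
      using h by (simp add: algebra_simps)
    then show ?thesis
      unfolding box[OF that] by (subst emeasure_plane_box) (use h in \<open>simp_all add: ennreal_power\<close>)
  qed
  then have "of_nat (card ?I) * ennreal (h ^ k) = (\<Sum>i\<in>?I. emeasure (plane_measure B) (?cell i))"
    by simp
  also have "\<dots> = emeasure (plane_measure B) (\<Union>i\<in>?I. ?cell i)"
    using finite_grid_index[OF h Z(1)] cell_sets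
    by (intro sum_emeasure) (auto simp: disjoint_family_on_def)
  also have "\<dots> \<le> emeasure (plane_measure B) {z. infdist z Z \<le> real k * h}"
  proof (rule emeasure_mono_AE)
    show "AE z in plane_measure B. z \<in> (\<Union>i\<in>?I. ?cell i) \<longrightarrow> z \<in> {z. infdist z Z \<le> real k * h}"
      using AE_plane_span
    proof eventually_elim
      case (elim z)
      have "infdist z Z \<le> real k * h" if w: "w \<in> Z" "grid_index h z = grid_index h w" for w
      proof -
        have "dist z w \<le> real k * h" using w Z elim h by (intro same_grid_cell_dist) auto
        then show ?thesis using infdist_le[OF w(1), of z] by linarith
      qed
      then show ?case by auto
    qed
    have "closed {z. infdist z Z \<le> real k * h}" by (intro closed_Collect_le continuous_intros)
    then show "{z. infdist z Z \<le> real k * h} \<in> sets (plane_measure B)" by simp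
  qed
  finally show ?thesis .
qed

text \<open>The images of the cells that meet \<open>Z\<close> cover the image of \<open>Z\<close>. As the side of the cells tends to zero,
  the neighbourhoods in \<open>card_grid_cells_le\<close> shrink to \<open>Z\<close>, because \<open>Z\<close> is compact.\<close>

lemma hausdorff_Lipschitz_image_compact:
  fixes F :: "'a \<Rightarrow> 'b::metric_space"
  assumes Z: "compact Z" "Z \<subseteq> span B" and \<Lambda>: "0 < \<Lambda>"
    and F: "\<And>x y. x \<in> span B \<Longrightarrow> y \<in> span B \<Longrightarrow> dist (F x) (F y) \<le> \<Lambda> * dist x y"
  shows "hausdorff_outer k (F ` Z)
      \<le> ennreal (unit_ball_vol k * (\<Lambda> * k / 2) ^ k) * emeasure (plane_measure B) Z"
proof (cases "Z = {}")
  case True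
  then show ?thesis
    using outer_measure_space_hausdorff[where 'a='b and k=k] by (simp add: outer_measure_space_def positive_def)
next
  case False
  define h :: "nat \<Rightarrow> real" where "h m = 1 / 2 ^ m" for m
  let ?c = "ennreal (unit_ball_vol k * (\<Lambda> * k / 2) ^ k)"
  let ?T = "\<lambda>m. {z. infdist z Z \<le> real k * h m}"
  have h: "0 < h m" for m by (simp add: h_def)
  have h_mono: "h n \<le> h m" if "m \<le> n" for m n
    using that by (auto simp: h_def field_simps intro: power_increasing)
  have h_lim: "h \<longlonglongrightarrow> 0"
    unfolding h_def using LIMSEQ_realpow_zero[of "1/2::real"] by (simp add: power_divide)
  have Tsets: "?T m \<in> sets (plane_measure B)" for m
  proof -
    have "closed (?T m)" by (intro closed_Collect_le continuous_intros)
    then show ?thesis by simp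
  qed
  have T_mono: "?T n \<subseteq> ?T m" if "m \<le> n" for m n
    using mult_left_mono[OF h_mono[OF that], of "real k"] by auto
  have bound: "hausdorff_outer k (F ` Z) \<le> ?c * emeasure (plane_measure B) (?T m)" for m
  proof (rule hausdorff_outer_le_finite_cover)
    fix \<delta> :: real assume "0 < \<delta>"
    have "(\<lambda>n. \<Lambda> * real k * h n) \<longlonglongrightarrow> \<Lambda> * real k * 0" by (intro tendsto_intros h_lim)
    then have "\<forall>\<^sub>F n in sequentially. \<Lambda> * real k * h n < \<delta>"
      using \<open>0 < \<delta>\<close> by (intro order_tendstoD) auto
    then obtain n where n: "m \<le> n" "\<Lambda> * real k * h n < \<delta>"
      using eventually_ge_at_top[of m] by (metis (mono_tags, lifting) eventually_conj eventually_sequentially le_refl)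
    let ?I = "grid_index (h n) ` Z"
    define C where "C i = F ` {z\<in>Z. grid_index (h n) z = i}" for i
    have d: "dist u v \<le> \<Lambda> * real k * h n" if uv: "u \<in> C i" "v \<in> C i" for u v i
    proof -
      obtain z w where zw: "u = F z" "v = F w" "z \<in> Z" "w \<in> Z" "grid_index (h n) z = grid_index (h n) w"
        using uv by (auto simp: C_def)
      then have "dist z w \<le> real k * h n" using h Z by (intro same_grid_cell_dist) auto
      then have "\<Lambda> * dist z w \<le> \<Lambda> * (real k * h n)" using \<Lambda> by (intro mult_left_mono) auto
      moreover have "z \<in> span B" "w \<in> span B" using zw Z by blast+
      ultimately show ?thesis using F[of z w] zw(1,2) by (simp add: mult.assoc)
    qed
    have d0: "0 \<le> \<Lambda> * real k * h n" using \<Lambda> h[of n] by simp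
    have Cd: "bounded (C i) \<and> diameter (C i) \<le> \<Lambda> * real k * h n" for i
    proof (cases "C i = {}")
      case True then show ?thesis using d0 by simp
    next
      case False
      then obtain u where "u \<in> C i" by blast
      then have "bounded (C i)" using d unfolding bounded_def by blast
      moreover have "diameter (C i) \<le> \<Lambda> * real k * h n"
        using False d unfolding diameter_def by (auto intro!: cSUP_least)
      ultimately show ?thesis by simp
    qed
    have "of_nat (card ?I) * ennreal (unit_ball_vol (real k) * (\<Lambda> * real k * h n / 2) ^ k)
        = ?c * (of_nat (card ?I) * ennreal (h n ^ k))"
    proof -
      have "unit_ball_vol (real k) * (\<Lambda> * real k * h n / 2) ^ k
          = unit_ball_vol (real k) * (\<Lambda> * real k / 2) ^ k * h n ^ k"
        by (simp add: power_mult_distrib power_divide)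
      then show ?thesis using \<Lambda> h[of n] by (simp only: ennreal_mult'' zero_le_power less_imp_le) (simp add: mult_ac)
    qed
    also have "\<dots> \<le> ?c * emeasure (plane_measure B) (?T n)"
      using Z h by (intro mult_left_mono card_grid_cells_le compact_imp_bounded) auto
    also have "\<dots> \<le> ?c * emeasure (plane_measure B) (?T m)"
      using T_mono[OF n(1)] Tsets by (intro mult_left_mono emeasure_mono) auto
    finally have "of_nat (card ?I) * ennreal (unit_ball_vol (real k) * (\<Lambda> * real k * h n / 2) ^ k)
        \<le> ?c * emeasure (plane_measure B) (?T m)" .
    moreover have "finite ?I" using Z h by (intro finite_grid_index compact_imp_bounded) auto
    moreover have "F ` Z \<subseteq> (\<Union>i\<in>?I. C i)" by (auto simp: C_def)
    ultimately show "\<exists>(I::('a \<Rightarrow> int) set) C d. finite I \<and> F ` Z \<subseteq> (\<Union>i\<in>I. C i) \<and> 0 \<le> d \<and> d \<le> \<delta> \<and>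
        (\<forall>i\<in>I. bounded (C i) \<and> diameter (C i) \<le> d) \<and>
        of_nat (card I) * ennreal (unit_ball_vol (real k) * (d / 2) ^ k) \<le> ?c * emeasure (plane_measure B) (?T m)"
      using Cd d0 less_imp_le[OF n(2)]
      by (intro exI[of _ ?I] exI[of _ C] exI[of _ "\<Lambda> * real k * h n"] conjI ballI) simp_all
  qed
  have "(\<lambda>m. emeasure (plane_measure B) (?T m)) \<longlonglongrightarrow> emeasure (plane_measure B) (\<Inter>m. ?T m)"
  proof (rule Lim_emeasure_decseq)
    show "decseq ?T" using T_mono by (auto simp: decseq_def)
    show "range ?T \<subseteq> sets (plane_measure B)" using Tsets by blast
    fix m
    obtain r where r: "\<And>z. z \<in> Z \<Longrightarrow> norm z \<le> r"
      using compact_imp_bounded[OF Z(1)] by (auto simp: bounded_iff)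
    have "?T m \<subseteq> cball 0 (\<bar>r\<bar> + real k * h m)"
    proof
      fix z assume z: "z \<in> ?T m"
      obtain w where w: "w \<in> Z" "infdist z Z = dist z w"
        using infdist_attains_inf[OF compact_imp_closed[OF Z(1)] False] by metis
      then have "norm z \<le> norm w + dist z w" by (metis dist_norm norm_triangle_sub)
      then show "z \<in> cball 0 (\<bar>r\<bar> + real k * h m)" using z w r[of w] by auto
    qed
    then have "emeasure (plane_measure B) (?T m) \<le> emeasure (plane_measure B) (cball 0 (\<bar>r\<bar> + real k * h m))"
      by (intro emeasure_mono) auto
    also have "\<dots> < \<infinity>"
      using h[of m] by (intro le_less_trans[OF plane_measure_cball]) auto
    finally show "emeasure (plane_measure B) (?T m) \<noteq> \<infinity>" by simp
  qed
  also have "(\<Inter>m. ?T m) = Z"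
  proof (rule antisym; rule subsetI)
    fix z assume "z \<in> (\<Inter>m. ?T m)"
    then have "infdist z Z \<le> real k * h m" for m by auto
    moreover have "(\<lambda>m. real k * h m) \<longlonglongrightarrow> real k * 0" by (intro tendsto_intros h_lim)
    ultimately have "infdist z Z \<le> 0"
      by (metis (no_types, lifting) LIMSEQ_le_const mult_zero_right)
    then show "z \<in> Z"
      using in_closed_iff_infdist_zero[OF compact_imp_closed[OF Z(1)] False] infdist_nonneg[of z Z] by auto
  qed (use h in \<open>auto simp: less_imp_le\<close>)
  finally have "(\<lambda>m. ?c * emeasure (plane_measure B) (?T m)) \<longlonglongrightarrow> ?c * emeasure (plane_measure B) Z"
    by (intro ennreal_tendsto_cmult) auto
  then show ?thesis using bound by (intro LIMSEQ_le_const) auto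
qed

text \<open>Finite Borel measures on Polish spaces are inner regular, so the bound for compact sets extends
  to Borel sets. The restriction to the bounded parts \<open>F(S\<^sub>n)\<close> makes the Hausdorff measure finite, and the
  left inverse \<open>p\<close> turns compact pieces of the image into compact subsets of the plane.\<close>

lemma hausdorff_graph_le:
  fixes F :: "'a \<Rightarrow> 'b::{second_countable_topology, complete_space}" and p :: "'b \<Rightarrow> 'a"
  assumes \<Lambda>: "0 < \<Lambda>"
    and F: "\<And>x y. x \<in> span B \<Longrightarrow> y \<in> span B \<Longrightarrow> dist (F x) (F y) \<le> \<Lambda> * dist x y"
    and contF: "continuous_on UNIV F"
    and p: "continuous_on UNIV p" "\<And>z. z \<in> span B \<Longrightarrow> p (F z) = z"
    and A: "A \<in> sets borel"
  shows "hausdorff_outer k (A \<inter> F ` span B)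
      \<le> ennreal (unit_ball_vol k * (\<Lambda> * k / 2) ^ k) * emeasure (plane_measure B) (F -` A)"
proof -
  let ?c = "ennreal (unit_ball_vol k * (\<Lambda> * k / 2) ^ k)"
  define H :: "'b measure" where "H = distr (hausdorff k) borel id"
  have [simp]: "sets H = sets borel" "space H = UNIV" by (simp_all add: H_def)
  have H: "emeasure H A = hausdorff_outer k A" if "A \<in> sets borel" for A
    using that sets_borel_le_hausdorff[where 'a='b, of k] unfolding H_def
    by (subst emeasure_distr) (auto simp: measurable_def emeasure_hausdorff)
  have FA: "F -` A \<in> sets (plane_measure B)"
    using measurable_sets[OF borel_measurable_continuous_onI[OF contF] A] by simp
  define S where "S n = span B \<inter> cball 0 (real n)" for n :: nat
  have S: "compact (S n)" "S n \<subseteq> span B" for n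
    by (auto simp: S_def closed_subspace intro: closed_Int_compact)
  have FS: "compact (F ` S n)" for n
    using S contF by (intro compact_continuous_image) (auto intro: continuous_on_subset)
  have FSb: "F ` S n \<in> sets borel" for n using FS by (simp add: borel_compact)
  have part: "emeasure H (A \<inter> F ` S n) \<le> ?c * emeasure (plane_measure B) (F -` A)" for n
  proof -
    define \<mu> where "\<mu> = density H (indicator (F ` S n))"
    have \<mu>: "emeasure \<mu> X = emeasure H (X \<inter> F ` S n)" if "X \<in> sets borel" for X
    proof -
      have "emeasure \<mu> X = (\<integral>\<^sup>+x. indicator (F ` S n) x * indicator X x \<partial>H)"
        using that FSb unfolding \<mu>_def
          by (subst emeasure_density) (auto intro!: borel_measurable_indicator)
      also have "\<dots> = (\<integral>\<^sup>+x. indicator (X \<inter> F ` S n) x \<partial>H)"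
        by (intro nn_integral_cong) (auto simp: indicator_def)
      also have "\<dots> = emeasure H (X \<inter> F ` S n)"
        using that FSb by (intro nn_integral_indicator) auto
      finally show ?thesis .
    qed
    have compact_le: "emeasure H (K \<inter> F ` S n) \<le> ?c * emeasure (plane_measure B) (F -` K \<inter> S n)"
      if K: "compact K" for K
    proof -
      have eq: "K \<inter> F ` S n = F ` (F -` K \<inter> S n)" by auto
      have "compact (F -` K \<inter> S n)"
        using contF K S(1) by (intro closed_Int_compact closed_vimage) (auto intro: compact_imp_closed)
      then have "hausdorff_outer k (F ` (F -` K \<inter> S n)) \<le> ?c * emeasure (plane_measure B) (F -` K \<inter> S n)"
        using S(2) by (intro hausdorff_Lipschitz_image_compact \<Lambda> F) auto
      then show ?thesis
        unfolding eq[symmetric] using H[OF sets.Int[OF borel_compact[OF K] FSb]] by simp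
    qed
    have "emeasure \<mu> UNIV = emeasure H (F ` S n \<inter> F ` S n)" by (subst \<mu>) auto
    also have "\<dots> \<le> ?c * emeasure (plane_measure B) (F -` (F ` S n) \<inter> S n)"
      by (rule compact_le[OF FS])
    also have "\<dots> \<le> ?c * emeasure (plane_measure B) (cball 0 (real n))"
      by (intro mult_left_mono emeasure_mono) (auto simp: S_def)
    also have "\<dots> < \<infinity>"
      using le_less_trans[OF plane_measure_cball[of "real n" 0], of \<infinity>] by (simp add: ennreal_mult_less_top)
    finally have "emeasure \<mu> (space \<mu>) \<noteq> \<infinity>" by (simp add: \<mu>_def)
    then have "emeasure \<mu> A = (SUP K \<in> {K. K \<subseteq> A \<and> compact K}. emeasure \<mu> K)"
      using A by (intro inner_regular) (auto simp: \<mu>_def)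
    also have "\<dots> \<le> ?c * emeasure (plane_measure B) (F -` A)"
    proof (rule SUP_least)
      fix K assume K: "K \<in> {K. K \<subseteq> A \<and> compact K}"
      then have "emeasure \<mu> K \<le> ?c * emeasure (plane_measure B) (F -` K \<inter> S n)"
        using compact_le[of K] \<mu>[of K] by (simp add: borel_compact)
      also have "\<dots> \<le> ?c * emeasure (plane_measure B) (F -` A)"
        using K by (intro mult_left_mono emeasure_mono FA) auto
      finally show "emeasure \<mu> K \<le> ?c * emeasure (plane_measure B) (F -` A)" .
    qed
    finally show ?thesis using \<mu>[OF A] by simp
  qed
  have AS: "A \<inter> F ` span B = (\<Union>n. A \<inter> F ` S n)"
  proof -
    have "\<exists>n. norm z \<le> real n" for z :: 'a by (rule real_arch_simple)
    then show ?thesis by (fastforce simp: S_def)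
  qed
  have "incseq (\<lambda>n. A \<inter> F ` S n)" by (fastforce simp: incseq_def S_def)
  then have "emeasure H (\<Union>n. A \<inter> F ` S n) = (SUP n. emeasure H (A \<inter> F ` S n))"
    using A FSb by (intro SUP_emeasure_incseq[symmetric]) auto
  also have "\<dots> \<le> ?c * emeasure (plane_measure B) (F -` A)" by (intro SUP_least part)
  finally show ?thesis
    unfolding AS using H[of "\<Union>n. A \<inter> F ` S n"] A FSb by simp
qed

end


section \<open>The planes of a distribution as graphs of Lipschitz slopes\<close>

lemma linear_blinfun_apply: "linear (blinfun_apply f)"
  by (rule bounded_linear.linear[OF blinfun.bounded_linear_right])

text \<open>Continuity bounds the derivative near the point, and the mean value inequality applies on a ball.\<close>

lemma C1_on_Lipschitz_at:
  fixes f :: "'a::real_normed_vector \<Rightarrow> 'b::real_normed_vector"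
  assumes "C1_on N f" "open N" "x \<in> N"
  shows "\<exists>r>0. \<exists>C\<ge>0. cball x r \<subseteq> N \<and> (\<forall>y\<in>cball x r. \<forall>z\<in>cball x r. norm (f y - f z) \<le> C * norm (y - z))"
proof -
  obtain D where D: "\<And>x. x \<in> N \<Longrightarrow> (f has_derivative blinfun_apply (D x)) (at x)" "continuous_on N D"
    using assms(1) unfolding C1_on_def by blast
  obtain e where e: "0 < e" "\<And>y. y \<in> N \<Longrightarrow> dist y x < e \<Longrightarrow> dist (D y) (D x) < 1"
    using D(2) assms(3) unfolding continuous_on_iff by (meson zero_less_one)
  obtain e' where e': "0 < e'" "cball x e' \<subseteq> N" using assms(2,3) open_contains_cball by blast
  define r where "r = min (e / 2) e'"
  have r: "0 < r" "cball x r \<subseteq> N" using e(1) e' by (auto simp: r_def)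
  have "norm (f y - f z) \<le> (norm (D x) + 1) * norm (y - z)" if "y \<in> cball x r" "z \<in> cball x r" for y z
  proof (rule differentiable_bound[OF convex_cball _ _ that])
    fix w assume w: "w \<in> cball x r"
    then show "(f has_derivative blinfun_apply (D w)) (at w within cball x r)"
      using D(1) r(2) by (blast intro: has_derivative_at_withinI)
    have "dist w x < e" using w e(1) by (auto simp: r_def dist_commute)
    then have "dist (D w) (D x) < 1" using e(2) w r(2) by blast
    then show "onorm (blinfun_apply (D w)) \<le> norm (D x) + 1"
      using norm_triangle_sub[of "D w" "D x"] by (simp add: dist_norm norm_blinfun.rep_eq)
  qed
  then show ?thesis using r by (intro exI[of _ r] exI[of _ "norm (D x) + 1"] conjI) auto
qed

lemma norm_blinfun_compose_le:
  "norm a \<le> c \<Longrightarrow> norm b \<le> d \<Longrightarrow> 0 \<le> c \<Longrightarrow> norm (a o\<^sub>L b) \<le> c * d"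
  by (meson norm_blinfun_compose mult_mono norm_ge_zero order_trans)

text \<open>Such a map satisfies \<open>|w| \<le> 2 |G w|\<close>; injectivity is enough in finite dimensions.\<close>

lemma blinfun_near_id_inverse:
  fixes G :: "'a::euclidean_space \<Rightarrow>\<^sub>L 'a"
  assumes "norm (G - id_blinfun) \<le> 1 / 2"
  shows "\<exists>H. G o\<^sub>L H = id_blinfun \<and> H o\<^sub>L G = id_blinfun \<and> norm H \<le> 2"
proof -
  have low: "norm w \<le> 2 * norm (G w)" for w
  proof -
    have "norm (w - G w) \<le> 1 / 2 * norm w"
      using norm_blinfun[of "G - id_blinfun" w] mult_right_mono[OF assms norm_ge_zero[of w]]
      by (simp add: blinfun.diff_left norm_minus_commute)
    then show ?thesis using norm_triangle_sub[of w "G w"] by linarith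
  qed
  have lin: "linear (blinfun_apply G)" by (rule linear_blinfun_apply)
  have inj: "inj (blinfun_apply G)"
    using low by (subst linear_injective_0[OF lin]) (metis mult_zero_right norm_le_zero_iff norm_zero)
  obtain h where h: "linear h" "\<And>x. h (G x) = x" "\<And>x. G (h x) = x"
    using linear_injective_isomorphism[OF lin inj] by metis
  have bl: "bounded_linear h" using h(1) by (simp add: linear_conv_bounded_linear)
  note ap = bounded_linear_Blinfun_apply[OF bl]
  have "norm (Blinfun h) \<le> 2"
    by (rule norm_blinfun_bound) (use low[of "h _"] h(3) ap in auto)
  then show ?thesis
    using h by (intro exI[of _ "Blinfun h"] conjI blinfun_eqI) (auto simp: ap)
qed

text \<open>The nearest point retraction onto the ball is 1-Lipschitz. The extension lets the slopes be evaluated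
  at points that are not yet known to be close to the origin.\<close>

lemma Lipschitz_extension_from_cball:
  fixes A :: "'a::euclidean_space \<Rightarrow> 'b::real_normed_vector"
  assumes "0 < r" and L: "\<And>x y. x \<in> cball 0 r \<Longrightarrow> y \<in> cball 0 r \<Longrightarrow> norm (A x - A y) \<le> C * norm (x - y)"
    and "0 \<le> C"
  defines "A' \<equiv> \<lambda>x. A (closest_point (cball 0 r) x)"
  shows "norm (A' x - A' y) \<le> C * norm (x - y)"
proof -
  have "closest_point (cball 0 r) z \<in> cball 0 r" for z :: 'a
    using assms(1) by (intro closest_point_in_set) auto
  then have "norm (A' x - A' y) \<le> C * norm (closest_point (cball 0 r) x - closest_point (cball 0 r) y)"
    unfolding A'_def by (intro L)
  also have "\<dots> \<le> C * norm (x - y)"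
    using closest_point_lipschitz[of "cball 0 r" x y] assms(1,3)
    by (intro mult_left_mono) (auto simp: dist_norm)
  finally show "norm (A' x - A' y) \<le> C * norm (x - y)" .
qed

context orthonormal_set
begin

text \<open>\<open>T(x)\<close> sends the frame of the distribution at the origin to the frame at \<open>x\<close>. The dimension forces the
  frame at the origin to be linearly independent, so there are coordinates \<open>\<xi>\<^sub>i\<close> with respect to it.\<close>

lemma local_frame_transport:
  assumes V: "C1_distribution d V" and V0: "V 0 = span B"
  shows "\<exists>r>0. \<exists>C>0. \<exists>T :: 'a \<Rightarrow> 'a \<Rightarrow>\<^sub>L 'a.
     (\<forall>x\<in>cball 0 r. \<forall>y\<in>cball 0 r. norm (T x - T y) \<le> C * norm (x - y)) \<and>
     (\<forall>x\<in>cball 0 r. V x = blinfun_apply (T x) ` span B) \<and> (\<forall>w\<in>span B. T 0 w = w) \<and>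
     (\<forall>x w. T x (proj w) = T x w)"
proof -
  obtain N and X :: "nat \<Rightarrow> 'a \<Rightarrow> 'a" where N: "open N" "0 \<in> N" and X: "\<And>i. i < d \<Longrightarrow> C1_on N (X i)"
    and VX: "\<And>y. y \<in> N \<Longrightarrow> V y = span ((\<lambda>i. X i y) ` {..<d})"
    using V unfolding C1_distribution_def by metis
  have dim: "dim (V 0) = d" using V by (simp add: C1_distribution_def)
  let ?E = "(\<lambda>i. X i 0) ` {..<d}"
  have spanE: "span ?E = span B" using VX[OF N(2)] V0 by simp
  have cardE: "card ?E = d"
  proof (rule antisym)
    show "card ?E \<le> d" using card_image_le[of "{..<d}" "\<lambda>i. X i 0"] by simp
    show "d \<le> card ?E" using dim VX[OF N(2)] dim_le_card'[of ?E] by simp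
  qed
  then have inj: "inj_on (\<lambda>i. X i 0) {..<d}" by (intro eq_card_imp_inj_on) auto
  have ind: "independent ?E"
    using cardE dim VX[OF N(2)] by (intro card_le_dim_spanning[of ?E "V 0"]) (auto simp: span_superset)
  have "\<exists>g :: 'a \<Rightarrow> real. linear g \<and> (\<forall>x\<in>?E. g x = (if x = X i 0 then 1 else 0))" for i
    by (rule linear_independent_extend[OF ind])
  then obtain \<xi> :: "nat \<Rightarrow> 'a \<Rightarrow> real" where \<xi>: "\<And>i. linear (\<xi> i)"
      "\<And>i x. x \<in> ?E \<Longrightarrow> \<xi> i x = (if x = X i 0 then 1 else 0)" by metis
  define \<Xi> where "\<Xi> i = Blinfun (\<xi> i) o\<^sub>L proj" for i
  have \<Xi>: "\<Xi> i w = \<xi> i (proj w)" for i w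
    using \<xi>(1)[of i] by (simp add: \<Xi>_def bounded_linear_Blinfun_apply linear_conv_bounded_linear)
  define T where "T x = (\<Sum>i<d. blinfun_scaleR_left (X i x) o\<^sub>L \<Xi> i)" for x
  have T: "T x w = (\<Sum>i<d. \<xi> i (proj w) *\<^sub>R X i x)" for x w
    by (simp add: T_def blinfun.sum_left \<Xi>)
  have TE: "T x (X j 0) = X j x" if "j < d" for x j
  proof -
    have "X j 0 \<in> span B" using that unfolding spanE[symmetric] by (intro span_base) auto
    then have "T x (X j 0) = (\<Sum>i<d. \<xi> i (X j 0) *\<^sub>R X i x)" by (simp add: T proj_span)
    also have "\<dots> = (\<Sum>i<d. (if i = j then X i x else 0))"
      using that inj by (intro sum.cong) (auto simp: \<xi>(2) inj_on_def)
    finally show ?thesis using that by simp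
  qed
  have TV: "blinfun_apply (T x) ` span B = V x" if "x \<in> N" for x
  proof -
    have "blinfun_apply (T x) ` span ?E = span (blinfun_apply (T x) ` ?E)" by (rule linear_span_image[OF linear_blinfun_apply, symmetric])
    also have "blinfun_apply (T x) ` ?E = (\<lambda>i. X i x) ` {..<d}" using TE by (force simp: image_image)
    finally show ?thesis using VX[OF that] spanE by simp
  qed
  have T0: "T 0 w = w" if "w \<in> span B" for w
  proof (rule linear_eq_on_span[of "blinfun_apply (T 0)" "\<lambda>x. x" ?E])
    show "w \<in> span ?E" using that spanE by simp
  qed (use TE linear_blinfun_apply linear_ident in auto)
  have "\<forall>i\<in>{..<d}. \<exists>r>0. \<exists>C\<ge>0. cball 0 r \<subseteq> N \<and>
      (\<forall>y\<in>cball 0 r. \<forall>z\<in>cball 0 r. norm (X i y - X i z) \<le> C * norm (y - z))"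
    using C1_on_Lipschitz_at[OF X N] by blast
  then obtain r C where rC: "\<And>i. i < d \<Longrightarrow> 0 < r i" "\<And>i. i < d \<Longrightarrow> 0 \<le> C i"
      "\<And>i y z. i < d \<Longrightarrow> y \<in> cball 0 (r i) \<Longrightarrow> z \<in> cball 0 (r i) \<Longrightarrow> norm (X i y - X i z) \<le> C i * norm (y - z)"
    unfolding lessThan_iff Ball_def by metis
  obtain r0 where r0: "0 < r0" "cball 0 r0 \<subseteq> N" using N open_contains_cball by blast
  define R where "R = Min (insert r0 (r ` {..<d}))"
  have R: "0 < R" "R \<le> r0" "\<And>i. i < d \<Longrightarrow> R \<le> r i"
    using r0 rC(1) by (auto simp: R_def Min_gr_iff)
  define C' where "C' = (\<Sum>i<d. C i * norm (\<Xi> i)) + 1"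
  have "norm (T x - T y) \<le> C' * norm (x - y)" if "x \<in> cball 0 R" "y \<in> cball 0 R" for x y
  proof -
    have "T x - T y = (\<Sum>i<d. blinfun_scaleR_left (X i x - X i y) o\<^sub>L \<Xi> i)"
      by (rule blinfun_eqI) (simp add: T_def blinfun.sum_left blinfun.diff_left sum_subtractf scaleR_diff_right)
    then have "norm (T x - T y) \<le> (\<Sum>i<d. norm (blinfun_scaleR_left (X i x - X i y) o\<^sub>L \<Xi> i))"
      by (simp add: norm_sum)
    also have "\<dots> \<le> (\<Sum>i<d. (C i * norm (x - y)) * norm (\<Xi> i))"
    proof (rule sum_mono)
      fix i assume "i \<in> {..<d}"
      then have i: "i < d" by simp
      have "norm (blinfun_scaleR_left (X i x - X i y) :: real \<Rightarrow>\<^sub>L 'a) \<le> norm (X i x - X i y)"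
        by (rule norm_blinfun_bound) (auto simp: mult.commute)
      also have "\<dots> \<le> C i * norm (x - y)" using that R(3)[OF i] by (intro rC(3) i) auto
      finally show "norm (blinfun_scaleR_left (X i x - X i y) o\<^sub>L \<Xi> i) \<le> (C i * norm (x - y)) * norm (\<Xi> i)"
        using rC(2)[OF i] by (intro norm_blinfun_compose_le) auto
    qed
    also have "\<dots> \<le> C' * norm (x - y)"
      by (simp add: C'_def sum_distrib_right sum_distrib_left algebra_simps)
    finally show ?thesis .
  qed
  moreover have "0 < C'" unfolding C'_def using rC(2) by (intro add_nonneg_pos sum_nonneg) auto
  moreover have "V x = blinfun_apply (T x) ` span B" if "x \<in> cball 0 R" for x
    using TV[of x] that R(2) r0(2) by (simp add: subset_iff)
  moreover have "T x (proj w) = T x w" for x w by (simp add: T proj_span proj_in_span)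
  ultimately show ?thesis using R(1) T0 by (intro exI[of _ R] exI[of _ C'] exI[of _ T] conjI ballI allI) auto
qed

text \<open>With \<open>P\<close> the orthogonal projection onto \<open>V(0)\<close>, the map \<open>G(x) = 1 + P (T(x) - T(0))\<close> agrees with \<open>P T(x)\<close> on \<open>V(0)\<close>
  and is close to the identity near the origin. Every vector of \<open>V(x)\<close> is therefore \<open>T(x) G(x)\<^sup>-\<^sup>1 w\<close> for its
  projection \<open>w\<close>, and its normal part is \<open>A(x) w = (1 - P) T(x) G(x)\<^sup>-\<^sup>1 w\<close>. Inversion preserves the Lipschitz
  property because \<open>H - H' = H (G' - G) H'\<close> for the inverses.\<close>

lemma distribution_slopes:
  assumes V: "C1_distribution d V" and V0: "V 0 = span B"
  shows "\<exists>r>0. \<exists>\<Lambda>>0. \<exists>A :: 'a \<Rightarrow> 'a \<Rightarrow>\<^sub>L 'a.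
     (\<forall>x y. norm (A x - A y) \<le> \<Lambda> * norm (x - y)) \<and> (\<forall>x. norm (A x) \<le> \<Lambda>) \<and>
     (\<forall>x w. blinfun_apply (A x) w \<in> orthogonal_comp (span B)) \<and> (\<forall>x w. blinfun_apply (A x) (proj w) = blinfun_apply (A x) w) \<and>
     (\<forall>x\<in>cball 0 r. V x = (\<lambda>w. w + blinfun_apply (A x) w) ` span B)"
proof -
  obtain r1 C and T :: "'a \<Rightarrow> 'a \<Rightarrow>\<^sub>L 'a" where r1: "0 < r1" and C: "0 < C"
    and TL: "\<And>x y. x \<in> cball 0 r1 \<Longrightarrow> y \<in> cball 0 r1 \<Longrightarrow> norm (T x - T y) \<le> C * norm (x - y)"
    and TV: "\<And>x. x \<in> cball 0 r1 \<Longrightarrow> V x = blinfun_apply (T x) ` span B"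
    and T0: "\<And>w. w \<in> span B \<Longrightarrow> T 0 w = w" and Tp: "\<And>x w. T x (proj w) = T x w"
    using local_frame_transport[OF V V0] by metis
  define r where "r = min r1 (1 / (2 * C))"
  have r: "0 < r" "r \<le> r1" "C * r \<le> 1 / 2"
    using r1 C by (auto simp: r_def min_def field_simps)
  have TLr: "norm (T x - T y) \<le> C * norm (x - y)" if "x \<in> cball 0 r" "y \<in> cball 0 r" for x y
    using that r(2) by (intro TL) auto
  define G where "G x = id_blinfun + (proj o\<^sub>L (T x - T 0))" for x
  have GL: "norm (G x - G y) \<le> C * norm (x - y)" if "x \<in> cball 0 r" "y \<in> cball 0 r" for x y
  proof -
    have "G x - G y = proj o\<^sub>L (T x - T y)"
      by (rule blinfun_eqI) (simp add: G_def blinfun.diff_left blinfun.add_left blinfun.diff_right)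
    then show ?thesis using norm_blinfun_compose_le[OF norm_proj TLr[OF that]] by simp
  qed
  have "\<exists>H. G x o\<^sub>L H = id_blinfun \<and> H o\<^sub>L G x = id_blinfun \<and> norm H \<le> 2" if x: "x \<in> cball 0 r" for x
  proof (rule blinfun_near_id_inverse)
    have "norm (G x - id_blinfun) = norm (G x - G 0)" by (simp add: G_def)
    also have "\<dots> \<le> C * norm (x - 0)" using x r(1) by (intro GL) auto
    also have "\<dots> \<le> C * r" using x C by (intro mult_left_mono) auto
    finally show "norm (G x - id_blinfun) \<le> 1 / 2" using r(3) by simp
  qed
  then obtain H where H: "\<And>x. x \<in> cball 0 r \<Longrightarrow> G x o\<^sub>L H x = id_blinfun"
      "\<And>x. x \<in> cball 0 r \<Longrightarrow> H x o\<^sub>L G x = id_blinfun" "\<And>x. x \<in> cball 0 r \<Longrightarrow> norm (H x) \<le> 2"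
    by metis
  have GH: "G x (H x w) = w" "H x (G x w) = w" if "x \<in> cball 0 r" for x w
    using H(1,2)[OF that] by (metis blinfun_apply_blinfun_compose blinfun_apply_id_blinfun id_apply)+
  have HL: "norm (H x - H y) \<le> 4 * C * norm (x - y)" if x: "x \<in> cball 0 r" and y: "y \<in> cball 0 r" for x y
  proof -
    have "H x - H y = H x o\<^sub>L ((G y - G x) o\<^sub>L H y)"
      by (rule blinfun_eqI) (simp add: blinfun.diff_left blinfun.diff_right GH[OF x] GH[OF y])
    moreover have "norm (H x o\<^sub>L ((G y - G x) o\<^sub>L H y)) \<le> 2 * ((C * norm (y - x)) * 2)"
      using C by (intro norm_blinfun_compose_le H GL x y) auto
    ultimately show ?thesis by (simp add: norm_minus_commute)
  qed
  let ?Q = "id_blinfun - proj"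
  have Q: "norm ?Q \<le> 2"
    using norm_triangle_ineq4[of "id_blinfun :: 'a \<Rightarrow>\<^sub>L 'a" proj] norm_proj norm_blinfun_id_le[where 'a='a] by linarith
  define A where "A x = ?Q o\<^sub>L (T x o\<^sub>L (H x o\<^sub>L proj))" for x
  define M where "M = norm (T 0) + C * r"
  have M: "norm (T x) \<le> M" if "x \<in> cball 0 r" for x
  proof -
    have "norm (T x - T 0) \<le> C * norm (x - 0)" using that r(1) by (intro TLr) auto
    also have "\<dots> \<le> C * r" using that C by (intro mult_left_mono) auto
    finally show ?thesis using norm_triangle_sub[of "T x" "T 0"] by (simp add: M_def)
  qed
  have M0: "0 \<le> M" using C r(1) by (simp add: M_def)
  have AL: "norm (A x - A y) \<le> (8 * C * M + 4 * C) * norm (x - y)"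
    if x: "x \<in> cball 0 r" and y: "y \<in> cball 0 r" for x y
  proof -
    have "A x - A y = (?Q o\<^sub>L (T x o\<^sub>L ((H x - H y) o\<^sub>L proj))) + (?Q o\<^sub>L ((T x - T y) o\<^sub>L (H y o\<^sub>L proj)))"
      by (rule blinfun_eqI) (simp add: A_def blinfun.diff_left blinfun.add_left blinfun.diff_right)
    then have "norm (A x - A y) \<le> norm (?Q o\<^sub>L (T x o\<^sub>L ((H x - H y) o\<^sub>L proj)))
        + norm (?Q o\<^sub>L ((T x - T y) o\<^sub>L (H y o\<^sub>L proj)))" by (simp add: norm_triangle_ineq)
    also have "\<dots> \<le> 2 * (M * ((4 * C * norm (x - y)) * 1)) + 2 * ((C * norm (x - y)) * (2 * 1))"
      using C M0 by (intro add_mono norm_blinfun_compose_le Q M HL TLr H norm_proj x y) auto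
    finally show ?thesis by (simp add: algebra_simps)
  qed
  have Ab: "norm (A x) \<le> 4 * M" if x: "x \<in> cball 0 r" for x
  proof -
    have "norm (A x) \<le> 2 * (M * (2 * 1))"
      unfolding A_def using M0 by (intro norm_blinfun_compose_le Q M H norm_proj x) auto
    then show ?thesis by simp
  qed
  have Aorth: "A x w \<in> orthogonal_comp (span B)" for x w
    using diff_proj_orthogonal_comp by (simp add: A_def blinfun.diff_left)
  have Ap: "A x (proj w) = A x w" for x w by (simp add: A_def proj_span proj_in_span)
  have AV: "V x = (\<lambda>w. w + A x w) ` span B" if x: "x \<in> cball 0 r" for x
  proof -
    have Gspan: "G x u = proj (T x u)" if "u \<in> span B" for u
      using that by (simp add: G_def blinfun.add_left blinfun.diff_left blinfun.diff_right T0 proj_span)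
    have Hspan: "H x w \<in> span B" if "w \<in> span B" for w
    proof -
      have "H x w = w - proj ((T x - T 0) (H x w))"
        using GH(1)[OF x, of w] by (simp add: G_def blinfun.add_left eq_diff_eq)
      then show ?thesis using that by (metis proj_in_span span_diff)
    qed
    have key: "w + A x w = T x (H x w)" if "w \<in> span B" for w
      using Gspan[OF Hspan[OF that]] GH(1)[OF x, of w] that
      by (simp add: A_def proj_span blinfun.diff_left)
    have "(\<lambda>w. w + A x w) ` span B = (\<lambda>w. T x (H x w)) ` span B" using key by (intro image_cong) auto
    also have "\<dots> = blinfun_apply (T x) ` (blinfun_apply (H x) ` span B)" by (simp add: image_image)
    also have "blinfun_apply (H x) ` span B = span B"
    proof (rule antisym)
      show "span B \<subseteq> blinfun_apply (H x) ` span B"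
      proof
        fix u assume u: "u \<in> span B"
        then have "G x u \<in> span B" using Gspan proj_in_span by simp
        then show "u \<in> blinfun_apply (H x) ` span B" using GH(2)[OF x, of u] by (metis imageI)
      qed
    qed (use Hspan in auto)
    finally show ?thesis using TV[of x] x r(2) by simp
  qed
  define \<Lambda> where "\<Lambda> = 8 * C * M + 4 * C + 4 * M"
  have \<Lambda>: "0 < \<Lambda>" "8 * C * M + 4 * C \<le> \<Lambda>" "4 * M \<le> \<Lambda>" 
  proof -
    have "0 \<le> 8 * C * M" using C M0 by simp
    then show "0 < \<Lambda>" "8 * C * M + 4 * C \<le> \<Lambda>" "4 * M \<le> \<Lambda>"
      unfolding \<Lambda>_def using C M0 by linarith+
  qed
  define A' where "A' x = A (closest_point (cball 0 r) x)" for x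
  have AL\<Lambda>: "norm (A x - A y) \<le> \<Lambda> * norm (x - y)" if "x \<in> cball 0 r" "y \<in> cball 0 r" for x y
    using AL[OF that] mult_right_mono[OF \<Lambda>(2), of "norm (x - y)"] by simp
  have ext1: "norm (A' x - A' y) \<le> \<Lambda> * norm (x - y)" for x y
    unfolding A'_def
    by (rule Lipschitz_extension_from_cball) (use r(1) AL\<Lambda> \<Lambda>(1) in auto)
  have ext2: "A' x = A x" if "x \<in> cball 0 r" for x
    using that by (simp add: A'_def closest_point_self)
  have "norm (A' x) \<le> \<Lambda>" for x
  proof -
    have "closest_point (cball 0 r) x \<in> cball 0 r" using r(1) by (intro closest_point_in_set) auto
    then show ?thesis using Ab \<Lambda>(3) unfolding A'_def by fastforce
  qed
  moreover have "V x = (\<lambda>w. w + A' x w) ` span B" if "x \<in> cball 0 r" for x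
    using AV[OF that] ext2[OF that] by simp
  ultimately show ?thesis
    using r(1) \<Lambda>(1) ext1 Aorth Ap by (intro exI[of _ r] exI[of _ \<Lambda>] exI[of _ A'] conjI allI ballI) (auto simp: A'_def)
qed

end


section \<open>Graphs over a plane as submanifolds\<close>

text \<open>The map \<open>f\<close> is defined on the whole space, not only on the plane, so that derivatives at points
  are available without restriction to a subspace.\<close>

locale normal_graph = orthonormal_set B for B :: "'a::euclidean_space set" +
  fixes f :: "'a \<Rightarrow> 'a" and Df :: "'a \<Rightarrow> 'a \<Rightarrow>\<^sub>L 'a"
  assumes f_normal: "\<And>x. f x \<in> orthogonal_comp (span B)"
    and f_proj: "\<And>x. f (proj x) = f x"
    and f_deriv: "\<And>x. (f has_derivative blinfun_apply (Df x)) (at x)"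
    and Df_cont: "continuous_on UNIV Df"
begin

definition embed :: "'a \<Rightarrow> 'a" where "embed z = z + f z"

lemma graph_over_embed: "graph_over (span B) f = embed ` span B"
  by (simp add: graph_over_def embed_def)

lemma proj_embed: "z \<in> span B \<Longrightarrow> proj (embed z) = z"
  by (simp add: embed_def blinfun.add_right proj_span proj_orthogonal_comp f_normal)

lemma graph_iff: "x \<in> graph_over (span B) f \<longleftrightarrow> x = embed (proj x)"
proof
  assume "x \<in> graph_over (span B) f"
  then obtain z where "z \<in> span B" "x = embed z" unfolding graph_over_embed by blast
  then show "x = embed (proj x)" by (simp add: proj_embed)
next
  assume "x = embed (proj x)"
  then show "x \<in> graph_over (span B) f"
    unfolding graph_over_embed using proj_in_span by (rule image_eqI)
qed

lemma continuous_f: "continuous_on UNIV f"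
  using f_deriv by (meson continuous_at_imp_continuous_on has_derivative_continuous)

lemma continuous_embed: "continuous_on A embed"
  unfolding embed_def
  by (intro continuous_on_add continuous_on_id continuous_on_subset[OF continuous_f]) simp

lemma closed_graph: "closed (graph_over (span B) f)"
proof -
  have "continuous_on UNIV (\<lambda>x. embed (proj x))"
    by (rule continuous_on_compose2[OF continuous_embed[of UNIV]]) (auto intro: continuous_intros)
  then have "closed {x. x = embed (proj x)}" by (rule closed_Collect_eq[OF continuous_on_id])
  moreover have "graph_over (span B) f = {x. x = embed (proj x)}"
    by (rule set_eqI) (unfold mem_Collect_eq, rule graph_iff)
  ultimately show ?thesis by simp
qed

lemma dist_embed_ge: "z \<in> span B \<Longrightarrow> w \<in> span B \<Longrightarrow> dist z w \<le> dist (embed z) (embed w)"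
  using norm_proj_le[of "embed z - embed w"] by (simp add: dist_norm blinfun.diff_right proj_embed)

text \<open>The shear \<open>x \<mapsto> x - f x\<close> straightens the whole graph at once; its inverse is \<open>x \<mapsto> x + f x\<close> because
  \<open>f\<close> ignores normal displacements.\<close>

lemma embedded_graph: "embedded_C1_submanifold k (graph_over (span B) f)"
  unfolding embedded_C1_submanifold_def
proof (intro ballI)
  fix x assume "x \<in> graph_over (span B) f"
  have ff: "f (x + f x) = f x" "f (x - f x) = f x" for x
  proof -
    have "proj (x + f x) = proj x" "proj (x - f x) = proj x"
      by (simp_all add: blinfun.add_right blinfun.diff_right proj_orthogonal_comp[OF f_normal])
    then show "f (x + f x) = f x" "f (x - f x) = f x" by (metis f_proj)+
  qed
  have C1: "C1_on UNIV (\<lambda>x. x + c *\<^sub>R f x)" for c :: real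
    unfolding C1_on_def
  proof (intro exI[of _ "\<lambda>x. id_blinfun + c *\<^sub>R Df x"] conjI ballI)
    fix x
    have "((\<lambda>x. x + c *\<^sub>R f x) has_derivative (\<lambda>h. h + c *\<^sub>R Df x h)) (at x)"
      by (intro has_derivative_add has_derivative_ident has_derivative_scaleR_right f_deriv)
    then show "((\<lambda>x. x + c *\<^sub>R f x) has_derivative blinfun_apply (id_blinfun + c *\<^sub>R Df x)) (at x)"
      by (rule has_derivative_eq_rhs) (simp add: fun_eq_iff blinfun.add_left blinfun.scaleR_left)
  qed (intro continuous_intros Df_cont)
  let ?\<Phi> = "\<lambda>x. x - f x" and ?\<Psi> = "\<lambda>x. x + f x"
  have "homeomorphism UNIV UNIV ?\<Phi> ?\<Psi>"
    by (intro homeomorphismI continuous_on_add continuous_on_diff continuous_on_id continuous_f)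
       (simp_all add: ff)
  moreover have "C1_on UNIV ?\<Phi>" "C1_on UNIV ?\<Psi>" using C1[of "-1"] C1[of 1] by simp_all
  moreover have "?\<Phi> ` (graph_over (span B) f \<inter> UNIV) = span B \<inter> UNIV"
    by (simp add: graph_over_def image_image ff)
  moreover have "dim (span B) = k" using independent_basis by (simp add: dim_eq_card_independent)
  ultimately have "open (UNIV :: 'a set) \<and> x \<in> UNIV \<and> open (UNIV :: 'a set) \<and> homeomorphism UNIV UNIV ?\<Phi> ?\<Psi> \<and>
      C1_on UNIV ?\<Phi> \<and> C1_on UNIV ?\<Psi> \<and> subspace (span B) \<and> dim (span B) = k \<and>
      ?\<Phi> ` (graph_over (span B) f \<inter> UNIV) = span B \<inter> UNIV" by simp
  then show "\<exists>W W' \<Phi> \<Psi> L. open W \<and> x \<in> W \<and> open W' \<and> homeomorphism W W' \<Phi> \<Psi> \<and>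
      C1_on W \<Phi> \<and> C1_on W' \<Psi> \<and> subspace (L :: 'a set) \<and> dim L = k \<and> \<Phi> ` (graph_over (span B) f \<inter> W) = L \<inter> W'"
    by - (rule exI[of _ UNIV], rule exI[of _ UNIV], rule exI[of _ ?\<Phi>],
          rule exI[of _ ?\<Psi>], rule exI[of _ "span B"], assumption)
qed

text \<open>A curve \<open>\<gamma>\<close> in the graph equals \<open>embed (proj \<gamma>)\<close>, which gives one inclusion by the chain rule; lifted
  straight lines give the other.\<close>

lemma tangent_space_graph:
  assumes z: "z \<in> span B"
  shows "tangent_space (graph_over (span B) f) (embed z) = (\<lambda>w. w + Df z w) ` span B"
proof (intro antisym subsetI)
  fix v assume "v \<in> tangent_space (graph_over (span B) f) (embed z)"
  then obtain \<gamma> \<epsilon> where \<gamma>: "0 < \<epsilon>" "\<gamma> ` {-\<epsilon><..<\<epsilon>} \<subseteq> graph_over (span B) f" "\<gamma> 0 = embed z"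
      "(\<gamma> has_vector_derivative v) (at 0)"
    unfolding tangent_space_def by blast
  have "(\<gamma> has_derivative (\<lambda>t. t *\<^sub>R v)) (at 0)" using \<gamma>(4) by (simp add: has_vector_derivative_def)
  from bounded_linear.has_derivative[OF blinfun.bounded_linear_right this, of proj]
  have p: "((\<lambda>t. proj (\<gamma> t)) has_derivative (\<lambda>t. proj (t *\<^sub>R v))) (at 0)" .
  have "(f has_derivative Df z) (at (proj (\<gamma> 0)))" using f_deriv[of z] \<gamma>(3) z by (simp add: proj_embed)
  from has_derivative_add[OF p diff_chain_at[OF p this]]
  have d: "((\<lambda>t. embed (proj (\<gamma> t))) has_derivative (\<lambda>t. proj (t *\<^sub>R v) + Df z (proj (t *\<^sub>R v)))) (at 0)"
    by (simp add: embed_def o_def)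
  have e: "embed (proj (\<gamma> t)) = \<gamma> t" if "t \<in> {-\<epsilon><..<\<epsilon>}" for t
  proof -
    have "\<gamma> t \<in> graph_over (span B) f" using \<gamma>(2) that by blast
    then show ?thesis by (metis graph_iff)
  qed
  have "(\<gamma> has_derivative (\<lambda>t. proj (t *\<^sub>R v) + Df z (proj (t *\<^sub>R v)))) (at 0)"
    by (rule has_derivative_transform_within_open[OF d open_greaterThanLessThan[of "-\<epsilon>" \<epsilon>] _ e])
       (use \<gamma>(1) in auto)
  from has_derivative_unique[OF this \<open>(\<gamma> has_derivative (\<lambda>t. t *\<^sub>R v)) (at 0)\<close>]
  have "proj (1 *\<^sub>R v) + Df z (proj (1 *\<^sub>R v)) = 1 *\<^sub>R v" by metis
  then show "v \<in> (\<lambda>w. w + Df z w) ` span B"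
    by (intro image_eqI[of _ _ "proj v"] proj_in_span) simp
next
  fix v assume "v \<in> (\<lambda>w. w + Df z w) ` span B"
  then obtain w where w: "w \<in> span B" "v = w + Df z w" by blast
  define \<gamma> where "\<gamma> t = embed (z + t *\<^sub>R w)" for t
  have der: "(\<gamma> has_vector_derivative (w + Df (z + t *\<^sub>R w) w)) (at t)" for t
  proof -
    have 1: "((\<lambda>t. z + t *\<^sub>R w) has_derivative (\<lambda>t. t *\<^sub>R w)) (at t)"
      by (auto intro!: derivative_eq_intros)
    have "\<gamma> = (\<lambda>t. z + t *\<^sub>R w + (f \<circ> (\<lambda>t. z + t *\<^sub>R w)) t)"
      by (simp add: fun_eq_iff \<gamma>_def embed_def)
    with has_derivative_add[OF 1 diff_chain_at[OF 1 f_deriv]] show ?thesis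
      by (simp add: o_def has_vector_derivative_def blinfun.scaleR_right scaleR_add_right)
  qed
  have "continuous_on S (\<lambda>t. w + blinfun_apply (Df (z + t *\<^sub>R w)) w)" for S
    by (intro continuous_intros continuous_on_compose2[OF Df_cont]) auto
  then have "\<gamma> C1_differentiable_on {-1<..<1}"
    unfolding C1_differentiable_on_def using der
    by (intro exI[of _ "\<lambda>t. w + blinfun_apply (Df (z + t *\<^sub>R w)) w"] conjI ballI) simp_all
  moreover have "\<gamma> ` {-1<..<1} \<subseteq> graph_over (span B) f"
    unfolding graph_over_embed \<gamma>_def using z w(1) by (auto intro!: imageI span_add span_scale)
  ultimately show "v \<in> tangent_space (graph_over (span B) f) (embed z)"
    unfolding tangent_space_def using der[of 0] w(2)
    by (intro CollectI exI[of _ \<gamma>] exI[of _ 1]) (simp add: \<gamma>_def)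
qed

lemma Df_orthogonal_comp: "w \<in> orthogonal_comp (span B) \<Longrightarrow> Df x w = 0"
proof -
  assume w: "w \<in> orthogonal_comp (span B)"
  have "f y = f (proj y)" for y by (simp add: f_proj)
  then have "f = f \<circ> proj" by (auto simp: fun_eq_iff)
  moreover have "(f \<circ> proj has_derivative (Df (proj x) \<circ> proj)) (at x)"
    by (intro diff_chain_at f_deriv bounded_linear_imp_has_derivative blinfun.bounded_linear_right)
  ultimately have "blinfun_apply (Df x) = Df (proj x) \<circ> proj"
    using has_derivative_unique[OF f_deriv] by metis
  then show "Df x w = 0" by (simp add: proj_orthogonal_comp[OF w])
qed

text \<open>A single chart, over the whole plane, is an atlas.\<close>

lemma Y_submanifold_graph:
  assumes "frac_sobolev_flat (span B) (span B) \<alpha> q Df"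
  shows "Y_submanifold k \<alpha> q (graph_over (span B) f)"
proof -
  have "Y_chart \<alpha> q (span B) (span B) f"
    unfolding Y_chart_def
  proof (intro conjI exI[of _ Df] ballI)
    show "(f has_derivative blinfun_apply (Df x)) (at x within span B)" for x
      by (rule has_derivative_at_withinI[OF f_deriv])
    show "continuous_on (span B) Df" by (rule continuous_on_subset[OF Df_cont]) simp
  qed (use f_normal Df_orthogonal_comp assms in auto)
  moreover have "dim (span B) = k" using independent_basis by (simp add: dim_eq_card_independent)
  ultimately show ?thesis
    unfolding Y_submanifold_def using closed_graph embedded_graph
    by (intro conjI exI[of _ "{(span B, span B, f)}"]) auto
qed

end


section \<open>Cut-off functions along a grid\<close>

text \<open>The square of the positive part is the source of all cut-offs: it is of class \<open>C\<^sup>1\<close> with Lipschitz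
  derivative.\<close>

definition sqp :: "real \<Rightarrow> real" where "sqp x = (max 0 x)\<^sup>2"

lemma has_derivative_sqp: "(sqp has_real_derivative 2 * max 0 x) (at x)"
proof (cases x "0::real" rule: linorder_cases)
  case less
  have "((\<lambda>_. 0) has_real_derivative 0) (at x)" by simp
  then have "(sqp has_real_derivative 0) (at x)"
    by (rule has_field_derivative_transform_within_open[where S="{..<0}"])
       (use less in \<open>auto simp: sqp_def\<close>)
  then show ?thesis using less by simp
next
  case greater
  have "((\<lambda>x. x\<^sup>2) has_real_derivative 2 * x) (at x)" by (auto intro!: derivative_eq_intros)
  then have "(sqp has_real_derivative 2 * x) (at x)"
    by (rule has_field_derivative_transform_within_open[where S="{0<..}"])
       (use greater in \<open>auto simp: sqp_def\<close>)
  then show ?thesis using greater by simp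
next
  case equal
  have "((\<lambda>h. sqp h / h) \<longlongrightarrow> 0) (at 0)"
  proof (rule tendsto_0_le[where K=1])
    show "((\<lambda>h::real. h) \<longlongrightarrow> 0) (at 0)" by (rule tendsto_ident_at)
    show "\<forall>\<^sub>F h in at 0. norm (sqp h / h) \<le> norm h * 1"
      by (rule eventuallyI) (auto simp: sqp_def max_def power2_eq_square)
  qed
  then show ?thesis using equal by (simp add: has_field_derivative_iff sqp_def)
qed

lemma abs_max0_diff_le: "\<bar>max 0 a - max 0 b\<bar> \<le> \<bar>a - b\<bar>" for a b :: real
  by (auto simp: max_def)

lemma abs_mult_add_mult_le: "\<bar>a * b + c * e\<bar> \<le> \<bar>a\<bar> * \<bar>b\<bar> + \<bar>c\<bar> * \<bar>e\<bar>" for a b c e :: real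
  by (metis abs_mult abs_triangle_ineq)

text \<open>In terms of \<open>u = (l / d) sin (\<pi> t / l)\<close>, which is small exactly near the points of \<open>l \<int>\<close>, the function
  \<open>ridge l d\<close> is at least 1 where \<open>|u| \<le> 1\<close> and vanishes where \<open>|u| \<ge> 2\<close>. The sine makes it periodic and
  differentiable everywhere without any gluing.\<close>

definition ridge_arg :: "real \<Rightarrow> real \<Rightarrow> real \<Rightarrow> real" where
  "ridge_arg l d t = l / d * sin (pi * t / l)"

text \<open>The part of the derivative of \<open>ridge\<close> that depends on \<open>u\<close> alone; its Lipschitz bound gives
  that of the derivative.\<close>

definition hump :: "real \<Rightarrow> real" where "hump u = max 0 (2 - u\<^sup>2) * u"

definition ridge :: "real \<Rightarrow> real \<Rightarrow> real \<Rightarrow> real" where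
  "ridge l d t = sqp (2 - (ridge_arg l d t)\<^sup>2)"

definition ridge' :: "real \<Rightarrow> real \<Rightarrow> real \<Rightarrow> real" where
  "ridge' l d t = - (4 * pi / d) * hump (ridge_arg l d t) * cos (pi * t / l)"

lemma abs_hump_le: "\<bar>hump u\<bar> \<le> 4"
proof (cases "\<bar>u\<bar> \<le> 2")
  case True
  have "max 0 (2 - u\<^sup>2) * \<bar>u\<bar> \<le> 2 * 2" using True by (intro mult_mono) auto
  then show ?thesis by (simp add: hump_def abs_mult)
next
  case False
  then have "4 < u\<^sup>2" using power_strict_mono[of 2 "\<bar>u\<bar>" 2] by simp
  then show ?thesis by (simp add: hump_def)
qed

lemma hump_Lipschitz: "\<bar>hump u - hump v\<bar> \<le> 10 * \<bar>u - v\<bar>"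
proof -
  \<comment> \<open>The hump vanishes outside [-2, 2], and clamping to this interval does not increase distances.\<close>
  define c where "c x = max (-2) (min 2 x)" for x :: real
  have hc: "hump (c x) = hump x" for x
  proof (cases "\<bar>x\<bar> \<le> 2")
    case True then show ?thesis by (auto simp: c_def)
  next
    case False
    then have "4 < x\<^sup>2" using power_strict_mono[of 2 "\<bar>x\<bar>" 2] by simp
    moreover have "(c x)\<^sup>2 = 4" using False by (auto simp: c_def max_def min_def abs_if split: if_splits)
    ultimately show ?thesis by (simp add: hump_def)
  qed
  have c2: "\<bar>c x\<bar> \<le> 2" for x by (auto simp: c_def)
  have "hump (c u) - hump (c v) = (max 0 (2 - (c u)\<^sup>2) - max 0 (2 - (c v)\<^sup>2)) * c u + max 0 (2 - (c v)\<^sup>2) * (c u - c v)"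
    by (simp add: hump_def algebra_simps)
  then have "\<bar>hump (c u) - hump (c v)\<bar>
      \<le> \<bar>max 0 (2 - (c u)\<^sup>2) - max 0 (2 - (c v)\<^sup>2)\<bar> * \<bar>c u\<bar> + max 0 (2 - (c v)\<^sup>2) * \<bar>c u - c v\<bar>"
    using abs_mult_add_mult_le[of "max 0 (2 - (c u)\<^sup>2) - max 0 (2 - (c v)\<^sup>2)" "c u" "max 0 (2 - (c v)\<^sup>2)" "c u - c v"]
    by simp
  also have "\<dots> \<le> (4 * \<bar>c u - c v\<bar>) * 2 + 2 * \<bar>c u - c v\<bar>"
  proof (intro add_mono mult_mono c2)
    have "\<bar>max 0 (2 - (c u)\<^sup>2) - max 0 (2 - (c v)\<^sup>2)\<bar> \<le> \<bar>(c v)\<^sup>2 - (c u)\<^sup>2\<bar>"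
      using abs_max0_diff_le[of "2 - (c u)\<^sup>2" "2 - (c v)\<^sup>2"] by simp
    also have "\<dots> = \<bar>c u - c v\<bar> * \<bar>c u + c v\<bar>"
      by (simp add: power2_eq_square algebra_simps flip: abs_mult)
    also have "\<dots> \<le> \<bar>c u - c v\<bar> * 4" using c2[of u] c2[of v] by (intro mult_left_mono) auto
    finally show "\<bar>max 0 (2 - (c u)\<^sup>2) - max 0 (2 - (c v)\<^sup>2)\<bar> \<le> 4 * \<bar>c u - c v\<bar>" by simp
  qed auto
  also have "\<dots> \<le> 10 * \<bar>u - v\<bar>"
    using abs_max0_diff_le[of 0 0] by (auto simp: c_def max_def min_def)
  finally show ?thesis by (simp add: hc)
qed

lemma abs_sin_diff_le: "\<bar>sin x - sin y\<bar> \<le> \<bar>x - y\<bar>" for x y :: real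
proof -
  have "norm (sin x - sin y) \<le> 1 * norm (x - y)"
    by (rule field_differentiable_bound[where S=UNIV and f'=cos])
       (auto intro: DERIV_sin abs_cos_le_one)
  then show ?thesis by simp
qed

lemma abs_cos_diff_le: "\<bar>cos x - cos y\<bar> \<le> \<bar>x - y\<bar>" for x y :: real
  using abs_sin_diff_le[of "pi/2 - x" "pi/2 - y"] by (simp add: sin_diff abs_minus_commute)

text \<open>Jordan's inequality, from the concavity of the sine.\<close>

lemma sin_pi_ge: "0 \<le> x \<Longrightarrow> x \<le> 1/2 \<Longrightarrow> 2 * x \<le> sin (pi * x)" for x :: real
proof -
  assume x: "0 \<le> x" "x \<le> 1/2"
  have "convex_on {0..1/2} (\<lambda>x. - sin (pi * x))"
  proof (rule f''_ge0_imp_convex)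
    fix x :: real assume "x \<in> {0..1/2}"
    then have "0 \<le> pi * x" "pi * x \<le> pi" using mult_left_mono[of x 1 pi] by auto
    then show "0 \<le> pi * (pi * sin (pi * x))" by (simp add: sin_ge_zero)
  qed (auto intro!: derivative_eq_intros simp: mult_ac)
  from convex_onD[OF this, of "2 * x" 0 "1/2"] x show ?thesis by (simp add: mult.commute)
qed

lemma abs_sin_shift: "l \<noteq> 0 \<Longrightarrow> \<bar>sin (pi * t / l)\<bar> = \<bar>sin (pi * (t - l * of_int i) / l)\<bar>"
proof -
  assume "l \<noteq> 0"
  then have "pi * t / l = pi * (t - l * of_int i) / l + pi * of_int i"
    by (simp add: field_simps)
  then have "sin (pi * t / l) = sin (pi * (t - l * of_int i) / l) * cos (pi * of_int i)
      + cos (pi * (t - l * of_int i) / l) * sin (pi * of_int i)"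
    by (metis sin_add)
  moreover have "sin (pi * of_int i) = 0" by simp
  moreover have "\<bar>cos (pi * of_int i)\<bar> = 1"
  proof -
    have "(cos (pi * of_int i))\<^sup>2 = 1" using calculation(2) sin_cos_squared_add[of "pi * of_int i"] by simp
    then show ?thesis by (metis abs_1 power2_eq_1_iff abs_minus_cancel)
  qed
  ultimately show ?thesis by (simp add: abs_mult)
qed

context
  fixes l d :: real
  assumes d: "0 < d" "d \<le> l"
begin

lemma l_pos: "0 < l" using d by linarith

lemma ridge_nonneg: "0 \<le> ridge l d t" by (simp add: ridge_def sqp_def)

lemma ridge_deriv: "(ridge l d has_real_derivative ridge' l d t) (at t)"
proof -
  have 1: "((\<lambda>t. 2 - (ridge_arg l d t)\<^sup>2) has_real_derivative
      - 2 * ridge_arg l d t * (pi / d * cos (pi * t / l))) (at t)"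
  proof -
    have "((\<lambda>t. sin (pi * t / l)) has_real_derivative cos (pi * t / l) * (pi / l)) (at t)"
      using l_pos by (auto intro!: derivative_eq_intros)
    from DERIV_cmult[OF this, of "l / d"]
    have "(ridge_arg l d has_real_derivative pi / d * cos (pi * t / l)) (at t)"
      using d l_pos by (simp add: ridge_arg_def[abs_def] mult.commute)
    from DERIV_diff[OF DERIV_const DERIV_power[OF this, of 2], of 2] show ?thesis
      by (simp add: mult_ac)
  qed
  have "(ridge l d has_real_derivative
      2 * max 0 (2 - (ridge_arg l d t)\<^sup>2) * (- 2 * ridge_arg l d t * (pi / d * cos (pi * t / l)))) (at t)"
    unfolding ridge_def by (rule DERIV_chain2[OF has_derivative_sqp 1])
  then show ?thesis by (simp add: ridge'_def hump_def mult_ac)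
qed

lemma ridge_ge_1:
  assumes "\<bar>t - l * of_int i\<bar> < d / 4"
  shows "1 \<le> ridge l d t"
proof -
  have "\<bar>sin (pi * t / l)\<bar> \<le> \<bar>pi * (t - l * of_int i) / l\<bar>"
    using abs_sin_shift[of l t i] abs_sin_diff_le[of "pi * (t - l * of_int i) / l" 0] l_pos by simp
  also have "\<dots> = pi * \<bar>t - l * of_int i\<bar> / l" using l_pos by (simp add: abs_mult)
  also have "\<dots> \<le> 4 * (d / 4) / l"
    using assms pi_less_4 pi_gt_zero l_pos by (intro divide_right_mono mult_mono) auto
  finally have "\<bar>ridge_arg l d t\<bar> \<le> 1"
    using d l_pos by (simp add: ridge_arg_def abs_mult field_simps)
  then have "(ridge_arg l d t)\<^sup>2 \<le> 1" by (simp add: abs_square_le_1)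
  then show ?thesis by (simp add: ridge_def sqp_def)
qed

lemma ridge_eq_0:
  assumes "\<And>i::int. d \<le> \<bar>t - l * of_int i\<bar>"
  shows "ridge l d t = 0" "ridge' l d t = 0"
proof -
  define i where "i = round (t / l)"
  define x where "x = \<bar>t - l * of_int i\<bar> / l"
  have "\<bar>of_int i - t / l\<bar> \<le> 1 / 2" unfolding i_def by (rule of_int_round_abs_le)
  moreover have "x = \<bar>of_int i - t / l\<bar>"
  proof -
    have "t - l * of_int i = l * (t / l - of_int i)" using l_pos by (simp add: field_simps)
    then show ?thesis unfolding x_def using l_pos by (simp add: abs_mult abs_minus_commute)
  qed
  ultimately have x: "0 \<le> x" "x \<le> 1/2" by auto
  have "\<bar>sin (pi * t / l)\<bar> = \<bar>sin (pi * x)\<bar>"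
  proof -
    have "pi * x = pi * (t - l * of_int i) / l \<or> pi * x = - (pi * (t - l * of_int i) / l)"
      unfolding x_def by (cases "0 \<le> t - l * of_int i") (auto simp: right_diff_distrib diff_divide_distrib)
    then have "\<bar>sin (pi * x)\<bar> = \<bar>sin (pi * (t - l * of_int i) / l)\<bar>"
      by (elim disjE) (simp_all only: sin_minus abs_minus_cancel)
    then show ?thesis using abs_sin_shift[of l t i] l_pos by simp
  qed
  also have "\<dots> \<ge> 2 * x" using sin_pi_ge[OF x] by simp
  also have "2 * x \<ge> 2 * (d / l)" using assms[of i] l_pos by (simp add: x_def divide_right_mono)
  finally have "2 \<le> \<bar>ridge_arg l d t\<bar>"
    using d l_pos by (simp add: ridge_arg_def abs_mult field_simps)
  then have "4 \<le> (ridge_arg l d t)\<^sup>2" using power_mono[of 2 "\<bar>ridge_arg l d t\<bar>" 2] by simp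
  then show "ridge l d t = 0" "ridge' l d t = 0" by (simp_all add: ridge_def sqp_def ridge'_def hump_def)
qed

lemma abs_ridge'_le: "\<bar>ridge' l d t\<bar> \<le> 64 / d"
proof -
  have "\<bar>ridge' l d t\<bar> = 4 * pi / d * (\<bar>hump (ridge_arg l d t)\<bar> * \<bar>cos (pi * t / l)\<bar>)"
    using d by (simp add: ridge'_def abs_mult)
  also have "\<dots> \<le> 4 * 4 / d * (4 * 1)"
    using d pi_less_4 pi_gt_zero by (intro mult_mono divide_right_mono abs_hump_le abs_cos_le_one) auto
  finally show ?thesis by simp
qed

lemma ridge'_Lipschitz: "\<bar>ridge' l d s - ridge' l d t\<bar> \<le> 1000 / d\<^sup>2 * \<bar>s - t\<bar>"
proof -
  let ?u = "ridge_arg l d"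
  have u: "\<bar>?u s - ?u t\<bar> \<le> 4 / d * \<bar>s - t\<bar>"
  proof -
    have "\<bar>?u s - ?u t\<bar> = l / d * \<bar>sin (pi * s / l) - sin (pi * t / l)\<bar>"
    proof -
      have "?u s - ?u t = l / d * (sin (pi * s / l) - sin (pi * t / l))"
        by (simp add: ridge_arg_def right_diff_distrib)
      then show ?thesis using d l_pos by (simp only: abs_mult) simp
    qed
    also have "\<dots> \<le> l / d * \<bar>pi * s / l - pi * t / l\<bar>"
      using d l_pos by (intro mult_left_mono abs_sin_diff_le) auto
    also have "\<dots> = pi / d * \<bar>s - t\<bar>"
    proof -
      have "pi * s / l - pi * t / l = pi / l * (s - t)" by (simp add: right_diff_distrib diff_divide_distrib)
      then have "\<bar>pi * s / l - pi * t / l\<bar> = pi / l * \<bar>s - t\<bar>" using l_pos by (simp only: abs_mult) simp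
      then show ?thesis using l_pos by simp
    qed
    also have "\<dots> \<le> 4 / d * \<bar>s - t\<bar>"
      using d pi_less_4 by (intro mult_right_mono divide_right_mono) auto
    finally show ?thesis .
  qed
  have c: "\<bar>cos (pi * s / l) - cos (pi * t / l)\<bar> \<le> 4 / d * \<bar>s - t\<bar>"
  proof -
    have "\<bar>cos (pi * s / l) - cos (pi * t / l)\<bar> \<le> \<bar>pi * s / l - pi * t / l\<bar>" by (rule abs_cos_diff_le)
    also have "\<dots> = pi / l * \<bar>s - t\<bar>"
    proof -
      have "pi * s / l - pi * t / l = pi / l * (s - t)" by (simp add: right_diff_distrib diff_divide_distrib)
      then show ?thesis using l_pos by (simp only: abs_mult) simp
    qed
    also have "\<dots> \<le> 4 / d * \<bar>s - t\<bar>"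
      using d l_pos pi_less_4 by (intro mult_right_mono frac_le) auto
    finally show ?thesis .
  qed
  have "ridge' l d s - ridge' l d t = - (4 * pi / d) *
      ((hump (?u s) - hump (?u t)) * cos (pi * s / l) + hump (?u t) * (cos (pi * s / l) - cos (pi * t / l)))"
    by (simp add: ridge'_def algebra_simps)
  then have "\<bar>ridge' l d s - ridge' l d t\<bar> = 4 * pi / d *
      \<bar>(hump (?u s) - hump (?u t)) * cos (pi * s / l) + hump (?u t) * (cos (pi * s / l) - cos (pi * t / l))\<bar>"
    using d by (simp only: abs_mult abs_minus_cancel) simp
  also have "\<dots> \<le> 4 * 4 / d * (10 * (4 / d * \<bar>s - t\<bar>) * 1 + 4 * (4 / d * \<bar>s - t\<bar>))"
  proof (rule mult_mono)
    have "\<bar>(hump (?u s) - hump (?u t)) * cos (pi * s / l) + hump (?u t) * (cos (pi * s / l) - cos (pi * t / l))\<bar>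
        \<le> \<bar>hump (?u s) - hump (?u t)\<bar> * \<bar>cos (pi * s / l)\<bar> + \<bar>hump (?u t)\<bar> * \<bar>cos (pi * s / l) - cos (pi * t / l)\<bar>"
      by (metis abs_mult abs_triangle_ineq)
    also have "\<dots> \<le> 10 * (4 / d * \<bar>s - t\<bar>) * 1 + 4 * (4 / d * \<bar>s - t\<bar>)"
      using d u by (intro add_mono mult_mono abs_cos_le_one abs_hump_le c order_trans[OF hump_Lipschitz]) auto
    finally show "\<bar>(hump (?u s) - hump (?u t)) * cos (pi * s / l) + hump (?u t) * (cos (pi * s / l) - cos (pi * t / l))\<bar>
        \<le> 10 * (4 / d * \<bar>s - t\<bar>) * 1 + 4 * (4 / d * \<bar>s - t\<bar>)" .
  qed (use d pi_less_4 in \<open>auto intro!: divide_right_mono\<close>)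
  also have "\<dots> = 896 / d\<^sup>2 * \<bar>s - t\<bar>" by (simp add: power2_eq_square field_simps)
  also have "\<dots> \<le> 1000 / d\<^sup>2 * \<bar>s - t\<bar>" using d by (intro mult_right_mono divide_right_mono) auto
  finally show ?thesis .
qed

lemma ridge_Lipschitz: "\<bar>ridge l d s - ridge l d t\<bar> \<le> 64 / d * \<bar>s - t\<bar>"
proof -
  have "norm (ridge l d s - ridge l d t) \<le> 64 / d * norm (s - t)"
    using ridge_deriv abs_ridge'_le
    by (intro field_differentiable_bound[where S=UNIV and f'="ridge' l d"]) auto
  then show ?thesis by simp
qed

end

context orthonormal_set
begin

text \<open>Equal to 1 where all ridges vanish and to 0 as soon as one of them reaches 1. The sum over the
  coordinates avoids the product rule.\<close>

definition cutoff :: "real \<Rightarrow> real \<Rightarrow> 'a \<Rightarrow> real" where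
  "cutoff l d z = sqp (1 - (\<Sum>b\<in>B. ridge l d (z \<bullet> b)))"

definition cutoff_grad :: "real \<Rightarrow> real \<Rightarrow> 'a \<Rightarrow> 'a" where
  "cutoff_grad l d z = (\<Sum>b\<in>B. (- 2 * max 0 (1 - (\<Sum>c\<in>B. ridge l d (z \<bullet> c))) * ridge' l d (z \<bullet> b)) *\<^sub>R b)"

lemma cutoff_has_derivative:
  assumes "0 < d" "d \<le> l"
  shows "(cutoff l d has_derivative (\<lambda>h. cutoff_grad l d z \<bullet> h)) (at z)"
proof -
  have r: "((\<lambda>z. ridge l d (z \<bullet> b)) has_derivative (\<lambda>h. ridge' l d (z \<bullet> b) * (h \<bullet> b))) (at z)" for b
  proof -
    have "((\<lambda>z. z \<bullet> b) has_derivative (\<lambda>h. h \<bullet> b)) (at z)" by (auto intro!: derivative_eq_intros)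
    moreover have "(ridge l d has_derivative (\<lambda>h. ridge' l d (z \<bullet> b) * h)) (at (z \<bullet> b))"
      using ridge_deriv[OF assms] by (simp add: has_field_derivative_def)
    ultimately show ?thesis by (drule_tac diff_chain_at) (auto simp: o_def)
  qed
  have s: "((\<lambda>z. 1 - (\<Sum>b\<in>B. ridge l d (z \<bullet> b))) has_derivative
      (\<lambda>h. 0 - (\<Sum>b\<in>B. ridge' l d (z \<bullet> b) * (h \<bullet> b)))) (at z)"
    by (intro has_derivative_diff has_derivative_const has_derivative_sum r)
  have h1: "(sqp has_derivative (\<lambda>h. 2 * max 0 (1 - (\<Sum>b\<in>B. ridge l d (z \<bullet> b))) * h))
      (at (1 - (\<Sum>b\<in>B. ridge l d (z \<bullet> b))))"
    using has_derivative_sqp by (simp add: has_field_derivative_def)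
  have h2: "cutoff_grad l d z \<bullet> h = 2 * max 0 (1 - (\<Sum>b\<in>B. ridge l d (z \<bullet> b))) *
      (0 - (\<Sum>b\<in>B. ridge' l d (z \<bullet> b) * (h \<bullet> b)))" for h
  proof -
    let ?m = "max 0 (1 - (\<Sum>b\<in>B. ridge l d (z \<bullet> b)))"
    have "cutoff_grad l d z \<bullet> h = (\<Sum>b\<in>B. - 2 * ?m * (ridge' l d (z \<bullet> b) * (h \<bullet> b)))"
      unfolding cutoff_grad_def inner_sum_left
      by (intro sum.cong refl) (simp only: inner_scaleR_left inner_commute[of h] mult.assoc)
    then show ?thesis by (simp only: sum_distrib_left[symmetric]) simp
  qed
  show ?thesis
    using diff_chain_at[OF s h1] unfolding cutoff_def[abs_def] o_def h2 .
qed

lemma cutoff_range: "0 < d \<Longrightarrow> d \<le> l \<Longrightarrow> 0 \<le> cutoff l d z \<and> cutoff l d z \<le> 1"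
proof -
  assume d: "0 < d" "d \<le> l"
  have "0 \<le> (\<Sum>b\<in>B. ridge l d (z \<bullet> b))" using ridge_nonneg[OF d] by (intro sum_nonneg) auto
  then show ?thesis by (auto simp: cutoff_def sqp_def power_le_one)
qed

lemma cutoff_near_grid:
  assumes "0 < d" "d \<le> l" "b \<in> B" "\<bar>z \<bullet> b - l * of_int i\<bar> < d / 4"
  shows "cutoff l d z = 0" "cutoff_grad l d z = 0"
proof -
  have "1 \<le> ridge l d (z \<bullet> b)" by (rule ridge_ge_1[OF assms(1,2,4)])
  also have "\<dots> \<le> (\<Sum>b\<in>B. ridge l d (z \<bullet> b))"
    using ridge_nonneg[OF assms(1,2)] finite_basis assms(3) by (intro member_le_sum) auto
  finally show "cutoff l d z = 0" "cutoff_grad l d z = 0" by (simp_all add: cutoff_def cutoff_grad_def sqp_def)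
qed

lemma cutoff_off_grid:
  assumes "0 < d" "d \<le> l" "\<And>b i. b \<in> B \<Longrightarrow> d \<le> \<bar>z \<bullet> b - l * of_int i\<bar>"
  shows "cutoff l d z = 1" "cutoff_grad l d z = 0"
  using ridge_eq_0[OF assms(1,2)] assms(3) by (simp_all add: cutoff_def cutoff_grad_def sqp_def)

text \<open>Each derivative of the cut-off costs a factor of the order of \<open>1 / d\<close>; the constant does not depend
  on the scales.\<close>

lemma cutoff_bounds:
  "\<exists>C\<ge>0. \<forall>l d. 0 < d \<longrightarrow> d \<le> l \<longrightarrow> (\<forall>x y.
     norm (cutoff_grad l d x) \<le> C / d \<and>
     \<bar>cutoff l d x - cutoff l d y\<bar> \<le> C / d * norm (x - y) \<and>
     norm (cutoff_grad l d x - cutoff_grad l d y) \<le> C / d\<^sup>2 * norm (x - y))"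
proof (intro exI conjI allI impI)
  let ?C = "real k * (128 * real k * 64 + 2000) + 128 * real k"
  show "0 \<le> ?C" by simp
  fix l d :: real and x y :: 'a assume d: "0 < d" "d \<le> l"
  let ?S = "\<lambda>z. \<Sum>b\<in>B. ridge l d (z \<bullet> b)" and ?m = "\<lambda>z. max 0 (1 - (\<Sum>b\<in>B. ridge l d (z \<bullet> b)))"
  have S0: "0 \<le> ?S z" for z using ridge_nonneg[OF d] by (intro sum_nonneg) auto
  then have m1: "0 \<le> ?m z" "?m z \<le> 1" for z by auto
  have inner_le: "\<bar>x \<bullet> b - y \<bullet> b\<bar> \<le> norm (x - y)" if "b \<in> B" for b
    using abs_inner_basis_le[OF that, of "x - y"] by (simp add: inner_diff_left)
  have mL: "\<bar>?m x - ?m y\<bar> \<le> real k * (64 / d * norm (x - y))"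
  proof -
    have "\<bar>?m x - ?m y\<bar> \<le> \<bar>?S y - ?S x\<bar>" using abs_max0_diff_le[of "1 - ?S x" "1 - ?S y"] by simp
    also have "\<dots> \<le> (\<Sum>b\<in>B. \<bar>ridge l d (x \<bullet> b) - ridge l d (y \<bullet> b)\<bar>)"
      using sum_abs[of "\<lambda>b. ridge l d (x \<bullet> b) - ridge l d (y \<bullet> b)" B] by (simp add: sum_subtractf abs_minus_commute)
    also have "\<dots> \<le> (\<Sum>b\<in>B. 64 / d * norm (x - y))"
    proof (rule sum_mono)
      fix b assume "b \<in> B"
      then show "\<bar>ridge l d (x \<bullet> b) - ridge l d (y \<bullet> b)\<bar> \<le> 64 / d * norm (x - y)"
        using d inner_le by (intro order_trans[OF ridge_Lipschitz[OF d]] mult_left_mono) auto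
    qed
    finally show ?thesis by simp
  qed
  have "norm (cutoff_grad l d x) \<le> real k * (128 / d)"
    unfolding cutoff_grad_def
  proof (rule norm_comb_le)
    fix b
    have "\<bar>- 2 * ?m x * ridge' l d (x \<bullet> b)\<bar> = 2 * (?m x * \<bar>ridge' l d (x \<bullet> b)\<bar>)"
      using m1(1)[of x] by (simp add: abs_mult)
    also have "\<dots> \<le> 2 * (1 * (64 / d))" using d m1 by (intro mult_left_mono mult_mono abs_ridge'_le[OF d]) auto
    finally show "\<bar>- 2 * ?m x * ridge' l d (x \<bullet> b)\<bar> \<le> 128 / d" by simp
  qed
  also have "\<dots> \<le> ?C / d" using d by (simp add: field_simps)
  finally show "norm (cutoff_grad l d x) \<le> ?C / d" .
  have "cutoff l d x - cutoff l d y = (?m x - ?m y) * (?m x + ?m y)"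
    by (simp add: cutoff_def sqp_def power2_eq_square algebra_simps)
  then have "\<bar>cutoff l d x - cutoff l d y\<bar> = \<bar>?m x - ?m y\<bar> * (?m x + ?m y)"
    using m1(1) by (simp only: abs_mult) (simp add: add_nonneg_nonneg)
  also have "\<dots> \<le> (real k * (64 / d * norm (x - y))) * 2"
    using m1(2)[of x] m1(2)[of y] m1(1)[of x] m1(1)[of y] d by (intro mult_mono mL) auto
  also have "\<dots> \<le> ?C / d * norm (x - y)"
    using d by (simp add: divide_right_mono mult_right_mono field_simps)
  finally show "\<bar>cutoff l d x - cutoff l d y\<bar> \<le> ?C / d * norm (x - y)" .
  have "cutoff_grad l d x - cutoff_grad l d y
      = (\<Sum>b\<in>B. (- 2 * (?m x * ridge' l d (x \<bullet> b) - ?m y * ridge' l d (y \<bullet> b))) *\<^sub>R b)"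
    unfolding cutoff_grad_def sum_subtractf[symmetric] by (intro sum.cong) (auto simp: algebra_simps)
  also have "norm \<dots> \<le> real k * ((128 * real k * 64 + 2000) / d\<^sup>2 * norm (x - y))"
  proof (rule norm_comb_le)
    fix b assume b: "b \<in> B"
    have "\<bar>?m x * ridge' l d (x \<bullet> b) - ?m y * ridge' l d (y \<bullet> b)\<bar>
        = \<bar>(?m x - ?m y) * ridge' l d (x \<bullet> b) + ?m y * (ridge' l d (x \<bullet> b) - ridge' l d (y \<bullet> b))\<bar>"
      by (simp add: algebra_simps)
    also have "\<dots> \<le> \<bar>?m x - ?m y\<bar> * \<bar>ridge' l d (x \<bullet> b)\<bar> + ?m y * \<bar>ridge' l d (x \<bullet> b) - ridge' l d (y \<bullet> b)\<bar>"
      using abs_mult_add_mult_le[of "?m x - ?m y" "ridge' l d (x \<bullet> b)" "?m y" "ridge' l d (x \<bullet> b) - ridge' l d (y \<bullet> b)"]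
      by simp
    also have "\<dots> \<le> (real k * (64 / d * norm (x - y))) * (64 / d) + 1 * (1000 / d\<^sup>2 * norm (x - y))"
    proof (intro add_mono mult_mono mL abs_ridge'_le[OF d] m1)
      show "\<bar>ridge' l d (x \<bullet> b) - ridge' l d (y \<bullet> b)\<bar> \<le> 1000 / d\<^sup>2 * norm (x - y)"
        using d inner_le[OF b] by (intro order_trans[OF ridge'_Lipschitz[OF d]] mult_left_mono) auto
    qed (use d in auto)
    finally have "2 * \<bar>?m x * ridge' l d (x \<bullet> b) - ?m y * ridge' l d (y \<bullet> b)\<bar>
        \<le> 2 * ((real k * (64 / d * norm (x - y))) * (64 / d) + 1 * (1000 / d\<^sup>2 * norm (x - y)))"
      by (rule mult_left_mono) simp
    also have "\<dots> = (128 * real k * 64 + 2000) / d\<^sup>2 * norm (x - y)"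
      using d by (simp add: power2_eq_square field_simps)
    finally show "\<bar>- 2 * (?m x * ridge' l d (x \<bullet> b) - ?m y * ridge' l d (y \<bullet> b))\<bar>
        \<le> (128 * real k * 64 + 2000) / d\<^sup>2 * norm (x - y)"
      by (simp only: abs_mult)
  qed
  also have "\<dots> \<le> ?C / d\<^sup>2 * norm (x - y)"
    unfolding mult.assoc[symmetric] using d by (intro mult_right_mono) (auto simp: field_simps)
  finally show "norm (cutoff_grad l d x - cutoff_grad l d y) \<le> ?C / d\<^sup>2 * norm (x - y)" .
qed

end


section \<open>The corrections of all generations\<close>

text \<open>The multiple of \<open>L\<close> that separates the two points is close to both.\<close>

lemma floor_neq_near_multiple:
  fixes s t L \<eta> :: real
  assumes "0 < L" "\<bar>s - t\<bar> < \<eta>" "\<lfloor>s / L\<rfloor> \<noteq> \<lfloor>t / L\<rfloor>"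
  shows "\<exists>i::int. \<bar>s - L * of_int i\<bar> < \<eta> \<and> \<bar>t - L * of_int i\<bar> < \<eta>"
proof -
  have main: "\<exists>i::int. \<bar>u - L * of_int i\<bar> < \<eta> \<and> \<bar>v - L * of_int i\<bar> < \<eta>"
    if "\<lfloor>u / L\<rfloor> < \<lfloor>v / L\<rfloor>" "\<bar>u - v\<bar> < \<eta>" for u v
  proof (intro exI conjI)
    let ?i = "\<lfloor>v / L\<rfloor>"
    have "u / L < of_int ?i" using that(1) by linarith
    then have 1: "u < L * of_int ?i" using assms(1) by (simp add: field_simps)
    have "of_int ?i \<le> v / L" by linarith
    then have 2: "L * of_int ?i \<le> v" using assms(1) by (simp only: pos_le_divide_eq mult.commute)
    show "\<bar>u - L * of_int ?i\<bar> < \<eta>" "\<bar>v - L * of_int ?i\<bar> < \<eta>" using 1 2 that(2) by linarith+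
  qed
  show ?thesis
    using assms(2,3) main[of s t] main[of t s] by (cases "\<lfloor>s / L\<rfloor> < \<lfloor>t / L\<rfloor>") (auto simp: abs_minus_commute)
qed

text \<open>The slopes \<open>A\<close> are bounded and Lipschitz on the whole space. The level \<open>m\<close> fixes the size \<open>2\<^sup>-\<^sup>m\<close> of the
  base cube, and the gaps of the cells of side \<open>l\<close> have width \<open>l\<^sup>\<beta>\<close>.\<close>

locale cantor_graph = orthonormal_set B for B :: "'a::euclidean_space set" +
  fixes A :: "'a \<Rightarrow> 'a \<Rightarrow>\<^sub>L 'a" and \<Lambda> :: real and m :: nat and \<beta> :: real
  assumes \<Lambda>_pos: "0 < \<Lambda>" and A_Lipschitz: "\<And>x y. norm (A x - A y) \<le> \<Lambda> * norm (x - y)"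
    and A_bounded: "\<And>x. norm (A x) \<le> \<Lambda>"
    and A_normal: "\<And>x w. blinfun_apply (A x) w \<in> orthogonal_comp (span B)"
    and A_proj: "\<And>x w. blinfun_apply (A x) (proj w) = blinfun_apply (A x) w"
    and \<beta>: "1 < \<beta>" "\<beta> < 2"
begin

definition len :: "nat \<Rightarrow> real" where "len j = 1 / 2 ^ (m + j)"
definition gap :: "nat \<Rightarrow> real" where "gap j = len j powr \<beta>"

lemma len_pos: "0 < len j" by (simp add: len_def)
lemma len_le_1: "len j \<le> 1" by (simp add: len_def)
lemma len_Suc: "len (Suc j) = len j / 2" by (simp add: len_def)
lemma len_add: "len j = len i / 2 ^ (j - i)" if "i \<le> j"
  using that by (simp add: len_def flip: power_add)
lemma gap_pos: "0 < gap j" using len_pos[of j] by (simp add: gap_def)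
lemma gap_le_len: "gap j \<le> len j"
  using powr_mono'[of 1 \<beta> "len j"] \<beta>(1) len_pos[of j] len_le_1[of j] by (simp add: gap_def)

lemma len_powr: "len j powr c = len 0 powr c * (2 powr (- c)) ^ j"
proof -
  have "len j = len 0 * 2 powr (- real j)"
    by (simp add: len_def powr_minus powr_realpow power_add divide_inverse)
  then have "len j powr c = len 0 powr c * 2 powr (- real j * c)"
    using len_pos[of 0] by (simp add: powr_mult powr_powr)
  moreover have "(2 powr (- c)) ^ j = (2::real) powr (- real j * c)"
    by (simp add: powr_realpow[symmetric] powr_powr mult.commute)
  ultimately show ?thesis by simp
qed

lemma summable_len_powr: "0 < c \<Longrightarrow> summable (\<lambda>j. len j powr c)"
proof -
  assume "0 < c"
  then have "summable (\<lambda>j. len 0 powr c * (2 powr (- c)) ^ j)"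
    by (intro summable_mult summable_geometric) (simp add: powr_less_one)
  moreover have "(\<lambda>j. len j powr c) = (\<lambda>j. len 0 powr c * (2 powr (- c)) ^ j)"
    by (rule ext) (rule len_powr)
  ultimately show ?thesis by simp
qed

lemma summable_len: "summable len"
  using summable_len_powr[of 1] len_pos by (simp add: less_imp_le)

text \<open>The order of magnitude of the derivative of the \<open>j\<close>-th correction: slope times cell size divided by
  gap width.\<close>

lemma len2_gap: "(len j)\<^sup>2 / gap j = len j powr (2 - \<beta>)"
  using powr_numeral[of "len j" "num.Bit0 num.One"] len_pos[of j] by (simp add: gap_def powr_diff)

definition base :: "'a set" where "base = {z. \<forall>b\<in>B. 0 \<le> z \<bullet> b \<and> z \<bullet> b < len 0}"

text \<open>The lower corner of the cell of generation \<open>j\<close> that contains the projection of \<open>z\<close>.\<close>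

definition corner :: "nat \<Rightarrow> 'a \<Rightarrow> 'a" where
  "corner j z = (\<Sum>b\<in>B. (len j * of_int \<lfloor>z \<bullet> b / len j\<rfloor>) *\<^sub>R b)"

text \<open>The height of the graph above the corner as predicted by the affine map of the parent cell. It
  depends on \<open>z\<close> only through the cells that contain \<open>z\<close>.\<close>

fun height :: "nat \<Rightarrow> 'a \<Rightarrow> 'a" where
  "height 0 z = 0"
| "height (Suc j) z = height j z + A (corner j z + height j z) (corner (Suc j) z - corner j z)"

definition slope :: "nat \<Rightarrow> 'a \<Rightarrow> 'a \<Rightarrow>\<^sub>L 'a" where "slope j z = A (corner j z + height j z)"

text \<open>The change of slope from one generation to the next. In generation 0 it starts from slope 0.\<close>

definition incr :: "nat \<Rightarrow> 'a \<Rightarrow> 'a \<Rightarrow>\<^sub>L 'a" where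
  "incr j z = (if z \<in> base then case j of 0 \<Rightarrow> slope 0 z | Suc i \<Rightarrow> slope (Suc i) z - slope i z else 0)"

lemma corner_proj: "corner j (proj z) = corner j z"
  by (auto simp: corner_def proj_inner intro!: sum.cong)

lemma norm_proj_corner: "norm (proj z - corner j z) \<le> real k * len j"
proof -
  have "proj z - corner j z = (\<Sum>b\<in>B. (z \<bullet> b - len j * of_int \<lfloor>z \<bullet> b / len j\<rfloor>) *\<^sub>R b)"
    by (simp add: proj_apply corner_def sum_subtractf scaleR_diff_left)
  also have "norm \<dots> \<le> real k * len j"
  proof (rule norm_comb_le)
    fix b
    have "\<bar>z \<bullet> b / len j - of_int \<lfloor>z \<bullet> b / len j\<rfloor>\<bar> \<le> 1" by linarith
    then have "len j * \<bar>z \<bullet> b / len j - of_int \<lfloor>z \<bullet> b / len j\<rfloor>\<bar> \<le> len j * 1"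
      using len_pos[of j] by (intro mult_left_mono) auto
    also have "len j * \<bar>z \<bullet> b / len j - of_int \<lfloor>z \<bullet> b / len j\<rfloor>\<bar>
        = \<bar>len j * (z \<bullet> b / len j - of_int \<lfloor>z \<bullet> b / len j\<rfloor>)\<bar>"
      using len_pos[of j] by (simp add: abs_mult)
    also have "len j * (z \<bullet> b / len j - of_int \<lfloor>z \<bullet> b / len j\<rfloor>) = z \<bullet> b - len j * of_int \<lfloor>z \<bullet> b / len j\<rfloor>"
      using len_pos[of j] by (simp add: right_diff_distrib)
    finally show "\<bar>z \<bullet> b - len j * of_int \<lfloor>z \<bullet> b / len j\<rfloor>\<bar> \<le> len j" by simp
  qed
  finally show ?thesis .
qed

lemma norm_corner_Suc: "norm (corner (Suc j) z - corner j z) \<le> 2 * real k * len j"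
proof -
  have "norm (corner (Suc j) z - corner j z) \<le> norm (proj z - corner j z) + norm (proj z - corner (Suc j) z)"
    using norm_triangle_ineq4[of "proj z - corner j z" "proj z - corner (Suc j) z"] by simp
  also have "\<dots> \<le> real k * len j + real k * len (Suc j)" by (intro add_mono norm_proj_corner)
  also have "\<dots> \<le> 2 * real k * len j" using len_pos[of j] by (simp add: len_Suc mult_left_mono)
  finally show ?thesis .
qed

lemma norm_incr_le: "norm (incr j z) \<le> 2 * \<Lambda>"
proof -
  have "norm (slope i z) \<le> \<Lambda>" for i by (simp add: slope_def A_bounded)
  then have "norm (slope 0 z) \<le> 2 * \<Lambda>" "norm (slope (Suc i) z - slope i z) \<le> 2 * \<Lambda>" for i
    using norm_triangle_ineq4[of "slope (Suc i) z" "slope i z"] \<Lambda>_pos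
    by (smt (verit))+
  then show ?thesis using \<Lambda>_pos by (auto simp: incr_def split: nat.split)
qed

definition incr_const :: real where
  "incr_const = \<Lambda> / len 0 + 4 * real k * \<Lambda> * (1 + \<Lambda>)"

lemma incr_const_nonneg: "0 \<le> incr_const"
  using \<Lambda>_pos len_pos[of 0] by (simp add: incr_const_def)

text \<open>The parent slope is taken at a point at distance \<open>O(l\<^sub>j)\<close>. The first summand of the constant only serves
  generation 0, which has no parent.\<close>

lemma norm_incr_le_len: "norm (incr j z) \<le> incr_const * len j"
proof (cases j)
  case 0
  have "norm (incr 0 z) \<le> \<Lambda>" using A_bounded \<Lambda>_pos by (simp add: incr_def slope_def)
  also have "\<Lambda> = \<Lambda> / len 0 * len 0" using len_pos[of 0] by simp
  also have "\<dots> \<le> incr_const * len 0"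
    using \<Lambda>_pos len_pos[of 0] by (intro mult_right_mono) (auto simp: incr_const_def)
  finally show ?thesis using 0 by simp
next
  case (Suc i)
  let ?d = "corner (Suc i) z - corner i z"
  \<comment> \<open>Consecutive base points differ by the vector between the corners and its image under the slope.\<close>
  have "norm (slope (Suc i) z - slope i z) \<le> \<Lambda> * norm ((corner (Suc i) z + height (Suc i) z) - (corner i z + height i z))"
    unfolding slope_def by (rule A_Lipschitz)
  also have "(corner (Suc i) z + height (Suc i) z) - (corner i z + height i z) = ?d + A (corner i z + height i z) ?d"
    by simp
  also have "norm \<dots> \<le> norm ?d + \<Lambda> * norm ?d"
    using norm_triangle_ineq[of ?d "A (corner i z + height i z) ?d"] norm_blinfun[of "A (corner i z + height i z)" ?d]
      mult_right_mono[OF A_bounded[of "corner i z + height i z"] norm_ge_zero[of ?d]] by linarith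
  also have "norm ?d + \<Lambda> * norm ?d = (1 + \<Lambda>) * norm ?d" by (simp add: algebra_simps)
  also have "\<dots> \<le> (1 + \<Lambda>) * (2 * real k * len i)"
    using \<Lambda>_pos by (intro mult_left_mono norm_corner_Suc) auto
  finally have "norm (slope (Suc i) z - slope i z) \<le> \<Lambda> * ((1 + \<Lambda>) * (2 * real k * len i))"
    using \<Lambda>_pos by simp
  also have "\<dots> = 4 * real k * \<Lambda> * (1 + \<Lambda>) * len (Suc i)" by (simp add: len_Suc)
  also have "\<dots> \<le> incr_const * len (Suc i)"
    using \<Lambda>_pos len_pos[of "Suc i"] len_pos[of 0] by (intro mult_right_mono) (auto simp: incr_const_def)
  finally show ?thesis
    using Suc incr_const_nonneg len_pos[of j] by (simp add: incr_def)
qed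

lemma incr_proj: "incr j z (proj w) = incr j z w"
  by (simp add: incr_def slope_def A_proj blinfun.diff_left split: nat.split)

lemma incr_normal: "incr j z w \<in> orthogonal_comp (span B)"
  using A_normal subspace_orthogonal_comp[of "span B"]
  by (auto simp: incr_def slope_def blinfun.diff_left subspace_0 intro: subspace_diff split: nat.split)

lemma base_proj: "proj z \<in> base \<longleftrightarrow> z \<in> base" by (simp add: base_def proj_inner)

definition same_cell :: "nat \<Rightarrow> 'a \<Rightarrow> 'a \<Rightarrow> bool" where
  "same_cell j x y \<longleftrightarrow> (\<forall>i\<le>j. corner i x = corner i y) \<and> (x \<in> base \<longleftrightarrow> y \<in> base)"

lemma same_cell_height: "\<forall>i\<le>j. corner i x = corner i y \<Longrightarrow> height j x = height j y"
  by (induction j) auto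

lemma same_cell_incr: "same_cell j x y \<Longrightarrow> incr j x = incr j y"
  unfolding same_cell_def incr_def slope_def
  using same_cell_height[of j x y] same_cell_height[of "j - 1" x y] by (auto split: nat.split)

lemma same_cell_proj: "same_cell j (proj z) z"
  by (simp add: same_cell_def corner_proj base_proj)

definition near_grid :: "nat \<Rightarrow> real \<Rightarrow> 'a \<Rightarrow> bool" where
  "near_grid j \<eta> z \<longleftrightarrow> (\<exists>b\<in>B. \<exists>i::int. \<bar>z \<bullet> b - len j * of_int i\<bar> < \<eta>)"

text \<open>If \<open>x\<close> and \<open>y\<close> lie in different cells of some generation up to \<open>j\<close>, a face of that cell passes between
  them; as the grids are nested, it is also a face of generation \<open>j\<close>.\<close>

lemma cell_dichotomy:
  assumes "norm (x - y) < \<eta>"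
  shows "same_cell j x y \<or> near_grid j \<eta> x \<and> near_grid j \<eta> y"
proof (rule disjCI)
  assume no: "\<not> (near_grid j \<eta> x \<and> near_grid j \<eta> y)"
  have floors: "\<lfloor>x \<bullet> b / len i\<rfloor> = \<lfloor>y \<bullet> b / len i\<rfloor>" if "b \<in> B" "i \<le> j" for b i
  proof (rule ccontr)
    assume neq: "\<lfloor>x \<bullet> b / len i\<rfloor> \<noteq> \<lfloor>y \<bullet> b / len i\<rfloor>"
    have "\<bar>x \<bullet> b - y \<bullet> b\<bar> < \<eta>"
      using abs_inner_basis_le[OF that(1), of "x - y"] assms by (simp add: inner_diff_left)
    from floor_neq_near_multiple[OF len_pos this neq] obtain n :: int where
      n: "\<bar>x \<bullet> b - len i * of_int n\<bar> < \<eta>" "\<bar>y \<bullet> b - len i * of_int n\<bar> < \<eta>" by blast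
    have "len i * of_int n = len j * of_int (2 ^ (j - i) * n)" using len_add[OF that(2)] by simp
    then have "near_grid j \<eta> x" "near_grid j \<eta> y" unfolding near_grid_def using n that(1) by metis+
    then show False using no by simp
  qed
  have base_iff: "z \<in> base \<longleftrightarrow> (\<forall>b\<in>B. \<lfloor>z \<bullet> b / len 0\<rfloor> = 0)" for z
    using len_pos[of 0] by (simp add: base_def floor_eq_iff pos_le_divide_eq pos_divide_less_eq)
  show "same_cell j x y"
    unfolding same_cell_def corner_def base_iff using floors by auto
qed

text \<open>The \<open>j\<close>-th correction: an affine map in each cell, switched off near the faces of the cell.\<close>

definition bump :: "nat \<Rightarrow> 'a \<Rightarrow> 'a" where
  "bump j z = cutoff (len j) (gap j) z *\<^sub>R incr j z (proj z - corner j z)"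

definition dbump :: "nat \<Rightarrow> 'a \<Rightarrow> 'a \<Rightarrow>\<^sub>L 'a" where
  "dbump j z = (blinfun_scaleR_left (incr j z (proj z - corner j z)) o\<^sub>L blinfun_inner_left (cutoff_grad (len j) (gap j) z))
     + cutoff (len j) (gap j) z *\<^sub>R incr j z"

lemma dbump_apply:
  "dbump j z h = (cutoff_grad (len j) (gap j) z \<bullet> h) *\<^sub>R incr j z (proj z - corner j z)
     + cutoff (len j) (gap j) z *\<^sub>R incr j z h"
  by (simp add: dbump_def blinfun.add_left blinfun.scaleR_left inner_commute)

lemma near_grid_cutoff:
  assumes "near_grid j (gap j / 4) z"
  shows "cutoff (len j) (gap j) z = 0" "cutoff_grad (len j) (gap j) z = 0"
  using assms cutoff_near_grid[OF gap_pos gap_le_len] by (auto simp: near_grid_def)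

lemma off_grid_cutoff:
  assumes "\<not> near_grid j (gap j) z"
  shows "cutoff (len j) (gap j) z = 1" "cutoff_grad (len j) (gap j) z = 0"
  using assms cutoff_off_grid[OF gap_pos[of j] gap_le_len[of j], where z=z] by (auto simp: near_grid_def not_less)

lemma near_grid_dbump: "near_grid j (gap j / 4) z \<Longrightarrow> dbump j z = 0"
  by (rule blinfun_eqI) (simp add: dbump_apply near_grid_cutoff)

lemma off_grid_dbump: "\<not> near_grid j (gap j) z \<Longrightarrow> dbump j z = incr j z"
  by (rule blinfun_eqI) (simp add: dbump_apply off_grid_cutoff)

lemma off_base_dbump: "z \<notin> base \<Longrightarrow> dbump j z = 0"
  by (rule blinfun_eqI) (simp add: dbump_apply incr_def)

text \<open>Near a face the correction vanishes identically, and away from the faces the cell is locally constant.\<close>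

lemma bump_has_derivative: "(bump j has_derivative blinfun_apply (dbump j z)) (at z)"
proof (cases "near_grid j (gap j / 4) z")
  case True
  then obtain b i where bi: "b \<in> B" "\<bar>z \<bullet> b - len j * of_int i\<bar> < gap j / 4" by (auto simp: near_grid_def)
  let ?U = "{z. \<bar>z \<bullet> b - len j * of_int i\<bar> < gap j / 4}"
  have "open ?U" by (intro open_Collect_less continuous_intros)
  moreover have "0 = bump j y" if "y \<in> ?U" for y
    using cutoff_near_grid(1)[OF gap_pos gap_le_len bi(1)] that by (simp add: bump_def)
  ultimately have "(bump j has_derivative (\<lambda>_. 0)) (at z)"
    using bi(2) by (intro has_derivative_transform_within_open[OF has_derivative_const, where s="?U"]) auto
  then show ?thesis using near_grid_dbump[OF True] by (simp add: zero_blinfun.rep_eq)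
next
  case False
  let ?g = "\<lambda>y. cutoff (len j) (gap j) y *\<^sub>R incr j z (proj y - corner j z)"
  have "((\<lambda>y. incr j z (proj y - corner j z)) has_derivative (\<lambda>h. incr j z (proj h - 0))) (at z)"
    by (intro bounded_linear.has_derivative[OF blinfun.bounded_linear_right] has_derivative_diff has_derivative_const
        bounded_linear_imp_has_derivative blinfun.bounded_linear_right)
  from has_derivative_scaleR[OF cutoff_has_derivative[OF gap_pos gap_le_len] this]
  have "(?g has_derivative blinfun_apply (dbump j z)) (at z)"
    by (rule has_derivative_eq_rhs) (simp add: fun_eq_iff dbump_apply incr_proj add.commute)
  moreover have "?g y = bump j y" if "y \<in> ball z (gap j / 4)" for y
  proof -
    have "same_cell j z y"
      using cell_dichotomy[of z y "gap j / 4" j] False that by (auto simp: dist_norm)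
    then have "incr j z = incr j y" "corner j z = corner j y"
      using same_cell_incr by (auto simp: same_cell_def)
    then show ?thesis by (simp add: bump_def)
  qed
  ultimately show ?thesis
    using gap_pos[of j] by (elim has_derivative_transform_within_open[where s="ball z (gap j / 4)"]) auto
qed

lemma norm_bump_le: "norm (bump j z) \<le> 2 * \<Lambda> * real k * len j"
proof -
  have "norm (bump j z) \<le> 1 * norm (incr j z (proj z - corner j z))"
    using cutoff_range[OF gap_pos[of j] gap_le_len[of j], where z=z] unfolding bump_def norm_scaleR
    by (intro mult_right_mono) auto
  also have "\<dots> \<le> 1 * (norm (incr j z) * norm (proj z - corner j z))"
    by (intro mult_left_mono norm_blinfun) auto
  also have "\<dots> \<le> 1 * (2 * \<Lambda> * (real k * len j))"
    using \<Lambda>_pos by (intro mult_left_mono mult_mono norm_incr_le norm_proj_corner) auto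
  finally show ?thesis by simp
qed

lemma norm_rank_one: "norm (blinfun_scaleR_left y o\<^sub>L blinfun_inner_left (x::'a)) \<le> norm x * norm (y::'a)"
proof (rule norm_blinfun_bound)
  fix h
  have "norm ((h \<bullet> x) *\<^sub>R y) \<le> (norm h * norm x) * norm y"
    unfolding norm_scaleR by (intro mult_right_mono) (auto simp: Cauchy_Schwarz_ineq2)
  then show "norm (blinfun_apply (blinfun_scaleR_left y o\<^sub>L blinfun_inner_left x) h) \<le> norm x * norm y * norm h"
    by (simp add: mult_ac inner_commute)
qed simp

text \<open>The product rule with a change of slope of order \<open>l\<^sub>j\<close>, an affine map of order \<open>l\<^sub>j\<^sup>2\<close> and a cut-off
  with derivatives of order \<open>1 / d\<^sub>j\<close> and \<open>1 / d\<^sub>j\<^sup>2\<close>. Since \<open>\<beta> > 1\<close>, the terms in which the cut-off is not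
  differentiated are the smaller ones. Below the gap width two points either lie in the same cell or
  both have vanishing corrections.\<close>

lemma dbump_bounds:
  "\<exists>C>0. \<forall>j x y.
     norm (dbump j x) \<le> C * (len j powr (2 - \<beta>)) \<and>
     (\<not> near_grid j (gap j) x \<longrightarrow> norm (dbump j x) \<le> C * len j) \<and>
     (norm (x - y) < gap j / 4 \<longrightarrow> norm (dbump j x - dbump j y) \<le> C * (len j powr (2 - \<beta>) / gap j) * norm (x - y))"
proof -
  from cutoff_bounds obtain C where C: "0 \<le> C" and C': "\<forall>l d. 0 < d \<longrightarrow> d \<le> l \<longrightarrow> (\<forall>x y.
     norm (cutoff_grad l d x) \<le> C / d \<and>
     \<bar>cutoff l d x - cutoff l d y\<bar> \<le> C / d * norm (x - y) \<and>
     norm (cutoff_grad l d x - cutoff_grad l d y) \<le> C / d\<^sup>2 * norm (x - y))" by blast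
  let ?\<chi> = "\<lambda>j. cutoff (len j) (gap j)" and ?G = "\<lambda>j. cutoff_grad (len j) (gap j)"
  have grad: "norm (?G j x) \<le> C / gap j" and chi: "\<bar>?\<chi> j x - ?\<chi> j y\<bar> \<le> C / gap j * norm (x - y)"
    and gradL: "norm (?G j x - ?G j y) \<le> C / (gap j)\<^sup>2 * norm (x - y)" for j x y
    using C' gap_pos gap_le_len by blast+
  let ?I = incr_const
  define K where "K = ?I * (real k * C + C + C + 1) + 1"
  have I: "0 \<le> ?I" by (rule incr_const_nonneg)
  have K0: "0 < K" "?I \<le> K" "?I * (real k * C + 1) \<le> K" "?I * (real k * C + C + C) \<le> K"
  proof -
    have "0 \<le> real k * C" using C by simp
    then have *: "?I * 0 \<le> ?I * (real k * C + C + C + 1)" "?I * 1 \<le> ?I * (real k * C + C + C + 1)"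
      "?I * (real k * C + 1) \<le> ?I * (real k * C + C + C + 1)"
      "?I * (real k * C + C + C) \<le> ?I * (real k * C + C + C + 1)"
      using C by (intro mult_left_mono I; linarith)+
    then show "0 < K" "?I \<le> K" "?I * (real k * C + 1) \<le> K" "?I * (real k * C + C + C) \<le> K"
      unfolding K_def by simp_all
  qed
  have len_gap: "len j \<le> len j powr (2 - \<beta>)" for j
    using powr_mono'[of "2 - \<beta>" 1 "len j"] \<beta> len_pos[of j] len_le_1[of j] by simp
  have v: "norm (incr j x (proj x - corner j x)) \<le> ?I * real k * (len j)\<^sup>2" for j x
  proof -
    have "norm (incr j x (proj x - corner j x)) \<le> norm (incr j x) * norm (proj x - corner j x)" by (rule norm_blinfun)
    also have "\<dots> \<le> (?I * len j) * (real k * len j)"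
      using I len_pos[of j] by (intro mult_mono norm_incr_le_len norm_proj_corner) auto
    finally show ?thesis by (simp add: power2_eq_square mult_ac)
  qed
  have b1: "norm (dbump j x) \<le> K * (len j powr (2 - \<beta>))" for j x
  proof -
    have "norm (dbump j x) \<le> norm (?G j x) * norm (incr j x (proj x - corner j x)) + norm (?\<chi> j x *\<^sub>R incr j x)"
      unfolding dbump_def by (rule order_trans[OF norm_triangle_ineq add_right_mono[OF norm_rank_one]])
    also have "\<dots> \<le> C / gap j * (?I * real k * (len j)\<^sup>2) + 1 * (?I * len j)"
      unfolding norm_scaleR using cutoff_range[OF gap_pos[of j] gap_le_len[of j], where z=x] C gap_pos[of j]
      by (intro add_mono mult_mono grad v norm_incr_le_len) auto
    also have "\<dots> = ?I * (real k * C) * ((len j)\<^sup>2 / gap j) + ?I * len j" by simp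
    also have "\<dots> \<le> ?I * (real k * C) * len j powr (2 - \<beta>) + ?I * len j powr (2 - \<beta>)"
      unfolding len2_gap using I C len_gap by (intro add_mono mult_left_mono) auto
    also have "\<dots> = ?I * (real k * C + 1) * len j powr (2 - \<beta>)" by (simp add: algebra_simps)
    also have "\<dots> \<le> K * len j powr (2 - \<beta>)" using K0 by (intro mult_right_mono) auto
    finally show ?thesis .
  qed
  have b2: "norm (dbump j x) \<le> K * len j" if "\<not> near_grid j (gap j) x" for j x
  proof -
    have "norm (dbump j x) \<le> ?I * len j" using norm_incr_le_len off_grid_dbump[OF that] by simp
    also have "\<dots> \<le> K * len j" using K0 len_pos[of j] by (intro mult_right_mono) auto
    finally show ?thesis .
  qed
  have b3: "norm (dbump j x - dbump j y) \<le> K * (len j powr (2 - \<beta>) / gap j) * norm (x - y)"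
    if xy: "norm (x - y) < gap j / 4" for j x y
  proof (cases "same_cell j x y")
    case False
    then have "near_grid j (gap j / 4) x" "near_grid j (gap j / 4) y" using cell_dichotomy[OF xy] by auto
    then show ?thesis using near_grid_dbump K0(1) gap_pos[of j] by simp
  next
    case True
    let ?L = "incr j x" and ?vx = "incr j x (proj x - corner j x)" and ?vy = "incr j x (proj y - corner j x)"
    have Ly: "incr j y = ?L" "corner j y = corner j x" using True same_cell_incr by (auto simp: same_cell_def)
    have "dbump j x - dbump j y = (blinfun_scaleR_left ?vx o\<^sub>L blinfun_inner_left (?G j x - ?G j y))
        + (blinfun_scaleR_left (?vx - ?vy) o\<^sub>L blinfun_inner_left (?G j y)) + (?\<chi> j x - ?\<chi> j y) *\<^sub>R ?L"
      by (rule blinfun_eqI)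
         (simp add: dbump_apply Ly blinfun.add_left blinfun.diff_left blinfun.scaleR_left inner_diff_left inner_diff_right
            scaleR_diff_left scaleR_diff_right inner_commute)
    then have "norm (dbump j x - dbump j y) \<le> norm (?G j x - ?G j y) * norm ?vx + norm (?G j y) * norm (?vx - ?vy)
        + norm ((?\<chi> j x - ?\<chi> j y) *\<^sub>R ?L)"
      by (metis (no_types, lifting) norm_rank_one norm_triangle_mono order_refl)
    also have "\<dots> \<le> (C / (gap j)\<^sup>2 * norm (x - y)) * (?I * real k * (len j)\<^sup>2)
        + C / gap j * (?I * len j * norm (x - y)) + (C / gap j * norm (x - y)) * (?I * len j)"
    proof (intro add_mono mult_mono gradL grad v)
      have "?vx - ?vy = ?L (x - y)" by (simp add: incr_proj flip: blinfun.diff_right)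
      also have "norm \<dots> \<le> norm ?L * norm (x - y)" by (rule norm_blinfun)
      also have "\<dots> \<le> ?I * len j * norm (x - y)" by (intro mult_right_mono norm_incr_le_len) auto
      finally show "norm (?vx - ?vy) \<le> ?I * len j * norm (x - y)" .
      show "norm ((?\<chi> j x - ?\<chi> j y) *\<^sub>R ?L) \<le> (C / gap j * norm (x - y)) * (?I * len j)"
        unfolding norm_scaleR using chi C gap_pos[of j] by (intro mult_mono norm_incr_le_len) auto
    qed (use C gap_pos[of j] in auto)
    also have "\<dots> = ?I * (real k * C * ((len j)\<^sup>2 / gap j) + (C + C) * len j) / gap j * norm (x - y)"
      using gap_pos[of j] by (simp add: power2_eq_square field_simps)
    also have "\<dots> \<le> ?I * (real k * C * len j powr (2 - \<beta>) + (C + C) * len j powr (2 - \<beta>)) / gap j * norm (x - y)"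
      unfolding len2_gap using I C gap_pos[of j] len_gap[of j]
      by (intro mult_right_mono divide_right_mono mult_left_mono add_left_mono) auto
    also have "\<dots> = ?I * (real k * C + C + C) * (len j powr (2 - \<beta>) / gap j) * norm (x - y)"
      by (simp add: algebra_simps add_divide_distrib)
    also have "\<dots> \<le> K * (len j powr (2 - \<beta>) / gap j) * norm (x - y)"
      using K0 gap_pos[of j] by (intro mult_right_mono) auto
    finally show ?thesis .
  qed
  show ?thesis using K0(1) b1 b2 b3 by blast
qed

text \<open>Away from the grid the derivative is the constant \<open>incr\<close> of the cell, and outside the base cube it is
  zero.\<close>

lemma dbump_neq_near_grid:
  assumes "norm (x - y) < gap j / 4" "dbump j x \<noteq> dbump j y"
  shows "x \<in> base \<and> near_grid j (2 * gap j) x"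
proof -
  have same: "same_cell j x y"
    using cell_dichotomy[OF assms(1), of j] near_grid_dbump[of j x] near_grid_dbump[of j y] assms(2) by auto
  have "x \<in> base" using same assms(2) off_base_dbump by (auto simp: same_cell_def)
  moreover have "near_grid j (2 * gap j) x"
  proof (rule ccontr)
    assume far: "\<not> near_grid j (2 * gap j) x"
    have "2 * gap j \<le> \<bar>x \<bullet> b - len j * of_int i\<bar>" if "b \<in> B" for b i
      using far that unfolding near_grid_def not_less[symmetric] by blast
    moreover have "\<bar>x \<bullet> b - y \<bullet> b\<bar> < gap j" if "b \<in> B" for b
      using abs_inner_basis_le[OF that, of "x - y"] assms(1) gap_pos[of j] by (simp add: inner_diff_left)
    ultimately have "gap j \<le> \<bar>x \<bullet> b - len j * of_int i\<bar> \<and> gap j \<le> \<bar>y \<bullet> b - len j * of_int i\<bar>" if "b \<in> B" for b i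
      using that gap_pos[of j] by (smt (verit))
    then have "\<not> near_grid j (gap j) x" "\<not> near_grid j (gap j) y"
      unfolding near_grid_def not_less[symmetric] by blast+
    then show False using off_grid_dbump same_cell_incr[OF same] assms(2) by simp
  qed
  ultimately show ?thesis ..
qed

end


section \<open>The limit graph and its core\<close>

context cantor_graph
begin

definition limit_map :: "'a \<Rightarrow> 'a" where "limit_map z = (\<Sum>j. bump j z)"
definition limit_deriv :: "'a \<Rightarrow> 'a \<Rightarrow>\<^sub>L 'a" where "limit_deriv z = (\<Sum>j. dbump j z)"

lemma continuous_dbump: "continuous_on UNIV (dbump j)"
  unfolding continuous_on_iff
proof (intro ballI allI impI)
  fix x :: 'a and e :: real assume e: "0 < e"
  obtain C where "0 < C" and C: "\<And>x y. norm (x - y) < gap j / 4 \<Longrightarrow>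
      norm (dbump j x - dbump j y) \<le> C * (len j powr (2 - \<beta>) / gap j) * norm (x - y)"
    using dbump_bounds by meson
  define K where "K = C * (len j powr (2 - \<beta>) / gap j)"
  have K: "0 < K" using \<open>0 < C\<close> gap_pos[of j] len_pos[of j] by (simp add: K_def)
  show "\<exists>d>0. \<forall>x'\<in>UNIV. dist x' x < d \<longrightarrow> dist (dbump j x') (dbump j x) < e"
  proof (intro exI[of _ "min (gap j / 4) (e / K)"] conjI ballI impI)
    fix x' assume d: "dist x' x < min (gap j / 4) (e / K)"
    have "norm (dbump j x' - dbump j x) \<le> K * norm (x' - x)"
      using C[of x' x] d by (simp add: dist_norm K_def)
    also have "\<dots> < e" using d K by (simp add: dist_norm field_simps)
    finally show "dist (dbump j x') (dbump j x) < e" by (simp add: dist_norm)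
  qed (use K e gap_pos[of j] in auto)
qed

text \<open>Here \<open>\<beta> < 2\<close> enters: the derivatives of the corrections decay geometrically.\<close>

lemma ex_summable_dbump_bound: "\<exists>M. summable M \<and> (\<forall>j x. norm (dbump j x) \<le> M j)"
proof -
  obtain C where "\<And>j x. norm (dbump j x) \<le> C * len j powr (2 - \<beta>)"
    using dbump_bounds by meson
  moreover have "summable (\<lambda>j. C * len j powr (2 - \<beta>))"
    using \<beta> by (intro summable_mult summable_len_powr) auto
  ultimately show ?thesis by blast
qed

lemma summable_dbump: "summable (\<lambda>j. norm (dbump j x))"
proof -
  obtain M where M: "summable M" "\<And>j x. norm (dbump j x) \<le> M j" using ex_summable_dbump_bound by meson
  then show ?thesis by (intro summable_comparison_test'[OF M(1)]) auto
qed

lemma uniform_limit_dbump: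
  "uniform_limit UNIV (\<lambda>n x. \<Sum>j<n. dbump j x) limit_deriv sequentially"
proof -
  obtain M where M: "summable M" "\<And>j x. norm (dbump j x) \<le> M j" using ex_summable_dbump_bound by meson
  show ?thesis unfolding limit_deriv_def[abs_def] by (rule Weierstrass_m_test[OF _ M(1)]) (rule M(2))
qed

lemma continuous_limit_deriv: "continuous_on UNIV limit_deriv"
proof (rule uniform_limit_theorem[OF _ uniform_limit_dbump])
  show "\<forall>\<^sub>F n in sequentially. continuous_on UNIV (\<lambda>x. \<Sum>j<n. dbump j x)"
    by (intro always_eventually allI continuous_on_sum continuous_dbump)
qed simp

lemma ex_norm_limit_deriv_bound: "\<exists>C. \<forall>x. norm (limit_deriv x) \<le> C"
proof -
  obtain M where M: "summable M" "\<And>j x. norm (dbump j x) \<le> M j" using ex_summable_dbump_bound by meson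
  have "norm (limit_deriv x) \<le> suminf M" for x
    unfolding limit_deriv_def
    by (intro order_trans[OF summable_norm[OF summable_dbump] suminf_le] M summable_dbump)
  then show ?thesis by blast
qed

lemma bump_sums: "(\<lambda>j. bump j z) sums limit_map z"
  and norm_limit_map_le: "norm (limit_map z) \<le> 4 * \<Lambda> * real k * len 0"
proof -
  have len_sums: "(\<lambda>j. 2 * \<Lambda> * real k * len j) sums (2 * \<Lambda> * real k * (len 0 * 2))"
  proof (intro sums_mult)
    have "(\<lambda>j. len 0 * (1/2)^j) sums (len 0 * (1 / (1 - 1/2)))"
      by (intro sums_mult geometric_sums) auto
    then show "len sums (len 0 * 2)" by (simp add: len_def[abs_def] power_add power_divide)
  qed
  have s: "summable (\<lambda>j. norm (bump j z))"
    using norm_bump_le sums_summable[OF len_sums] by (intro summable_comparison_test'[OF sums_summable[OF len_sums]]) auto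
  then show "(\<lambda>j. bump j z) sums limit_map z"
    unfolding limit_map_def by (rule summable_sums[OF summable_norm_cancel])
  have "norm (limit_map z) \<le> (\<Sum>j. norm (bump j z))" unfolding limit_map_def by (rule summable_norm[OF s])
  also have "\<dots> \<le> (\<Sum>j. 2 * \<Lambda> * real k * len j)"
    by (intro suminf_le norm_bump_le s sums_summable[OF len_sums])
  also have "\<dots> = 4 * \<Lambda> * real k * len 0" using sums_unique[OF len_sums] by simp
  finally show "norm (limit_map z) \<le> 4 * \<Lambda> * real k * len 0" .
qed

lemma limit_map_has_derivative: "(limit_map has_derivative blinfun_apply (limit_deriv z)) (at z)"
proof -
  have "\<exists>g. \<forall>x\<in>UNIV. (\<lambda>n. bump n x) sums (g x) \<and> (g has_derivative blinfun_apply (limit_deriv x)) (at x within UNIV)"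
  proof (rule has_derivative_series[where f'="\<lambda>j x. blinfun_apply (dbump j x)"])
    show "(bump n has_derivative blinfun_apply (dbump n x)) (at x within UNIV)" for n x
      using bump_has_derivative by simp
    fix e :: real assume "0 < e"
    have "\<forall>\<^sub>F n in sequentially. \<forall>x\<in>UNIV. dist (\<Sum>j<n. dbump j x) (limit_deriv x) < e"
      using uniform_limit_dbump \<open>0 < e\<close> by (auto simp: uniform_limit_iff)
    then show "\<forall>\<^sub>F n in sequentially. \<forall>x\<in>UNIV. \<forall>h.
        norm ((\<Sum>i<n. blinfun_apply (dbump i x) h) - blinfun_apply (limit_deriv x) h) \<le> e * norm h"
    proof eventually_elim
      case (elim n)
      show ?case
      proof (intro ballI allI)
        fix x h
        have "norm ((\<Sum>j<n. dbump j x) - limit_deriv x) \<le> e" using elim by (simp add: dist_norm less_imp_le)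
        then have "norm (((\<Sum>j<n. dbump j x) - limit_deriv x) h) \<le> e * norm h"
          by (rule order_trans[OF norm_blinfun mult_right_mono]) simp
        then show "norm ((\<Sum>i<n. blinfun_apply (dbump i x) h) - blinfun_apply (limit_deriv x) h) \<le> e * norm h"
          by (simp add: blinfun.diff_left blinfun.sum_left)
      qed
    qed
  qed (use bump_sums[of 0] in auto)
  then obtain g where g: "\<And>x. (\<lambda>n. bump n x) sums (g x)" "\<And>x. (g has_derivative blinfun_apply (limit_deriv x)) (at x)"
    by auto
  have "g = limit_map" using sums_unique2[OF g(1) bump_sums] by (auto simp: fun_eq_iff)
  then show ?thesis using g(2) by simp
qed

lemma bump_normal: "bump j z \<in> orthogonal_comp (span B)"
  unfolding bump_def by (intro subspace_scale[OF subspace_orthogonal_comp] incr_normal)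

lemma bump_proj: "bump j (proj z) = bump j z"
proof -
  have "cutoff l d (proj z) = cutoff l d z" for l d by (simp add: cutoff_def proj_inner cong: sum.cong)
  then show ?thesis
    using same_cell_incr[OF same_cell_proj] by (simp add: bump_def corner_proj proj_span proj_in_span)
qed

sublocale graph: normal_graph B limit_map limit_deriv
proof
  show "limit_map x \<in> orthogonal_comp (span B)" for x
  proof -
    have "w \<bullet> limit_map x = 0" if "w \<in> span B" for w
    proof -
      have "(\<lambda>j. w \<bullet> bump j x) sums (w \<bullet> limit_map x)"
        by (intro bounded_linear.sums[OF bounded_linear_inner_right] bump_sums)
      moreover have "w \<bullet> bump j x = 0" for j
        using bump_normal[of j x] that by (auto simp: orthogonal_comp_def orthogonal_def)
      ultimately show ?thesis by (simp add: sums_iff)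
    qed
    then show ?thesis by (auto simp: orthogonal_comp_def orthogonal_def)
  qed
  show "limit_map (proj x) = limit_map x" for x by (simp add: limit_map_def bump_proj)
qed (rule limit_map_has_derivative continuous_limit_deriv)+

text \<open>What remains of the interval after the removal of all gaps. The level 0 gaps at both end points keep
  the core away from the boundary of the base cube.\<close>

definition cantor :: "real set" where
  "cantor = {t. 0 \<le> t \<and> t \<le> len 0 \<and> (\<forall>j. \<forall>i::int. gap j \<le> \<bar>t - len j * of_int i\<bar>)}"

definition core :: "'a set" where "core = {z\<in>span B. \<forall>b\<in>B. z \<bullet> b \<in> cantor}"

lemma closed_cantor: "closed cantor"
proof -
  have "closed {t::real. gap j \<le> \<bar>t - len j * of_int i\<bar>}" for j and i :: int
    by (intro closed_Collect_le continuous_intros)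
  moreover have "cantor = {0..len 0} \<inter> (\<Inter>j. \<Inter>i::int. {t. gap j \<le> \<bar>t - len j * of_int i\<bar>})"
    by (auto simp: cantor_def)
  ultimately show ?thesis by (simp only:) (intro closed_Int closed_INT closed_atLeastAtMost ballI)
qed

lemma compact_core: "compact core"
proof -
  have eq: "core = span B \<inter> (\<Inter>b\<in>B. (\<lambda>z. z \<bullet> b) -` cantor)" by (auto simp: core_def)
  have "closed core"
    unfolding eq by (intro closed_Int closed_INT ballI closed_vimage closed_cantor continuous_intros) (simp add: closed_subspace)
  moreover have "bounded core"
  proof -
    have "norm z \<le> real k * len 0" if "z \<in> core" for z
    proof -
      have "z = (\<Sum>b\<in>B. (z \<bullet> b) *\<^sub>R b)" using that proj_span[of z] by (simp add: core_def proj_apply)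
      also have "norm \<dots> \<le> real k * len 0"
        using that by (intro norm_comb_le) (auto simp: core_def cantor_def)
      finally show ?thesis .
    qed
    then show ?thesis unfolding bounded_iff by blast
  qed
  ultimately show ?thesis by (simp add: compact_eq_bounded_closed)
qed

context
  fixes z :: 'a
  assumes z: "z \<in> core"
begin

lemma core_off_grid: "\<not> near_grid j (gap j) z"
  using z by (auto simp: core_def cantor_def near_grid_def not_less)

lemma core_base: "z \<in> base"
proof -
  have "0 \<le> z \<bullet> b \<and> z \<bullet> b < len 0" if "b \<in> B" for b
  proof -
    have t: "0 \<le> z \<bullet> b" "z \<bullet> b \<le> len 0" "gap 0 \<le> \<bar>z \<bullet> b - len 0 * of_int 1\<bar>"
      using z that unfolding core_def cantor_def by blast+
    then show ?thesis using gap_pos[of 0] by auto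
  qed
  then show ?thesis by (simp add: base_def)
qed

lemma core_proj: "proj z = z" using z by (simp add: core_def proj_span)

lemma bump_core: "bump j z = incr j z (z - corner j z)"
  by (simp add: bump_def core_proj off_grid_cutoff[OF core_off_grid])

lemma sum_incr_core: "(\<Sum>j\<le>n. incr j z) = slope n z"
  by (induction n) (simp_all add: incr_def core_base)

text \<open>By induction: passing from the affine map of a cell to that of a subcell does not change the height
  predicted above the corner of the subcell.\<close>

lemma sum_bump_core: "(\<Sum>j\<le>n. bump j z) = height n z + slope n z (z - corner n z)"
proof (induction n)
  case 0
  then show ?case by (simp add: bump_core incr_def core_base)
next
  case (Suc n)
  have "slope n z (z - corner n z) = slope n z (z - corner (Suc n) z) + slope n z (corner (Suc n) z - corner n z)"
    by (simp flip: blinfun.add_right)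
  then show ?case
    using Suc by (simp add: bump_core incr_def core_base blinfun.diff_left) (simp add: slope_def)
qed

lemma corner_tendsto: "(\<lambda>n. corner n z) \<longlonglongrightarrow> z"
proof -
  have "(\<lambda>n. real k * len n) \<longlonglongrightarrow> real k * 0"
    by (rule tendsto_mult[OF tendsto_const summable_LIMSEQ_zero[OF summable_len]])
  then have "(\<lambda>n. z - corner n z) \<longlonglongrightarrow> 0"
    unfolding mult_zero_right
    by (rule Lim_null_comparison[rotated]) (rule always_eventually, rule allI, rule norm_proj_corner[of z, unfolded core_proj])
  from tendsto_diff[OF tendsto_const[of z] this] show ?thesis by simp
qed

lemma height_tendsto: "(\<lambda>n. height n z) \<longlonglongrightarrow> limit_map z"
proof -
  have a: "(\<lambda>n. \<Lambda> * norm (z - corner n z)) \<longlonglongrightarrow> \<Lambda> * norm (z - z)"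
    by (rule tendsto_mult[OF tendsto_const tendsto_norm[OF tendsto_diff[OF tendsto_const corner_tendsto]]])
  have b: "norm (slope n z (z - corner n z)) \<le> \<Lambda> * norm (z - corner n z)" for n
    unfolding slope_def by (rule order_trans[OF norm_blinfun mult_right_mono[OF A_bounded]]) simp
  have "(\<lambda>n. slope n z (z - corner n z)) \<longlonglongrightarrow> 0"
    by (rule Lim_null_comparison[OF always_eventually[OF allI[OF b]]
          a[unfolded diff_self norm_zero mult_zero_right]])
  moreover have "(\<lambda>n. \<Sum>j\<le>n. bump j z) \<longlonglongrightarrow> limit_map z"
    using bump_sums by (simp add: sums_def_le)
  ultimately have "(\<lambda>n. (\<Sum>j\<le>n. bump j z) - slope n z (z - corner n z)) \<longlonglongrightarrow> limit_map z - 0"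
    by (intro tendsto_diff)
  then show ?thesis by (simp add: sum_bump_core)
qed

text \<open>The slopes telescope to \<open>A\<close> at the points predicted by the cells, which converge to the point of
  the graph.\<close>

lemma limit_deriv_core: "limit_deriv z = A (z + limit_map z)"
proof (rule LIMSEQ_unique)
  have "(\<lambda>n. \<Sum>j\<le>n. dbump j z) \<longlonglongrightarrow> limit_deriv z"
    using summable_sums[OF summable_norm_cancel[OF summable_dbump]] by (simp add: sums_def_le limit_deriv_def)
  then show "(\<lambda>n. slope n z) \<longlonglongrightarrow> limit_deriv z"
    by (simp add: off_grid_dbump[OF core_off_grid] sum_incr_core)
  have a: "(\<lambda>n. \<Lambda> * norm ((corner n z + height n z) - (z + limit_map z))) \<longlonglongrightarrow>
      \<Lambda> * norm ((z + limit_map z) - (z + limit_map z))"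
    by (rule tendsto_mult[OF tendsto_const tendsto_norm[OF tendsto_diff[OF
          tendsto_add[OF corner_tendsto height_tendsto] tendsto_const]]])
  have b: "norm (slope n z - A (z + limit_map z)) \<le> \<Lambda> * norm ((corner n z + height n z) - (z + limit_map z))" for n
    unfolding slope_def by (rule A_Lipschitz)
  have "(\<lambda>n. slope n z - A (z + limit_map z)) \<longlonglongrightarrow> 0"
    by (rule Lim_null_comparison[OF always_eventually[OF allI[OF b]]
          a[unfolded diff_self norm_zero mult_zero_right]])
  then show "(\<lambda>n. slope n z) \<longlonglongrightarrow> A (z + limit_map z)" by (rule LIM_zero_cancel)
qed

end

end


section \<open>Fractional energy\<close>

text \<open>A substitute for Minkowski's inequality in \<open>L\<^sup>Q\<close>: since \<open>\<Sum> a\<^sub>j \<le> (\<Sum> w\<^sub>j) sup (a\<^sub>j / w\<^sub>j)\<close>, and the supremum is at most the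
  \<open>l\<^sup>Q\<close> norm, geometric weights \<open>w\<close> reduce a series to its terms at an arbitrarily small loss in the
  exponent.\<close>

lemma powr_suminf_le:
  fixes a w :: "nat \<Rightarrow> real"
  assumes a: "\<And>j. 0 \<le> a j" "summable a" and w: "\<And>j. 0 < w j" "summable w" and Q: "0 < Q"
  shows "ennreal (suminf a powr Q) \<le> (\<Sum>j. ennreal (suminf w powr Q * w j powr (- Q) * a j powr Q))"
proof -
  define W where "W = suminf w"
  define f where "f j = W powr Q * w j powr (- Q) * a j powr Q" for j
  have W: "0 < W" unfolding W_def using w by (intro suminf_pos)
  have f0: "0 \<le> f j" for j by (simp add: f_def)
  have "ennreal (suminf a powr Q) \<le> (\<Sum>j. ennreal (f j))"
  proof (cases "(\<Sum>j. ennreal (f j)) = top")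
    case False
    then have sf: "summable f" by (intro summable_suminf_not_top f0)
    define s where "s = suminf f"
    have s0: "0 \<le> s" unfolding s_def by (rule suminf_nonneg[OF sf f0])
    have aj: "a j \<le> w j * (s powr (1 / Q) / W)" for j
    proof -
      have "f j \<le> s" unfolding s_def using sum_le_suminf[OF sf, of "{j}"] f0 by simp
      moreover have "(W * a j / w j) powr Q = f j"
      proof -
        have "(W * a j / w j) powr Q = (W powr Q * a j powr Q) / w j powr Q"
          using W w(1)[of j] a(1)[of j] by (simp add: powr_divide powr_mult)
        also have "\<dots> = f j" by (simp add: f_def powr_minus divide_inverse mult_ac)
        finally show ?thesis .
      qed
      ultimately have "((W * a j / w j) powr Q) powr (1 / Q) \<le> s powr (1 / Q)"
        using Q f0[of j] by (intro powr_mono2) simp_all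
      moreover have "((W * a j / w j) powr Q) powr (1 / Q) = W * a j / w j"
        using Q W w(1)[of j] a(1)[of j] unfolding powr_powr by simp
      ultimately have "W * a j / w j \<le> s powr (1 / Q)" by simp
      then show ?thesis using W w(1)[of j] by (simp add: pos_divide_le_eq pos_le_divide_eq mult_ac)
    qed
    have "suminf a \<le> (\<Sum>j. w j * (s powr (1 / Q) / W))"
      by (rule suminf_le[OF aj a(2) summable_mult2[OF w(2)]])
    also have "\<dots> = W * (s powr (1 / Q) / W)" unfolding W_def by (rule suminf_mult2[symmetric, OF w(2)])
    also have "\<dots> = s powr (1 / Q)" using W by simp
    finally have "suminf a powr Q \<le> (s powr (1 / Q)) powr Q"
      using Q suminf_nonneg[OF a(2,1)] by (intro powr_mono2) simp_all
    also have "\<dots> = s" using Q s0 unfolding powr_powr by simp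
    finally have "ennreal (suminf a powr Q) \<le> ennreal s" by (rule ennreal_leI)
    also have "\<dots> = (\<Sum>j. ennreal (f j))" unfolding s_def by (rule suminf_ennreal2[symmetric, OF f0 sf])
    finally show ?thesis .
  qed simp
  then show ?thesis unfolding f_def W_def .
qed

lemma powr_add_le:
  assumes "0 \<le> (a::real)" "0 \<le> b" "0 \<le> Q"
  shows "(a + b) powr Q \<le> 2 powr Q * (a powr Q + b powr Q)"
proof -
  have "(a + b) powr Q \<le> (2 * max a b) powr Q" using assms by (intro powr_mono2) auto
  also have "\<dots> = 2 powr Q * max a b powr Q" using assms by (simp add: powr_mult)
  also have "max a b powr Q \<le> a powr Q + b powr Q" by (cases "a \<le> b") (auto simp: max_def)
  finally show ?thesis by simp
qed

locale sigma_growth_measure = growth_measure M g k + sigma_finite_measure M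
  for M :: "'a::euclidean_space measure" and g k
begin

sublocale pairs: pair_sigma_finite M M
  by standard

lemma space_M [simp]: "space M = UNIV"
  using sets_eq_imp_space_eq[OF sets_M] by simp

lemma pair_borel: "f \<in> borel_measurable borel \<Longrightarrow> f \<in> borel_measurable (M \<Otimes>\<^sub>M M)"
proof -
  assume f: "f \<in> borel_measurable borel"
  have "sets (M \<Otimes>\<^sub>M M) = sets (borel \<Otimes>\<^sub>M borel :: ('a \<times> 'a) measure)" by (intro sets_pair_measure_cong) simp_all
  also have "\<dots> = sets (borel :: ('a \<times> 'a) measure)" by (metis borel_prod)
  finally show ?thesis using f by (simp cong: measurable_cong_sets)
qed

text \<open>The double integral is split at the distance \<open>r\<close>. Below \<open>r\<close> the Lipschitz bound makes the kernel
  integrable, and only points of \<open>G\<close> contribute. Above \<open>r\<close> the kernel is integrable by itself, and the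
  difference is estimated by the two values.\<close>

lemma fractional_energy_le:
  fixes \<alpha> Q :: real
  assumes \<alpha>: "0 < \<alpha>" "\<alpha> < 1" and Q: "0 < Q"
  shows "\<exists>C\<ge>0. \<forall>(u :: 'a \<Rightarrow> 'b::real_normed_vector) G r L. continuous_on UNIV u \<longrightarrow> 0 < r \<longrightarrow> 0 \<le> L \<longrightarrow>
     G \<in> sets borel \<longrightarrow> (\<forall>x y. dist x y < r \<longrightarrow> norm (u x - u y) \<le> L * dist x y) \<longrightarrow>
     (\<forall>x y. dist x y < r \<longrightarrow> u x \<noteq> u y \<longrightarrow> x \<in> G) \<longrightarrow>
     (\<integral>\<^sup>+x. \<integral>\<^sup>+y. ennreal (norm (u x - u y) powr Q / dist x y powr (\<alpha> * Q + k)) \<partial>M \<partial>M)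
     \<le> ennreal C * (ennreal (L powr Q * r powr ((1 - \<alpha>) * Q)) * emeasure M G
         + ennreal (r powr (- (\<alpha> * Q))) * (\<integral>\<^sup>+x. ennreal (norm (u x) powr Q) \<partial>M))"
proof -
  have \<gamma>: "0 < (1 - \<alpha>) * Q" "0 < \<alpha> * Q" using \<alpha> Q by auto
  obtain C1 where C1: "0 \<le> C1" "\<And>x r. 0 < r \<Longrightarrow>
    (\<integral>\<^sup>+y. indicator {y. dist x y < r} y * ennreal (dist x y powr ((1 - \<alpha>) * Q - k)) \<partial>M) \<le> ennreal (C1 * r powr ((1 - \<alpha>) * Q))"
    using near_integral[OF \<gamma>(1)] by meson
  obtain C2 where C2: "0 \<le> C2" "\<And>x r. 0 < r \<Longrightarrow>
    (\<integral>\<^sup>+y. indicator {y. r \<le> dist x y} y * ennreal (dist x y powr (- (\<alpha> * Q) - k)) \<partial>M) \<le> ennreal (C2 * r powr (- (\<alpha> * Q)))"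
    using tail_integral[OF \<gamma>(2)] by meson
  define C where "C = C1 + 2 * (2 powr Q * C2)"
  have C0: "0 \<le> C" using C1(1) C2(1) by (simp add: C_def)
  show ?thesis
  proof (intro exI[of _ C] conjI allI impI C0)
    fix u :: "'a \<Rightarrow> 'b" and G r L
    assume u: "continuous_on UNIV u" and r: "0 < r" and L: "0 \<le> L" and G: "G \<in> sets borel"
      and uL: "\<forall>x y. dist x y < r \<longrightarrow> norm (u x - u y) \<le> L * dist x y"
      and uG: "\<forall>x y. dist x y < r \<longrightarrow> u x \<noteq> u y \<longrightarrow> x \<in> G"
    have [measurable]: "G \<in> sets borel" by (rule G)
    have [measurable]: "(\<lambda>x. norm (u x)) \<in> borel_measurable borel"
      by (intro borel_measurable_continuous_onI continuous_on_norm u)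
    define N1 :: "'a \<Rightarrow> 'a \<Rightarrow> ennreal" where
      "N1 x y = indicator {y. dist x y < r} y * ennreal (dist x y powr ((1 - \<alpha>) * Q - k))" for x y
    define N2 :: "'a \<Rightarrow> 'a \<Rightarrow> ennreal" where
      "N2 x y = indicator {y. r \<le> dist x y} y * ennreal (dist x y powr (- (\<alpha> * Q) - k))" for x y
    have N1m [measurable]: "case_prod N1 \<in> borel_measurable (M \<Otimes>\<^sub>M M)"
      unfolding N1_def indicator_def by measurable
    have N2m [measurable]: "case_prod N2 \<in> borel_measurable (M \<Otimes>\<^sub>M M)"
      unfolding N2_def indicator_def by measurable
    have N2s: "N2 x y = N2 y x" for x y by (simp add: N2_def indicator_def dist_commute)
    let ?U = "\<lambda>x. ennreal (2 powr Q * norm (u x) powr Q)"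
    let ?c = "ennreal (L powr Q)"
    have pt: "ennreal (norm (u x - u y) powr Q / dist x y powr (\<alpha> * Q + k))
        \<le> ?c * indicator G x * N1 x y + (?U x * N2 x y + ?U y * N2 x y)" for x y
    proof (cases "dist x y < r")
      case True
      show ?thesis
      proof (cases "u x = u y")
        case False
        then have "x \<in> G" "0 < dist x y" using uG True by auto
        have "norm (u x - u y) powr Q / dist x y powr (\<alpha> * Q + k) \<le> (L * dist x y) powr Q / dist x y powr (\<alpha> * Q + k)"
          using uL True Q by (intro divide_right_mono powr_mono2) auto
        also have "\<dots> = L powr Q * dist x y powr ((1 - \<alpha>) * Q - k)"
        proof -
          have e: "(1 - \<alpha>) * Q - real k = Q - (\<alpha> * Q + real k)" by (simp add: algebra_simps)
          show ?thesis unfolding e powr_diff using L by (simp add: powr_mult)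
        qed
        finally have "ennreal (norm (u x - u y) powr Q / dist x y powr (\<alpha> * Q + k))
            \<le> ?c * ennreal (dist x y powr ((1 - \<alpha>) * Q - k))"
          by (subst ennreal_mult'[symmetric]) (auto intro: ennreal_leI)
        also have "\<dots> = ?c * indicator G x * N1 x y" using True \<open>x \<in> G\<close> by (simp add: N1_def)
        also have "\<dots> \<le> ?c * indicator G x * N1 x y + (?U x * N2 x y + ?U y * N2 x y)" by simp
        finally show ?thesis .
      qed simp
    next
      case False
      have "norm (u x - u y) powr Q \<le> (norm (u x) + norm (u y)) powr Q"
        using Q by (intro powr_mono2 norm_triangle_ineq4) auto
      also have "\<dots> \<le> 2 powr Q * norm (u x) powr Q + 2 powr Q * norm (u y) powr Q"
        using powr_add_le[of "norm (u x)" "norm (u y)" Q] Q by (simp add: distrib_left)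
      finally have le: "norm (u x - u y) powr Q
          \<le> 2 powr Q * norm (u x) powr Q + 2 powr Q * norm (u y) powr Q" .
      have e: "- (\<alpha> * Q) - real k = - (\<alpha> * Q + real k)" by simp
      have N2xy: "N2 x y = ennreal (1 / dist x y powr (\<alpha> * Q + k))"
        using False unfolding N2_def e powr_minus_divide by simp
      have "(?U x + ?U y) * N2 x y = ennreal ((2 powr Q * norm (u x) powr Q + 2 powr Q * norm (u y) powr Q)
          * (1 / dist x y powr (\<alpha> * Q + k)))"
        unfolding N2xy by (subst ennreal_mult, simp, simp, subst ennreal_plus) auto
      then have "ennreal (norm (u x - u y) powr Q / dist x y powr (\<alpha> * Q + k)) \<le> (?U x + ?U y) * N2 x y"
        using divide_right_mono[OF le, of "dist x y powr (\<alpha> * Q + k)"] by (simp add: ennreal_leI)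
      also have "\<dots> = ?U x * N2 x y + ?U y * N2 x y" by (rule distrib_right)
      also have "\<dots> \<le> ?c * indicator G x * N1 x y + (?U x * N2 x y + ?U y * N2 x y)"
        by (rule add_increasing) simp_all
      finally show ?thesis .
    qed
    have I1: "(\<integral>\<^sup>+x. \<integral>\<^sup>+y. ?c * indicator G x * N1 x y \<partial>M \<partial>M) \<le> ?c * ennreal (C1 * r powr ((1 - \<alpha>) * Q)) * emeasure M G"
    proof -
      have "(\<integral>\<^sup>+x. \<integral>\<^sup>+y. ?c * indicator G x * N1 x y \<partial>M \<partial>M) = (\<integral>\<^sup>+x. ?c * indicator G x * (\<integral>\<^sup>+y. N1 x y \<partial>M) \<partial>M)"
        by (intro nn_integral_cong nn_integral_cmult) measurable
      also have "\<dots> \<le> (\<integral>\<^sup>+x. ?c * indicator G x * ennreal (C1 * r powr ((1 - \<alpha>) * Q)) \<partial>M)"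
        using C1(2)[OF r] unfolding N1_def by (intro nn_integral_mono mult_left_mono) auto
      also have "\<dots> = (\<integral>\<^sup>+x. ?c * ennreal (C1 * r powr ((1 - \<alpha>) * Q)) * indicator G x \<partial>M)"
        by (intro nn_integral_cong) (simp add: mult_ac)
      also have "\<dots> = ?c * ennreal (C1 * r powr ((1 - \<alpha>) * Q)) * emeasure M G"
        using G by (intro nn_integral_cmult_indicator) simp
      finally show ?thesis .
    qed
    have I2: "(\<integral>\<^sup>+x. \<integral>\<^sup>+y. ?U x * N2 x y \<partial>M \<partial>M)
        \<le> ennreal (2 powr Q * C2 * r powr (- (\<alpha> * Q))) * (\<integral>\<^sup>+x. ennreal (norm (u x) powr Q) \<partial>M)"
    proof -
      have "(\<integral>\<^sup>+x. \<integral>\<^sup>+y. ?U x * N2 x y \<partial>M \<partial>M) = (\<integral>\<^sup>+x. ?U x * (\<integral>\<^sup>+y. N2 x y \<partial>M) \<partial>M)"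
        by (intro nn_integral_cong nn_integral_cmult) measurable
      also have "\<dots> \<le> (\<integral>\<^sup>+x. ?U x * ennreal (C2 * r powr (- (\<alpha> * Q))) \<partial>M)"
        using C2(2)[OF r] unfolding N2_def by (intro nn_integral_mono mult_left_mono) auto
      also have "\<dots> = (\<integral>\<^sup>+x. ennreal (2 powr Q * C2 * r powr (- (\<alpha> * Q))) * ennreal (norm (u x) powr Q) \<partial>M)"
        using C2(1) by (intro nn_integral_cong) (simp add: mult_ac flip: ennreal_mult)
      also have "\<dots> = ennreal (2 powr Q * C2 * r powr (- (\<alpha> * Q))) * (\<integral>\<^sup>+x. ennreal (norm (u x) powr Q) \<partial>M)"
        by (intro nn_integral_cmult) measurable
      finally show ?thesis .
    qed
    have I3: "(\<integral>\<^sup>+x. \<integral>\<^sup>+y. ?U y * N2 x y \<partial>M \<partial>M) = (\<integral>\<^sup>+x. \<integral>\<^sup>+y. ?U x * N2 x y \<partial>M \<partial>M)"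
    proof -
      have "(\<integral>\<^sup>+x. \<integral>\<^sup>+y. ?U y * N2 x y \<partial>M \<partial>M) = (\<integral>\<^sup>+y. \<integral>\<^sup>+x. ?U y * N2 x y \<partial>M \<partial>M)"
        by (rule pairs.Fubini') measurable
      then show ?thesis by (simp add: N2s)
    qed
    define T1 where "T1 x y = ?c * indicator G x * N1 x y" for x y
    define T2 where "T2 x y = ?U x * N2 x y" for x y
    define T3 where "T3 x y = ?U y * N2 x y" for x y
    have T1m [measurable]: "case_prod T1 \<in> borel_measurable (M \<Otimes>\<^sub>M M)" unfolding T1_def by measurable
    have T2m [measurable]: "case_prod T2 \<in> borel_measurable (M \<Otimes>\<^sub>M M)" unfolding T2_def by measurable
    have T3m [measurable]: "case_prod T3 \<in> borel_measurable (M \<Otimes>\<^sub>M M)" unfolding T3_def by measurable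
    have inner: "(\<integral>\<^sup>+y. T1 x y + (T2 x y + T3 x y) \<partial>M)
        = (\<integral>\<^sup>+y. T1 x y \<partial>M) + ((\<integral>\<^sup>+y. T2 x y \<partial>M) + (\<integral>\<^sup>+y. T3 x y \<partial>M))" for x
    proof -
      have 1: "(\<lambda>y. T1 x y) \<in> borel_measurable M"
        using measurable_Pair2[OF T1m, of x] by simp
      have 2: "(\<lambda>y. T2 x y) \<in> borel_measurable M"
        using measurable_Pair2[OF T2m, of x] by simp
      have 3: "(\<lambda>y. T3 x y) \<in> borel_measurable M"
        using measurable_Pair2[OF T3m, of x] by simp
      show ?thesis unfolding nn_integral_add[OF 1 borel_measurable_add[OF 2 3]] nn_integral_add[OF 2 3] ..
    qed
    have outer: "(\<integral>\<^sup>+x. (\<integral>\<^sup>+y. T1 x y \<partial>M) + ((\<integral>\<^sup>+y. T2 x y \<partial>M) + (\<integral>\<^sup>+y. T3 x y \<partial>M)) \<partial>M)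
        = (\<integral>\<^sup>+x. \<integral>\<^sup>+y. T1 x y \<partial>M \<partial>M) + ((\<integral>\<^sup>+x. \<integral>\<^sup>+y. T2 x y \<partial>M \<partial>M) + (\<integral>\<^sup>+x. \<integral>\<^sup>+y. T3 x y \<partial>M \<partial>M))"
    proof -
      have 1: "(\<lambda>x. \<integral>\<^sup>+y. T1 x y \<partial>M) \<in> borel_measurable M"
        by (rule borel_measurable_nn_integral[OF T1m])
      have 2: "(\<lambda>x. \<integral>\<^sup>+y. T2 x y \<partial>M) \<in> borel_measurable M"
        by (rule borel_measurable_nn_integral[OF T2m])
      have 3: "(\<lambda>x. \<integral>\<^sup>+y. T3 x y \<partial>M) \<in> borel_measurable M"
        by (rule borel_measurable_nn_integral[OF T3m])
      show ?thesis unfolding nn_integral_add[OF 1 borel_measurable_add[OF 2 3]] nn_integral_add[OF 2 3] ..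
    qed
    have "(\<integral>\<^sup>+x. \<integral>\<^sup>+y. ennreal (norm (u x - u y) powr Q / dist x y powr (\<alpha> * Q + k)) \<partial>M \<partial>M)
        \<le> (\<integral>\<^sup>+x. \<integral>\<^sup>+y. T1 x y + (T2 x y + T3 x y) \<partial>M \<partial>M)"
      unfolding T1_def T2_def T3_def by (rule nn_integral_mono, rule nn_integral_mono, rule pt)
    also have "\<dots> = (\<integral>\<^sup>+x. \<integral>\<^sup>+y. T1 x y \<partial>M \<partial>M) + ((\<integral>\<^sup>+x. \<integral>\<^sup>+y. T2 x y \<partial>M \<partial>M) + (\<integral>\<^sup>+x. \<integral>\<^sup>+y. T3 x y \<partial>M \<partial>M))"
      unfolding inner outer ..
    also have "\<dots> \<le> ?c * ennreal (C1 * r powr ((1 - \<alpha>) * Q)) * emeasure M G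
        + (ennreal (2 powr Q * C2 * r powr (- (\<alpha> * Q))) * (\<integral>\<^sup>+x. ennreal (norm (u x) powr Q) \<partial>M)
         + ennreal (2 powr Q * C2 * r powr (- (\<alpha> * Q))) * (\<integral>\<^sup>+x. ennreal (norm (u x) powr Q) \<partial>M))"
      unfolding T1_def T2_def T3_def I3 by (rule add_mono[OF I1 add_mono[OF I2 I2]])
    also have "\<dots> \<le> ennreal C * (ennreal (L powr Q * r powr ((1 - \<alpha>) * Q)) * emeasure M G)
         + ennreal C * (ennreal (r powr (- (\<alpha> * Q))) * (\<integral>\<^sup>+x. ennreal (norm (u x) powr Q) \<partial>M))"
    proof (rule add_mono)
      have "?c * ennreal (C1 * r powr ((1 - \<alpha>) * Q)) = ennreal C1 * ennreal (L powr Q * r powr ((1 - \<alpha>) * Q))"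
        using C1(1) by (simp add: mult_ac flip: ennreal_mult)
      also have "\<dots> \<le> ennreal C * ennreal (L powr Q * r powr ((1 - \<alpha>) * Q))"
        using C2(1) by (intro mult_right_mono ennreal_leI) (auto simp: C_def)
      finally show "?c * ennreal (C1 * r powr ((1 - \<alpha>) * Q)) * emeasure M G
          \<le> ennreal C * (ennreal (L powr Q * r powr ((1 - \<alpha>) * Q)) * emeasure M G)"
        unfolding mult.assoc[symmetric] by (intro mult_right_mono) auto
      let ?e = "2 powr Q * C2 * r powr (- (\<alpha> * Q))" and ?I = "\<integral>\<^sup>+x. ennreal (norm (u x) powr Q) \<partial>M"
      have "ennreal ?e * ?I + ennreal ?e * ?I = ennreal (?e + ?e) * ?I"
        using C2(1) by (subst ennreal_plus) (auto simp: distrib_right)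
      also have "\<dots> \<le> ennreal (C * r powr (- (\<alpha> * Q))) * ?I"
        using C1(1) by (intro mult_right_mono ennreal_leI) (auto simp: C_def distrib_right)
      also have "\<dots> = ennreal C * (ennreal (r powr (- (\<alpha> * Q))) * ?I)"
        using C0 by (simp add: ennreal_mult mult.assoc)
      finally show "ennreal ?e * ?I + ennreal ?e * ?I \<le> ennreal C * (ennreal (r powr (- (\<alpha> * Q))) * ?I)" .
    qed
    also have "\<dots> = ennreal C * (ennreal (L powr Q * r powr ((1 - \<alpha>) * Q)) * emeasure M G
         + ennreal (r powr (- (\<alpha> * Q))) * (\<integral>\<^sup>+x. ennreal (norm (u x) powr Q) \<partial>M))"
      by (simp add: distrib_left)
    finally show "(\<integral>\<^sup>+x. \<integral>\<^sup>+y. ennreal (norm (u x - u y) powr Q / dist x y powr (\<alpha> * Q + k)) \<partial>M \<partial>M)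
     \<le> ennreal C * (ennreal (L powr Q * r powr ((1 - \<alpha>) * Q)) * emeasure M G
         + ennreal (r powr (- (\<alpha> * Q))) * (\<integral>\<^sup>+x. ennreal (norm (u x) powr Q) \<partial>M))" .
  qed
qed

end


section \<open>Regularity of the derivative\<close>

lemma prod_ennreal_le_1: "(\<And>i. i \<in> A \<Longrightarrow> f i \<le> (1::ennreal)) \<Longrightarrow> prod f A \<le> 1"
proof (induction A rule: infinite_finite_induct)
  case (insert x A)
  then have "f x * prod f A \<le> 1 * 1" by (intro mult_mono) auto
  then show ?case using insert by simp
qed simp_all

context orthonormal_set
begin

sublocale energy: sigma_growth_measure "plane_measure B" "2 ^ card B" "card B"
  by unfold_locales (simp_all add: plane_measure_cball)

end

context cantor_graph
begin

lemma near_grid_mono: "near_grid j \<eta> z \<Longrightarrow> \<eta> \<le> \<eta>' \<Longrightarrow> near_grid j \<eta>' z"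
  unfolding near_grid_def by (meson order_less_le_trans)

lemma base_slab_box: "base = slab_box B (\<lambda>_. {0..<len 0})"
  by (auto simp: base_def slab_box_def)

lemma base_sets [measurable]: "base \<in> sets borel"
  unfolding base_slab_box by (intro slab_box_sets) simp

lemma near_grid_sets [measurable]: "{z. near_grid j \<eta> z} \<in> sets borel"
proof -
  have "open {z. \<bar>z \<bullet> b - len j * of_int i\<bar> < \<eta>}" for b and i :: int
    by (intro open_Collect_less continuous_intros)
  then have "open (\<Union>b\<in>B. \<Union>i::int. {z. \<bar>z \<bullet> b - len j * of_int i\<bar> < \<eta>})" by blast
  moreover have "(\<Union>b\<in>B. \<Union>i::int. {z. \<bar>z \<bullet> b - len j * of_int i\<bar> < \<eta>}) = {z. near_grid j \<eta> z}"
    by (auto simp: near_grid_def)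
  ultimately show ?thesis by (metis borel_open)
qed

text \<open>Indices of all grid points within two cells of the base interval; the margin allows for
  neighbourhoods of the gaps.\<close>

definition grid_range :: "nat \<Rightarrow> int set" where "grid_range j = {-2 .. 2 ^ j + 2}"

lemma card_grid_range: "real (card (grid_range j)) \<le> 6 * (len 0 / len j)"
proof -
  have "real_of_int (int (card (grid_range j))) = 2 ^ j + 5" by (simp add: grid_range_def)
  then have "real (card (grid_range j)) = 2 ^ j + 5" by simp
  moreover have "(1::real) \<le> 2 ^ j" by simp
  moreover have "len 0 / len j = 2 ^ j" using len_add[of 0 j] len_pos[of 0] by simp
  ultimately show ?thesis by simp
qed

lemma in_grid_range:
  assumes "0 \<le> t" "t \<le> len 0" "\<bar>t - len j * of_int i\<bar> < 2 * len j"
  shows "i \<in> grid_range j"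
proof -
  have "len 0 = len j * 2 ^ j" using len_add[of 0 j] by simp
  then have "len j * of_int i < len j * (2 ^ j + 2)" "len j * (-2) < len j * of_int i"
    using assms by (auto simp: algebra_simps abs_less_iff)
  then have "(of_int i :: real) < 2 ^ j + 2" "-2 < (of_int i :: real)"
    by (simp_all only: mult_less_cancel_left_pos[OF len_pos])
  then have "real_of_int i < real_of_int (2 ^ j + 2)" "real_of_int (-2) < real_of_int i" by simp_all
  then show ?thesis unfolding of_int_less_iff by (simp add: grid_range_def)
qed

text \<open>By Fubini, because all other coordinates run through an interval of length at most one.\<close>

lemma nn_integral_base_coordinate_le:
  assumes b: "b \<in> B" and h: "h \<in> borel_measurable borel"
  shows "(\<integral>\<^sup>+z. indicator base z * h (z \<bullet> b) \<partial>plane_measure B) \<le> (\<integral>\<^sup>+t. h t \<partial>lborel)"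
proof -
  let ?H = "\<lambda>c t. if c = b then h t else indicator {0..<len 0} t"
  have "(\<integral>\<^sup>+z. indicator base z * h (z \<bullet> b) \<partial>plane_measure B) \<le> (\<integral>\<^sup>+z. (\<Prod>c\<in>B. ?H c (z \<bullet> c)) \<partial>plane_measure B)"
  proof (rule nn_integral_mono)
    fix z
    show "indicator base z * h (z \<bullet> b) \<le> (\<Prod>c\<in>B. ?H c (z \<bullet> c))"
    proof (cases "z \<in> base")
      case True
      have "(\<Prod>c\<in>B. ?H c (z \<bullet> c)) = h (z \<bullet> b) * (\<Prod>c\<in>B - {b}. ?H c (z \<bullet> c))"
        using finite_basis b by (subst prod.remove[of B b]) auto
      also have "(\<Prod>c\<in>B - {b}. ?H c (z \<bullet> c)) = 1"
        using True by (intro prod.neutral) (auto simp: base_def)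
      finally show ?thesis using True by simp
    qed simp
  qed
  also have "\<dots> = (\<Prod>c\<in>B. \<integral>\<^sup>+t. ?H c t \<partial>lborel)"
    using h by (intro nn_integral_plane_prod) auto
  also have "\<dots> = (\<integral>\<^sup>+t. h t \<partial>lborel) * (\<Prod>c\<in>B - {b}. \<integral>\<^sup>+t. ?H c t \<partial>lborel)"
    using finite_basis b by (subst prod.remove[of B b]) auto
  also have "(\<Prod>c\<in>B - {b}. \<integral>\<^sup>+t. ?H c t \<partial>lborel) \<le> 1"
    using len_le_1[of 0] len_pos[of 0] by (intro prod_ennreal_le_1) (auto simp: ennreal_le_1)
  finally show ?thesis by (simp add: mult_left_mono)
qed

lemma emeasure_base_le: "emeasure (plane_measure B) base \<le> 1"
proof -
  have "emeasure (plane_measure B) base = (\<Prod>b\<in>B. ennreal (len 0))"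
    unfolding base_slab_box using len_pos[of 0] by (subst emeasure_plane_box) auto
  also have "\<dots> \<le> 1"
    using len_le_1[of 0] by (intro prod_ennreal_le_1) (auto simp: ennreal_le_1)
  finally show ?thesis .
qed

text \<open>In each coordinate the base cube meets \<open>O(l\<^sub>0 / l\<^sub>j)\<close> slabs of width \<open>2 \<eta>\<close>.\<close>

lemma emeasure_near_grid_le:
  assumes \<eta>: "0 < \<eta>" "\<eta> \<le> 2 * len j"
  shows "emeasure (plane_measure B) (base \<inter> {z. near_grid j \<eta> z}) \<le> ennreal (12 * real k * (\<eta> / len j))"
proof -
  let ?I = "\<lambda>i::int. {len j * of_int i - \<eta> .. len j * of_int i + \<eta>}"
  let ?S = "\<lambda>b i. {z\<in>base. z \<bullet> b \<in> ?I i}"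
  have S_sets: "?S b i \<in> sets (plane_measure B)" for b i by measurable
  have S_le: "emeasure (plane_measure B) (?S b i) \<le> ennreal (2 * \<eta>)" if b: "b \<in> B" for b i
  proof -
    have "emeasure (plane_measure B) (?S b i) = (\<integral>\<^sup>+z. indicator base z * indicator (?I i) (z \<bullet> b) \<partial>plane_measure B)"
      by (subst nn_integral_indicator[symmetric, OF S_sets]) (intro nn_integral_cong, auto simp: indicator_def)
    also have "\<dots> \<le> (\<integral>\<^sup>+t. indicator (?I i) t \<partial>lborel)"
      by (rule nn_integral_base_coordinate_le[OF b]) simp
    also have "\<dots> = ennreal (2 * \<eta>)" using \<eta> by simp
    finally show ?thesis .
  qed
  have "base \<inter> {z. near_grid j \<eta> z} \<subseteq> (\<Union>p\<in>B \<times> grid_range j. ?S (fst p) (snd p))"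
  proof
    fix z assume z: "z \<in> base \<inter> {z. near_grid j \<eta> z}"
    then obtain b i where bi: "b \<in> B" "\<bar>z \<bullet> b - len j * of_int i\<bar> < \<eta>" by (auto simp: near_grid_def)
    have "i \<in> grid_range j"
      using z bi \<eta> by (intro in_grid_range[of "z \<bullet> b"]) (auto simp: base_def less_imp_le)
    moreover have "z \<in> ?S b i" using z bi by (auto simp: abs_less_iff)
    ultimately show "z \<in> (\<Union>p\<in>B \<times> grid_range j. ?S (fst p) (snd p))"
      using bi(1) by (intro UN_I[of "(b, i)"]) auto
  qed
  then have "emeasure (plane_measure B) (base \<inter> {z. near_grid j \<eta> z})
      \<le> emeasure (plane_measure B) (\<Union>p\<in>B \<times> grid_range j. ?S (fst p) (snd p))"
    using S_sets finite_basis by (intro emeasure_mono sets.finite_UN) (auto simp: grid_range_def)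
  also have "\<dots> \<le> (\<Sum>p\<in>B \<times> grid_range j. emeasure (plane_measure B) (?S (fst p) (snd p)))"
    using S_sets finite_basis by (intro emeasure_subadditive_finite) (auto simp: grid_range_def)
  also have "\<dots> \<le> (\<Sum>p\<in>B \<times> grid_range j. ennreal (2 * \<eta>))"
    by (intro sum_mono S_le) auto
  also have "\<dots> = ennreal (real (card (B \<times> grid_range j)) * (2 * \<eta>))"
    using \<eta> by (simp add: ennreal_mult flip: ennreal_of_nat_eq_real_of_nat)
  also have "\<dots> \<le> ennreal (12 * real k * (\<eta> / len j))"
  proof (rule ennreal_leI)
    have "real (card (B \<times> grid_range j)) * (2 * \<eta>) = real k * real (card (grid_range j)) * (2 * \<eta>)"
      by (simp add: card_cartesian_product)
    also have "\<dots> \<le> real k * (6 * (1 / len j)) * (2 * \<eta>)"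
    proof (intro mult_right_mono mult_left_mono)
      have "6 * (len 0 / len j) \<le> 6 * (1 / len j)"
        using len_le_1[of 0] len_pos[of j] by (intro mult_left_mono divide_right_mono) auto
      then show "real (card (grid_range j)) \<le> 6 * (1 / len j)" using card_grid_range[of j] by linarith
    qed (use \<eta> in auto)
    finally show "real (card (B \<times> grid_range j)) * (2 * \<eta>) \<le> 12 * real k * (\<eta> / len j)" by simp
  qed
  finally show ?thesis .
qed

lemma norm_limit_deriv_diff_le:
  "norm (limit_deriv x - limit_deriv y) \<le> (\<Sum>j. norm (dbump j x - dbump j y))"
  "summable (\<lambda>j. norm (dbump j x - dbump j y))"
proof -
  have "summable (\<lambda>j. norm (dbump j x) + norm (dbump j y))"
    by (intro summable_add summable_dbump)
  then show s: "summable (\<lambda>j. norm (dbump j x - dbump j y))"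
    by (rule summable_comparison_test'[where N=0]) (simp add: norm_triangle_ineq4)
  have "limit_deriv x - limit_deriv y = (\<Sum>j. dbump j x - dbump j y)"
    unfolding limit_deriv_def by (intro suminf_diff summable_norm_cancel[OF summable_dbump])
  then show "norm (limit_deriv x - limit_deriv y) \<le> (\<Sum>j. norm (dbump j x - dbump j y))"
    using summable_norm[OF s] by simp
qed

text \<open>At distances below and above the gap width, respectively, the Lipschitz bound and the size of the
  \<open>j\<close>-th derivative give the Hoelder constant \<open>l\<^sub>j\<^sup>2\<^sup>-\<^sup>\<beta> d\<^sub>j\<^sup>-\<^sup>\<alpha>\<close> up to a factor.\<close>

lemma limit_deriv_Hoelder:
  assumes \<alpha>: "0 < \<alpha>" "\<alpha> < 1" and pos: "0 < 2 - \<beta> - \<alpha> * \<beta>"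
  shows "\<exists>C. \<forall>x y. norm (limit_deriv x - limit_deriv y) \<le> C * dist x y powr \<alpha>"
proof -
  obtain K where K: "0 < K" "\<And>j x. norm (dbump j x) \<le> K * (len j powr (2 - \<beta>))"
     "\<And>j x y. norm (x - y) < gap j / 4 \<Longrightarrow> norm (dbump j x - dbump j y) \<le> K * (len j powr (2 - \<beta>) / gap j) * norm (x - y)"
    using dbump_bounds by meson
  have one: "norm (dbump j x - dbump j y) \<le> 8 * K * dist x y powr \<alpha> * len j powr (2 - \<beta> - \<alpha> * \<beta>)" for j x y
  proof (cases "x = y")
    case False
    then have d: "0 < dist x y" by simp
    let ?a = "len j powr (2 - \<beta>)" and ?g = "gap j"
    have g: "0 < ?g" by (rule gap_pos)
    have ga: "?g powr (- \<alpha>) = len j powr (- \<alpha> * \<beta>)" by (simp add: gap_def powr_powr mult.commute)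
    have "norm (dbump j x - dbump j y) \<le> 8 * K * ?a * (dist x y / ?g) powr \<alpha>"
    proof (cases "dist x y < ?g / 4")
      case True
      then have le1: "dist x y / ?g \<le> 1" using g by simp
      have "norm (dbump j x - dbump j y) \<le> K * (?a / ?g) * dist x y" using K(3)[of x y j] True by (simp add: dist_norm)
      also have "\<dots> = K * ?a * (dist x y / ?g) powr 1" using d g by simp
      also have "\<dots> \<le> K * ?a * (dist x y / ?g) powr \<alpha>"
        using d g le1 \<alpha> K(1) by (intro mult_left_mono powr_mono') auto
      also have "\<dots> \<le> 8 * (K * ?a * (dist x y / ?g) powr \<alpha>)"
        using K(1) by simp
      finally show ?thesis by simp
    next
      case False
      then have "1 \<le> 4 * (dist x y / ?g)" using g by (simp add: field_simps)
      then have "1 \<le> (4 * (dist x y / ?g)) powr \<alpha>" using \<alpha> by (intro ge_one_powr_ge_zero) auto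
      also have "\<dots> = 4 powr \<alpha> * (dist x y / ?g) powr \<alpha>"
        by (rule powr_mult)
      also have "\<dots> \<le> 4 powr 1 * (dist x y / ?g) powr \<alpha>" using \<alpha> by (intro mult_right_mono powr_mono) auto
      finally have 1: "1 \<le> 4 * (dist x y / ?g) powr \<alpha>" by simp
      have "norm (dbump j x - dbump j y) \<le> 2 * (K * ?a)"
        using norm_triangle_ineq4[of "dbump j x" "dbump j y"] K(2)[of j x] K(2)[of j y] by linarith
      also have "\<dots> \<le> 2 * (K * ?a) * (4 * (dist x y / ?g) powr \<alpha>)"
        using mult_left_mono[OF 1, of "2 * (K * ?a)"] K(1) by simp
      finally show ?thesis by simp
    qed
    also have "(dist x y / ?g) powr \<alpha> = dist x y powr \<alpha> * len j powr (- \<alpha> * \<beta>)"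
      using d g ga by (simp add: powr_mult powr_minus divide_inverse inverse_powr)
    also have "8 * K * ?a * (dist x y powr \<alpha> * len j powr (- \<alpha> * \<beta>)) = 8 * K * dist x y powr \<alpha> * (?a * len j powr (- \<alpha> * \<beta>))"
      by (simp add: mult_ac)
    also have "?a * len j powr (- \<alpha> * \<beta>) = len j powr (2 - \<beta> - \<alpha> * \<beta>)"
      by (simp flip: powr_add)
    finally show ?thesis .
  qed simp
  have "norm (limit_deriv x - limit_deriv y) \<le> (8 * K * (\<Sum>j. len j powr (2 - \<beta> - \<alpha> * \<beta>))) * dist x y powr \<alpha>" for x y
  proof -
    have s: "summable (\<lambda>j. 8 * K * dist x y powr \<alpha> * len j powr (2 - \<beta> - \<alpha> * \<beta>))"
      by (intro summable_mult summable_len_powr pos)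
    have "norm (limit_deriv x - limit_deriv y) \<le> (\<Sum>j. norm (dbump j x - dbump j y))"
      by (rule norm_limit_deriv_diff_le)
    also have "\<dots> \<le> (\<Sum>j. 8 * K * dist x y powr \<alpha> * len j powr (2 - \<beta> - \<alpha> * \<beta>))"
      by (intro suminf_le one norm_limit_deriv_diff_le s)
    also have "\<dots> = 8 * K * dist x y powr \<alpha> * (\<Sum>j. len j powr (2 - \<beta> - \<alpha> * \<beta>))"
      by (rule suminf_mult[OF summable_len_powr[OF pos]])
    finally show ?thesis by (simp add: mult_ac)
  qed
  then show ?thesis by blast
qed

text \<open>The general energy estimate at the scale \<open>r = d\<^sub>j / 4\<close>, with \<open>G\<close> the neighbourhood of the gaps. Its
  terms are \<open>d\<^sub>j\<^sup>-\<^sup>\<alpha>\<^sup>Q\<close> times \<open>l\<^sub>j\<^sup>(\<^sup>2\<^sup>-\<^sup>\<beta>\<^sup>)\<^sup>Q d\<^sub>j / l\<^sub>j\<close>, from the gaps, and \<open>d\<^sub>j\<^sup>-\<^sup>\<alpha>\<^sup>Q l\<^sub>j\<^sup>Q\<close>, from the interior of the cells; the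
  latter is not larger because \<open>Q \<ge> 1\<close> and \<open>\<beta> \<ge> 1\<close>.\<close>

lemma dbump_energy_le:
  assumes \<alpha>: "0 < \<alpha>" "\<alpha> < 1" and Q: "1 \<le> Q"
  shows "\<exists>C\<ge>0. \<forall>j. (\<integral>\<^sup>+x. \<integral>\<^sup>+y. ennreal (norm (dbump j x - dbump j y) powr Q / dist x y powr (\<alpha> * Q + real k))
       \<partial>plane_measure B \<partial>plane_measure B) \<le> ennreal (C * len j powr (Q * (2 - \<beta> - \<alpha> * \<beta>) + \<beta> - 1))"
proof -
  let ?M = "plane_measure B"
  obtain K where K: "0 < K" "\<And>j x. norm (dbump j x) \<le> K * (len j powr (2 - \<beta>))"
     "\<And>j x. \<not> near_grid j (gap j) x \<Longrightarrow> norm (dbump j x) \<le> K * len j"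
     "\<And>j x y. norm (x - y) < gap j / 4 \<Longrightarrow> norm (dbump j x - dbump j y) \<le> K * (len j powr (2 - \<beta>) / gap j) * norm (x - y)"
    using dbump_bounds by meson
  have "0 < Q" using Q by simp
  from energy.fractional_energy_le[OF \<alpha> this, where 'b="'a \<Rightarrow>\<^sub>L 'a"]
  obtain C where C: "0 \<le> C" and energy: "\<And>(u :: 'a \<Rightarrow> 'a \<Rightarrow>\<^sub>L 'a) G r L. continuous_on UNIV u \<Longrightarrow> 0 < r \<Longrightarrow> 0 \<le> L \<Longrightarrow>
     G \<in> sets borel \<Longrightarrow> (\<forall>x y. dist x y < r \<longrightarrow> norm (u x - u y) \<le> L * dist x y) \<Longrightarrow>
     (\<forall>x y. dist x y < r \<longrightarrow> u x \<noteq> u y \<longrightarrow> x \<in> G) \<Longrightarrow>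
     (\<integral>\<^sup>+x. \<integral>\<^sup>+y. ennreal (norm (u x - u y) powr Q / dist x y powr (\<alpha> * Q + k)) \<partial>?M \<partial>?M)
     \<le> ennreal C * (ennreal (L powr Q * r powr ((1 - \<alpha>) * Q)) * emeasure ?M G
         + ennreal (r powr (- (\<alpha> * Q))) * (\<integral>\<^sup>+x. ennreal (norm (u x) powr Q) \<partial>?M))"
    by blast
  define e1 where "e1 = Q * (2 - \<beta> - \<alpha> * \<beta>) + \<beta> - 1"
  define C1 where "C1 = K powr Q * (1 / 4) powr ((1 - \<alpha>) * Q) * (24 * real k)"
  define C2 where "C2 = (1 / 4) powr (- (\<alpha> * Q)) * (K powr Q * (24 * real k) + K powr Q)"
  have C12: "0 \<le> C1" "0 \<le> C2" by (simp_all add: C1_def C2_def)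
  have "(\<integral>\<^sup>+x. \<integral>\<^sup>+y. ennreal (norm (dbump j x - dbump j y) powr Q / dist x y powr (\<alpha> * Q + real k)) \<partial>?M \<partial>?M)
      \<le> ennreal (C * (C1 + C2) * len j powr e1)" for j
  proof -
    let ?l = "len j" and ?g = "gap j"
    let ?G = "base \<inter> {z. near_grid j (2 * ?g) z}" and ?L = "K * (?l powr (2 - \<beta>) / ?g)" and ?r = "?g / 4"
    have l: "0 < ?l" by (rule len_pos)
    have g: "0 < ?g" by (rule gap_pos)
    have gl: "?g / ?l = ?l powr (\<beta> - 1)" using l by (simp add: gap_def powr_diff)
    have MG: "emeasure ?M ?G \<le> ennreal (24 * real k * ?l powr (\<beta> - 1))"
    proof -
      have "12 * real k * (2 * ?g / ?l) = 24 * real k * ?l powr (\<beta> - 1)" unfolding gl[symmetric] by simp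
      then show ?thesis using emeasure_near_grid_le[of "2 * ?g" j] g gap_le_len[of j] by simp
    qed
    have e1: "(?l powr (2 - \<beta>)) powr Q * ?g powr (- (\<alpha> * Q)) * ?l powr (\<beta> - 1) = ?l powr e1"
      unfolding gap_def powr_powr powr_add[symmetric] e1_def by (simp add: algebra_simps)
    have e2: "?l powr Q * ?g powr (- (\<alpha> * Q)) \<le> ?l powr e1"
    proof -
      have "?l powr Q * ?g powr (- (\<alpha> * Q)) = ?l powr (Q + \<beta> * (- (\<alpha> * Q)))"
        unfolding gap_def powr_powr powr_add[symmetric] ..
      also have "\<dots> \<le> ?l powr e1"
      proof (rule powr_mono')
        have "0 \<le> (Q - 1) * (\<beta> - 1)" using Q \<beta>(1) by simp
        then show "e1 \<le> Q + \<beta> * (- (\<alpha> * Q))" by (simp add: e1_def algebra_simps)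
      qed (use l len_le_1 in auto)
      finally show ?thesis .
    qed
    have near: "ennreal (?L powr Q * ?r powr ((1 - \<alpha>) * Q)) * emeasure ?M ?G \<le> ennreal (C1 * ?l powr e1)"
    proof -
      have "?L powr Q * ?r powr ((1 - \<alpha>) * Q) * (24 * real k * ?l powr (\<beta> - 1)) = C1 * ?l powr e1"
      proof -
        have 1: "?L powr Q = K powr Q * (?l powr (2 - \<beta>)) powr Q * ?g powr (- Q)"
          using K(1) l g by (simp add: powr_mult powr_divide powr_minus divide_inverse inverse_powr)
        have 2: "?r powr ((1 - \<alpha>) * Q) = (1 / 4) powr ((1 - \<alpha>) * Q) * ?g powr ((1 - \<alpha>) * Q)"
          using g powr_mult[of "1/4" ?g] by simp
        have 3: "?g powr (- Q) * ?g powr ((1 - \<alpha>) * Q) = ?g powr (- (\<alpha> * Q))"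
          unfolding powr_add[symmetric] by (simp add: algebra_simps)
        have "?L powr Q * ?r powr ((1 - \<alpha>) * Q) * (24 * real k * ?l powr (\<beta> - 1))
            = C1 * ((?l powr (2 - \<beta>)) powr Q * (?g powr (- Q) * ?g powr ((1 - \<alpha>) * Q)) * ?l powr (\<beta> - 1))"
          unfolding 1 2 C1_def by (simp only: mult_ac)
        then show ?thesis unfolding 3 e1 .
      qed
      then have eq: "ennreal (C1 * ?l powr e1)
          = ennreal (?L powr Q * ?r powr ((1 - \<alpha>) * Q)) * ennreal (24 * real k * ?l powr (\<beta> - 1))"
        by (simp add: ennreal_mult[symmetric])
      show ?thesis unfolding eq by (rule mult_left_mono[OF MG]) simp
    qed
    have norm_le: "(\<integral>\<^sup>+x. ennreal (norm (dbump j x) powr Q) \<partial>?M)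
        \<le> ennreal ((K * ?l powr (2 - \<beta>)) powr Q * (24 * real k * ?l powr (\<beta> - 1)) + (K * ?l) powr Q)"
    proof -
      have "(\<integral>\<^sup>+x. ennreal (norm (dbump j x) powr Q) \<partial>?M)
          \<le> (\<integral>\<^sup>+x. ennreal ((K * ?l powr (2 - \<beta>)) powr Q) * indicator ?G x + ennreal ((K * ?l) powr Q) * indicator base x \<partial>?M)"
      proof (rule nn_integral_mono)
        fix x
        have "near_grid j (2 * ?g) x" if "near_grid j ?g x"
          using near_grid_mono[OF that, of "2 * ?g"] g by simp
        then consider "x \<notin> base" | "x \<in> ?G" | "x \<in> base" "\<not> near_grid j ?g x" by blast
        then show "ennreal (norm (dbump j x) powr Q)
            \<le> ennreal ((K * ?l powr (2 - \<beta>)) powr Q) * indicator ?G x + ennreal ((K * ?l) powr Q) * indicator base x"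
        proof cases
          case 1 then show ?thesis using off_base_dbump by simp
        next
          case 2
          have "ennreal (norm (dbump j x) powr Q) \<le> ennreal ((K * ?l powr (2 - \<beta>)) powr Q) * indicator ?G x"
            using 2 K(2) Q by (simp add: ennreal_leI powr_mono2)
          then show ?thesis by (rule add_increasing2[rotated]) simp
        next
          case 3
          have "ennreal (norm (dbump j x) powr Q) \<le> ennreal ((K * ?l) powr Q) * indicator base x"
            using 3 K(3) Q by (simp add: ennreal_leI powr_mono2)
          then show ?thesis by (rule add_increasing[rotated]) simp
        qed
      qed
      also have "\<dots> = ennreal ((K * ?l powr (2 - \<beta>)) powr Q) * emeasure ?M ?G + ennreal ((K * ?l) powr Q) * emeasure ?M base"
        by (subst nn_integral_add) (simp_all add: nn_integral_cmult_indicator)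
      also have "\<dots> \<le> ennreal ((K * ?l powr (2 - \<beta>)) powr Q) * ennreal (24 * real k * ?l powr (\<beta> - 1)) + ennreal ((K * ?l) powr Q) * 1"
        by (intro add_mono mult_left_mono MG emeasure_base_le) auto
      also have "\<dots> = ennreal ((K * ?l powr (2 - \<beta>)) powr Q * (24 * real k * ?l powr (\<beta> - 1)) + (K * ?l) powr Q)"
        by (simp add: ennreal_mult[symmetric] ennreal_plus[symmetric] del: ennreal_plus)
      finally show ?thesis .
    qed
    have far: "ennreal (?r powr (- (\<alpha> * Q))) * (\<integral>\<^sup>+x. ennreal (norm (dbump j x) powr Q) \<partial>?M) \<le> ennreal (C2 * ?l powr e1)"
    proof -
      let ?N = "(K * ?l powr (2 - \<beta>)) powr Q * (24 * real k * ?l powr (\<beta> - 1)) + (K * ?l) powr Q"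
      have "?r powr (- (\<alpha> * Q)) * ?N \<le> C2 * ?l powr e1"
      proof -
        have 1: "(K * ?l powr (2 - \<beta>)) powr Q = K powr Q * (?l powr (2 - \<beta>)) powr Q" "(K * ?l) powr Q = K powr Q * ?l powr Q"
          using K(1) l by (simp_all add: powr_mult)
        have 2: "?r powr (- (\<alpha> * Q)) = (1 / 4) powr (- (\<alpha> * Q)) * ?g powr (- (\<alpha> * Q))"
          using g powr_mult[of "1/4" ?g] by simp
        have "?r powr (- (\<alpha> * Q)) * ?N = (1 / 4) powr (- (\<alpha> * Q)) * (K powr Q * (24 * real k) *
              ((?l powr (2 - \<beta>)) powr Q * ?g powr (- (\<alpha> * Q)) * ?l powr (\<beta> - 1))
            + K powr Q * (?l powr Q * ?g powr (- (\<alpha> * Q))))"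
          unfolding 1 2 by (simp only: distrib_left mult_ac)
        also have "\<dots> \<le> (1 / 4) powr (- (\<alpha> * Q)) * (K powr Q * (24 * real k) * ?l powr e1 + K powr Q * ?l powr e1)"
          unfolding e1 by (intro mult_left_mono add_left_mono e2) auto
        also have "\<dots> = C2 * ?l powr e1" unfolding C2_def by (simp only: distrib_right mult.assoc)
        finally show ?thesis .
      qed
      then have "ennreal (?r powr (- (\<alpha> * Q))) * ennreal ?N \<le> ennreal (C2 * ?l powr e1)"
        by (subst ennreal_mult[symmetric]) (auto intro: ennreal_leI)
      then show ?thesis by (rule order_trans[OF mult_left_mono[OF norm_le zero_le]])
    qed
    have "(\<integral>\<^sup>+x. \<integral>\<^sup>+y. ennreal (norm (dbump j x - dbump j y) powr Q / dist x y powr (\<alpha> * Q + real k)) \<partial>?M \<partial>?M)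
        \<le> ennreal C * (ennreal (?L powr Q * ?r powr ((1 - \<alpha>) * Q)) * emeasure ?M ?G
         + ennreal (?r powr (- (\<alpha> * Q))) * (\<integral>\<^sup>+x. ennreal (norm (dbump j x) powr Q) \<partial>?M))"
    proof (rule energy[OF continuous_dbump])
      show "\<forall>x y. dist x y < ?r \<longrightarrow> norm (dbump j x - dbump j y) \<le> ?L * dist x y"
        using K(4) by (simp add: dist_norm)
      show "\<forall>x y. dist x y < ?r \<longrightarrow> dbump j x \<noteq> dbump j y \<longrightarrow> x \<in> ?G"
        using dbump_neq_near_grid by (simp add: dist_norm)
    qed (use K(1) g l in auto)
    also have "\<dots> \<le> ennreal C * (ennreal (C1 * ?l powr e1) + ennreal (C2 * ?l powr e1))"
      by (intro mult_left_mono add_mono near far) auto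
    also have "\<dots> = ennreal (C * (C1 + C2) * ?l powr e1)"
      using C C12 by (simp add: ennreal_mult[symmetric] ennreal_plus[symmetric] distrib_right distrib_left mult.assoc del: ennreal_plus)
    finally show ?thesis .
  qed
  then show ?thesis using C C12 unfolding e1_def by (intro exI[of _ "C * (C1 + C2)"]) auto
qed

lemma limit_deriv_energy_finite:
  assumes \<alpha>: "0 < \<alpha>" "\<alpha> < 1" and Q: "1 \<le> Q" and pos: "0 < Q * (2 - \<beta> - \<alpha> * \<beta>) + \<beta> - 1"
  shows "(\<integral>\<^sup>+x. \<integral>\<^sup>+y. ennreal (norm (limit_deriv x - limit_deriv y) powr Q / dist x y powr (\<alpha> * Q + real k))
       \<partial>plane_measure B \<partial>plane_measure B) < \<infinity>"
proof -
  let ?M = "plane_measure B"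
  define e where "e = Q * (2 - \<beta> - \<alpha> * \<beta>) + \<beta> - 1"
  obtain C where C: "0 \<le> C" "\<And>j. (\<integral>\<^sup>+x. \<integral>\<^sup>+y. ennreal (norm (dbump j x - dbump j y) powr Q / dist x y powr (\<alpha> * Q + real k))
       \<partial>?M \<partial>?M) \<le> ennreal (C * len j powr e)"
    using dbump_energy_le[OF \<alpha> Q] unfolding e_def by blast
  \<comment> \<open>These weights spend half of the decay of the energies.\<close>
  define w where "w j = len j powr (e / (2 * Q))" for j
  have e: "0 < e" using pos by (simp add: e_def)
  have w: "0 < w j" "summable w" for j
    unfolding w_def[abs_def] using len_pos[of j] e Q by (auto intro!: summable_len_powr)
  define c where "c j = suminf w powr Q * w j powr (- Q)" for j
  have c0: "0 \<le> c j" for j by (simp add: c_def)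
  let ?N = "\<lambda>j x y. ennreal (norm (dbump j x - dbump j y) powr Q / dist x y powr (\<alpha> * Q + real k))"
  have measN [measurable]: "(\<lambda>(x, y). ?N j x y) \<in> borel_measurable (?M \<Otimes>\<^sub>M ?M)" for j
  proof -
    have "continuous_on UNIV (\<lambda>p::'a \<times> 'a. norm (dbump j (fst p) - dbump j (snd p)))"
      by (intro continuous_intros continuous_on_compose2[OF continuous_dbump]) auto
    then have [measurable]: "(\<lambda>p. norm (dbump j (fst p) - dbump j (snd p))) \<in> borel_measurable (?M \<Otimes>\<^sub>M ?M)"
      by (intro energy.pair_borel borel_measurable_continuous_onI)
    have [measurable]: "(\<lambda>p. dist (fst p) (snd p)) \<in> borel_measurable (?M \<Otimes>\<^sub>M ?M)"
      by (intro energy.pair_borel borel_measurable_continuous_onI continuous_intros)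
    show ?thesis unfolding case_prod_beta' by measurable
  qed
  have meas: "(\<lambda>(x, y). ennreal (c j) * ?N j x y) \<in> borel_measurable (?M \<Otimes>\<^sub>M ?M)" for j
    using measN[of j] unfolding case_prod_beta' by (intro borel_measurable_times_ennreal borel_measurable_const)
  have "(\<integral>\<^sup>+x. \<integral>\<^sup>+y. ennreal (norm (limit_deriv x - limit_deriv y) powr Q / dist x y powr (\<alpha> * Q + real k)) \<partial>?M \<partial>?M)
      \<le> (\<integral>\<^sup>+x. \<integral>\<^sup>+y. (\<Sum>j. ennreal (c j) * ?N j x y) \<partial>?M \<partial>?M)"
  proof (rule nn_integral_mono, rule nn_integral_mono)
    fix x y
    let ?a = "\<lambda>j. norm (dbump j x - dbump j y)" and ?d = "dist x y powr (\<alpha> * Q + real k)"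
    have "ennreal (norm (limit_deriv x - limit_deriv y) powr Q) \<le> ennreal (suminf ?a powr Q)"
      using Q norm_limit_deriv_diff_le(1) by (intro ennreal_leI powr_mono2) auto
    also have "\<dots> \<le> (\<Sum>j. ennreal (c j * ?a j powr Q))"
      unfolding c_def using Q w norm_limit_deriv_diff_le(2) by (intro powr_suminf_le) auto
    finally have "ennreal (norm (limit_deriv x - limit_deriv y) powr Q) * ennreal (1 / ?d)
        \<le> (\<Sum>j. ennreal (c j * ?a j powr Q)) * ennreal (1 / ?d)" by (rule mult_right_mono) simp
    also have "\<dots> = (\<Sum>j. ennreal (c j * ?a j powr Q) * ennreal (1 / ?d))" by (rule ennreal_suminf_multc[symmetric])
    also have "\<dots> = (\<Sum>j. ennreal (c j) * ?N j x y)"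
      using c0 by (intro suminf_cong) (simp flip: ennreal_mult)
    finally show "ennreal (norm (limit_deriv x - limit_deriv y) powr Q / ?d) \<le> (\<Sum>j. ennreal (c j) * ?N j x y)"
      by (simp flip: ennreal_mult)
  qed
  also have "\<dots> = (\<integral>\<^sup>+x. (\<Sum>j. \<integral>\<^sup>+y. ennreal (c j) * ?N j x y \<partial>?M) \<partial>?M)"
  proof (intro nn_integral_cong nn_integral_suminf)
    fix x j
    show "(\<lambda>y. ennreal (c j) * ?N j x y) \<in> borel_measurable ?M"
      using measurable_Pair2[OF meas[of j], of x] by simp
  qed
  also have "\<dots> = (\<Sum>j. \<integral>\<^sup>+x. \<integral>\<^sup>+y. ennreal (c j) * ?N j x y \<partial>?M \<partial>?M)"
    by (intro nn_integral_suminf plane.borel_measurable_nn_integral[OF meas])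
  also have "\<dots> \<le> (\<Sum>j. ennreal (suminf w powr Q * C * len j powr (e / 2)))"
  proof (intro suminf_le summableI)
    fix j
    have N1: "(\<lambda>y. ?N j x y) \<in> borel_measurable ?M" for x
      using measurable_Pair2[OF measN[of j], of x] by simp
    have "(\<integral>\<^sup>+x. \<integral>\<^sup>+y. ennreal (c j) * ?N j x y \<partial>?M \<partial>?M)
        = ennreal (c j) * (\<integral>\<^sup>+x. \<integral>\<^sup>+y. ?N j x y \<partial>?M \<partial>?M)"
      unfolding nn_integral_cmult[OF N1]
      by (rule nn_integral_cmult[OF plane.borel_measurable_nn_integral[OF measN]])
    also have "\<dots> \<le> ennreal (c j) * ennreal (C * len j powr e)" by (rule mult_left_mono[OF C(2)]) simp
    also have "\<dots> = ennreal (c j * (C * len j powr e))" using c0 C(1) by (simp add: ennreal_mult)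
    also have "c j * (C * len j powr e) = suminf w powr Q * C * len j powr (e / 2)"
    proof -
      have "w j powr (- Q) = len j powr (- (e / 2))" using Q by (simp add: w_def powr_powr)
      moreover have "len j powr (- (e / 2)) * len j powr e = len j powr (e / 2)"
        unfolding powr_add[symmetric] by simp
      ultimately show ?thesis by (simp add: c_def mult_ac)
    qed
    finally show "(\<integral>\<^sup>+x. \<integral>\<^sup>+y. ennreal (c j) * ?N j x y \<partial>?M \<partial>?M)
        \<le> ennreal (suminf w powr Q * C * len j powr (e / 2))" .
  qed
  also have "\<dots> < \<infinity>"
  proof -
    have "summable (\<lambda>j. suminf w powr Q * C * len j powr (e / 2))"
      using e by (intro summable_mult summable_len_powr) simp
    then have "(\<Sum>j. ennreal (suminf w powr Q * C * len j powr (e / 2))) \<noteq> top"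
      using C(1) by (subst suminf_ennreal2) auto
    then show ?thesis by (simp add: less_top)
  qed
  finally show ?thesis .
qed

end


section \<open>Measure and fractional perimeter of the core\<close>

lemma growth_measure_lborel_real: "growth_measure (lborel :: real measure) 2 1"
proof
  fix r :: real and x :: real assume "0 \<le> r"
  then show "emeasure lborel (cball x r) \<le> ennreal (2 * r ^ 1)" by (simp add: cball_eq_atLeastAtMost)
qed simp_all

text \<open>The distance to the nearer end point of the interval is the distance to one of them, so this is the
  integral of the kernel on the line near that end point.\<close>

lemma interval_boundary_integral:
  assumes s: "0 < s" "s < 1"
  shows "\<exists>C\<ge>0. \<forall>c \<delta>. 0 < \<delta> \<longrightarrow>
    (\<integral>\<^sup>+t. indicator {t. \<bar>t - c\<bar> < \<delta>} t * ennreal ((\<delta> - \<bar>t - c\<bar>) powr (- s)) \<partial>lborel) \<le> ennreal (C * \<delta> powr (1 - s))"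
proof -
  interpret growth_measure "lborel :: real measure" 2 1 by (rule growth_measure_lborel_real)
  have "0 < 1 - s" using s by simp
  from near_integral[OF this] obtain C where "0 \<le> C" and "\<forall>x \<delta>. 0 < \<delta> \<longrightarrow>
    (\<integral>\<^sup>+y. indicator {y. dist x y < \<delta>} y * ennreal (dist x y powr (1 - s - real 1)) \<partial>(lborel :: real measure)) \<le> ennreal (C * \<delta> powr (1 - s))"
    by (elim exE conjE) (rule that)
  note C = this(1) this(2)[rule_format]
  have "(\<integral>\<^sup>+t. indicator {t. \<bar>t - c\<bar> < \<delta>} t * ennreal ((\<delta> - \<bar>t - c\<bar>) powr (- s)) \<partial>lborel)
      \<le> ennreal (2 * C * 2 powr (1 - s) * \<delta> powr (1 - s))" if \<delta>: "0 < \<delta>" for c \<delta> :: real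
  proof -
    let ?k = "\<lambda>x t. indicator {t. dist x t < 2 * \<delta>} t * ennreal (dist x t powr (1 - s - real 1))"
    have "(\<integral>\<^sup>+t. indicator {t. \<bar>t - c\<bar> < \<delta>} t * ennreal ((\<delta> - \<bar>t - c\<bar>) powr (- s)) \<partial>lborel)
        \<le> (\<integral>\<^sup>+t. ?k (c - \<delta>) t + ?k (c + \<delta>) t \<partial>lborel)"
    proof (rule nn_integral_mono)
      fix t
      show "indicator {t. \<bar>t - c\<bar> < \<delta>} t * ennreal ((\<delta> - \<bar>t - c\<bar>) powr (- s)) \<le> ?k (c - \<delta>) t + ?k (c + \<delta>) t"
      proof (cases "\<bar>t - c\<bar> < \<delta>")
        case True
        show ?thesis
        proof (cases "t \<le> c")
          case t: True
          have "\<delta> - \<bar>t - c\<bar> = dist (c - \<delta>) t" "dist (c - \<delta>) t < 2 * \<delta>" using True t by (auto simp: dist_real_def)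
          then have "indicator {t. \<bar>t - c\<bar> < \<delta>} t * ennreal ((\<delta> - \<bar>t - c\<bar>) powr (- s)) = ?k (c - \<delta>) t"
            using True by simp
          then show ?thesis by simp
        next
          case t: False
          have "\<delta> - \<bar>t - c\<bar> = dist (c + \<delta>) t" "dist (c + \<delta>) t < 2 * \<delta>" using True t by (auto simp: dist_real_def)
          then have "indicator {t. \<bar>t - c\<bar> < \<delta>} t * ennreal ((\<delta> - \<bar>t - c\<bar>) powr (- s)) = ?k (c + \<delta>) t"
            using True by simp
          then show ?thesis by simp
        qed
      qed simp
    qed
    also have "\<dots> = (\<integral>\<^sup>+t. ?k (c - \<delta>) t \<partial>lborel) + (\<integral>\<^sup>+t. ?k (c + \<delta>) t \<partial>lborel)"
      by (rule nn_integral_add) (unfold indicator_def, measurable)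
    also have "\<dots> \<le> ennreal (C * (2 * \<delta>) powr (1 - s)) + ennreal (C * (2 * \<delta>) powr (1 - s))"
      using \<delta> by (intro add_mono C(2)) auto
    also have "\<dots> = ennreal (2 * C * 2 powr (1 - s) * \<delta> powr (1 - s))"
      using C(1) \<delta> by (simp add: powr_mult ennreal_plus[symmetric] del: ennreal_plus)
    finally show ?thesis .
  qed
  then show ?thesis using C(1) by (intro exI[of _ "2 * C * 2 powr (1 - s)"]) auto
qed

context cantor_graph
begin

lemma core_sets [measurable]: "core \<in> sets borel"
  using compact_core by (rule borel_compact)

lemma emeasure_core_finite: "emeasure (plane_measure B) core < \<infinity>"
proof -
  have "core \<subseteq> base" using core_base by blast
  then have "emeasure (plane_measure B) core \<le> emeasure (plane_measure B) base"
    by (intro emeasure_mono) auto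
  then show ?thesis using emeasure_base_le by (auto simp: less_top[symmetric] top_unique)
qed

text \<open>The gaps of generation \<open>j\<close> have total length at most \<open>12 l\<^sub>0 l\<^sub>j\<^sup>\<beta>\<^sup>-\<^sup>1\<close>; by hypothesis the sum of these is
  smaller than the length \<open>l\<^sub>0\<close> of the interval.\<close>

lemma emeasure_cantor_pos:
  assumes small: "12 * (\<Sum>j. len j powr (\<beta> - 1)) < 1"
  shows "0 < emeasure lborel cantor"
proof (rule ccontr)
  assume "\<not> 0 < emeasure lborel cantor"
  then have null: "emeasure lborel cantor = 0" by simp
  let ?R = "\<lambda>j i. {len j * of_int i - gap j .. len j * of_int i + gap j} :: real set"
  have cover: "{0..len 0} \<subseteq> cantor \<union> (\<Union>j. \<Union>i\<in>grid_range j. ?R j i)"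
  proof
    fix t assume t: "t \<in> {0..len 0}"
    show "t \<in> cantor \<union> (\<Union>j. \<Union>i\<in>grid_range j. ?R j i)"
    proof (cases "t \<in> cantor")
      case False
      then obtain j and i :: int where ji: "\<bar>t - len j * of_int i\<bar> < gap j"
        using t by (auto simp: cantor_def not_le)
      then have "\<bar>t - len j * of_int i\<bar> < 2 * len j" using gap_le_len[of j] gap_pos[of j] by linarith
      then have "i \<in> grid_range j" using t by (intro in_grid_range) auto
      moreover have "t \<in> ?R j i" using ji by (auto simp: abs_less_iff)
      ultimately show ?thesis by blast
    qed simp
  qed
  have Rj: "emeasure lborel (\<Union>i\<in>grid_range j. ?R j i) \<le> ennreal (12 * len 0 * len j powr (\<beta> - 1))" for j
  proof -
    have "emeasure lborel (\<Union>i\<in>grid_range j. ?R j i) \<le> (\<Sum>i\<in>grid_range j. emeasure lborel (?R j i))"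
      by (rule emeasure_subadditive_finite) (auto simp: grid_range_def)
    also have "\<dots> = (\<Sum>i\<in>grid_range j. ennreal (2 * gap j))" using gap_pos[of j] by simp
    also have "\<dots> = ennreal (real (card (grid_range j)) * (2 * gap j))"
      using gap_pos[of j] by (simp add: ennreal_mult flip: ennreal_of_nat_eq_real_of_nat)
    also have "\<dots> \<le> ennreal (12 * len 0 * len j powr (\<beta> - 1))"
    proof (rule ennreal_leI)
      have "real (card (grid_range j)) * (2 * gap j) \<le> 6 * (len 0 / len j) * (2 * gap j)"
        using gap_pos[of j] by (intro mult_right_mono card_grid_range) auto
      also have "\<dots> = 12 * len 0 * (gap j / len j)" by simp
      also have "gap j / len j = len j powr (\<beta> - 1)" using len_pos[of j] by (simp add: gap_def powr_diff)
      finally show "real (card (grid_range j)) * (2 * gap j) \<le> 12 * len 0 * len j powr (\<beta> - 1)" .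
    qed
    finally show ?thesis .
  qed
  have sm: "summable (\<lambda>j. 12 * len 0 * len j powr (\<beta> - 1))" using \<beta> by (intro summable_mult summable_len_powr) auto
  have "ennreal (len 0) = emeasure lborel {0..len 0}" using len_pos[of 0] by simp
  also have "\<dots> \<le> emeasure lborel (cantor \<union> (\<Union>j. \<Union>i\<in>grid_range j. ?R j i))"
    using cover closed_cantor by (intro emeasure_mono) (auto simp: grid_range_def)
  also have "\<dots> \<le> emeasure lborel cantor + emeasure lborel (\<Union>j. \<Union>i\<in>grid_range j. ?R j i)"
    using closed_cantor by (intro emeasure_subadditive) (auto simp: grid_range_def)
  also have "\<dots> = emeasure lborel (\<Union>j. \<Union>i\<in>grid_range j. ?R j i)" using null by simp
  also have "\<dots> \<le> (\<Sum>j. emeasure lborel (\<Union>i\<in>grid_range j. ?R j i))"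
    by (intro emeasure_subadditive_countably) (auto simp: grid_range_def)
  also have "\<dots> \<le> (\<Sum>j. ennreal (12 * len 0 * len j powr (\<beta> - 1)))" by (intro suminf_le Rj summableI)
  also have "\<dots> = ennreal (\<Sum>j. 12 * len 0 * len j powr (\<beta> - 1))"
    using len_pos[of 0] sm by (intro suminf_ennreal2) auto
  also have "(\<Sum>j. 12 * len 0 * len j powr (\<beta> - 1)) = 12 * len 0 * (\<Sum>j. len j powr (\<beta> - 1))"
    using \<beta> by (intro suminf_mult summable_len_powr) auto
  finally have "len 0 \<le> 12 * len 0 * (\<Sum>j. len j powr (\<beta> - 1))"
    using len_pos[of 0] by (subst (asm) ennreal_le_iff) (auto intro!: mult_nonneg_nonneg suminf_nonneg summable_len_powr simp: \<beta>)
  also have "\<dots> = len 0 * (12 * (\<Sum>j. len j powr (\<beta> - 1)))" by simp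
  also have "\<dots> < len 0 * 1" by (rule mult_strict_left_mono[OF small len_pos])
  finally show False by simp
qed

lemma emeasure_core_pos:
  assumes "12 * (\<Sum>j. len j powr (\<beta> - 1)) < 1"
  shows "0 < emeasure (plane_measure B) core"
proof -
  have cs: "cantor \<in> sets borel" using closed_cantor by (rule borel_closed)
  have "emeasure (plane_measure B) core = emeasure (plane_measure B) (slab_box B (\<lambda>_. cantor))"
    using AE_plane_span slab_box_sets[of "\<lambda>_. cantor"] cs
    by (intro emeasure_eq_AE) (auto simp: core_def slab_box_def intro: core_sets[unfolded core_def])
  also have "\<dots> = (\<Prod>b\<in>B. emeasure lborel cantor)" using cs by (intro emeasure_plane_box) simp
  finally have "emeasure (plane_measure B) core = (\<Prod>b\<in>B. emeasure lborel cantor)" .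
  moreover have "emeasure lborel cantor \<noteq> 0" using emeasure_cantor_pos[OF assms] by simp
  ultimately show ?thesis using finite_basis by (simp add: zero_less_iff_neq_zero)
qed

text \<open>For \<open>x\<close> outside the core the inner integral is at most a multiple of \<open>\<rho>\<^sup>-\<^sup>s\<close>, where \<open>\<rho>\<close> is a lower bound for
  the distance to the core. If \<open>x\<close> is in the base cube, one of its coordinates lies in a gap, and
  the distance to the end points of that gap can be taken for \<open>\<rho>\<close>; its power \<open>-s\<close> is integrable over
  each gap. Outside the base cube the distance to the core is bounded below, and the order of
  integration is exchanged because the core, but not the outside, has finite measure.\<close>

lemma core_half_perimeter_finite:
  assumes s: "0 < s" "s < 1" and pos: "1 < \<beta> * (1 - s)"
  shows "(\<integral>\<^sup>+x. \<integral>\<^sup>+y. indicator (- core) x * (indicator core y * ennreal (dist x y powr (- s - real k)))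
     \<partial>plane_measure B \<partial>plane_measure B) < \<infinity>"
proof -
  let ?M = "plane_measure B"
  define N where "N x y = indicator core y * ennreal (dist x y powr (- s - real k))" for x y
  have Nm [measurable]: "case_prod N \<in> borel_measurable (?M \<Otimes>\<^sub>M ?M)"
    unfolding N_def by measurable
  obtain C where C: "0 \<le> C" "\<And>x \<delta>. 0 < \<delta> \<Longrightarrow>
    (\<integral>\<^sup>+y. indicator {y. \<delta> \<le> dist x y} y * ennreal (dist x y powr (- s - real k)) \<partial>?M) \<le> ennreal (C * \<delta> powr (- s))"
    using energy.tail_integral[OF s(1)] by blast
  obtain C' where C': "0 \<le> C'" "\<And>c \<delta>. 0 < \<delta> \<Longrightarrow>
    (\<integral>\<^sup>+t. indicator {t. \<bar>t - c\<bar> < \<delta>} t * ennreal ((\<delta> - \<bar>t - c\<bar>) powr (- s)) \<partial>lborel) \<le> ennreal (C' * \<delta> powr (1 - s))"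
    using interval_boundary_integral[OF s] by blast
  have tail: "(\<integral>\<^sup>+y. N x y \<partial>?M) \<le> ennreal (C * \<rho> powr (- s))" if "0 < \<rho>" "\<And>y. y \<in> core \<Longrightarrow> \<rho> \<le> dist x y" for x \<rho>
  proof -
    have "(\<integral>\<^sup>+y. N x y \<partial>?M) \<le> (\<integral>\<^sup>+y. indicator {y. \<rho> \<le> dist x y} y * ennreal (dist x y powr (- s - real k)) \<partial>?M)"
      unfolding N_def using that(2) by (intro nn_integral_mono mult_right_mono) (auto simp: indicator_def)
    also have "\<dots> \<le> ennreal (C * \<rho> powr (- s))" by (rule C(2)[OF that(1)])
    finally show ?thesis .
  qed
  \<comment> \<open>The sum over all gaps dominates the contribution of the gap that contains the point.\<close>
  define h where "h j i t = indicator {t. \<bar>t - len j * of_int i\<bar> < gap j} t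
      * ennreal ((gap j - \<bar>t - len j * of_int i\<bar>) powr (- s))" for j and i :: int and t
  have hm [measurable]: "h j i \<in> borel_measurable borel" for j i
    unfolding h_def indicator_def by measurable
  define H where "H z = (\<Sum>j. \<Sum>p\<in>B \<times> grid_range j. indicator base z * h j (snd p) (z \<bullet> fst p))" for z
  have in_base: "indicator (base - core) x * (\<integral>\<^sup>+y. N x y \<partial>?M) \<le> ennreal C * H x" if x: "x \<in> span B" for x
  proof (cases "x \<in> base - core")
    case True
    then obtain b where b: "b \<in> B" "x \<bullet> b \<notin> cantor" "0 \<le> x \<bullet> b" "x \<bullet> b < len 0"
      using x by (auto simp: core_def base_def)
    then obtain j and i :: int where ji: "\<bar>x \<bullet> b - len j * of_int i\<bar> < gap j"
      by (auto simp: cantor_def not_le)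
    then have "\<bar>x \<bullet> b - len j * of_int i\<bar> < 2 * len j" using gap_le_len[of j] gap_pos[of j] by linarith
    then have i: "i \<in> grid_range j" using b by (intro in_grid_range) auto
    define \<rho> where "\<rho> = gap j - \<bar>x \<bullet> b - len j * of_int i\<bar>"
    have "(\<integral>\<^sup>+y. N x y \<partial>?M) \<le> ennreal (C * \<rho> powr (- s))"
    proof (rule tail)
      show "0 < \<rho>" using ji by (simp add: \<rho>_def)
      fix y assume "y \<in> core"
      then have "gap j \<le> \<bar>y \<bullet> b - len j * of_int i\<bar>" using b(1) by (auto simp: core_def cantor_def)
      then have "\<rho> \<le> \<bar>x \<bullet> b - y \<bullet> b\<bar>" unfolding \<rho>_def by linarith
      also have "\<dots> \<le> dist x y" using abs_inner_basis_le[OF b(1), of "x - y"] by (simp add: inner_diff_left dist_norm)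
      finally show "\<rho> \<le> dist x y" .
    qed
    also have "\<dots> = ennreal C * (indicator base x * h j i (x \<bullet> b))"
      using True ji C(1) by (simp add: h_def \<rho>_def ennreal_mult)
    also have "\<dots> \<le> ennreal C * H x"
    proof (rule mult_left_mono)
      let ?t = "\<lambda>j p. indicator base x * h j (snd p) (x \<bullet> fst p)"
      have "indicator base x * h j i (x \<bullet> b) = ?t j (b, i)" by simp
      also have "\<dots> \<le> (\<Sum>p\<in>B \<times> grid_range j. ?t j p)"
        using b(1) i finite_basis by (intro member_le_sum) (auto simp: grid_range_def)
      also have "\<dots> = (\<Sum>j\<in>{j}. \<Sum>p\<in>B \<times> grid_range j. ?t j p)" by simp
      also have "\<dots> \<le> H x" unfolding H_def by (intro sum_le_suminf summableI) auto
      finally show "indicator base x * h j i (x \<bullet> b) \<le> H x" .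
    qed simp
    finally show ?thesis using True by simp
  qed simp
  have H_int: "(\<integral>\<^sup>+z. H z \<partial>?M) < \<infinity>"
  proof -
    have "(\<integral>\<^sup>+z. H z \<partial>?M) = (\<Sum>j. \<integral>\<^sup>+z. (\<Sum>p\<in>B \<times> grid_range j. indicator base z * h j (snd p) (z \<bullet> fst p)) \<partial>?M)"
      unfolding H_def by (rule nn_integral_suminf) measurable
    also have "\<dots> = (\<Sum>j. \<Sum>p\<in>B \<times> grid_range j. \<integral>\<^sup>+z. indicator base z * h j (snd p) (z \<bullet> fst p) \<partial>?M)"
      by (intro suminf_cong nn_integral_sum) measurable
    also have "\<dots> \<le> (\<Sum>j. ennreal (6 * real k * len 0 * C' * len j powr (\<beta> * (1 - s) - 1)))"
    proof (intro suminf_le summableI)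
      fix j
      have "(\<Sum>p\<in>B \<times> grid_range j. \<integral>\<^sup>+z. indicator base z * h j (snd p) (z \<bullet> fst p) \<partial>?M)
          \<le> (\<Sum>p\<in>B \<times> grid_range j. ennreal (C' * gap j powr (1 - s)))"
      proof (rule sum_mono)
        fix p assume "p \<in> B \<times> grid_range j"
        then have "(\<integral>\<^sup>+z. indicator base z * h j (snd p) (z \<bullet> fst p) \<partial>?M) \<le> (\<integral>\<^sup>+t. h j (snd p) t \<partial>lborel)"
          by (intro nn_integral_base_coordinate_le hm) auto
        also have "\<dots> \<le> ennreal (C' * gap j powr (1 - s))" unfolding h_def by (rule C'(2)[OF gap_pos])
        finally show "(\<integral>\<^sup>+z. indicator base z * h j (snd p) (z \<bullet> fst p) \<partial>?M) \<le> ennreal (C' * gap j powr (1 - s))" .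
      qed
      also have "\<dots> = ennreal (real (card (B \<times> grid_range j)) * (C' * gap j powr (1 - s)))"
        using C'(1) by (simp add: ennreal_mult flip: ennreal_of_nat_eq_real_of_nat)
      also have "\<dots> \<le> ennreal (6 * real k * len 0 * C' * len j powr (\<beta> * (1 - s) - 1))"
      proof (rule ennreal_leI)
        have "real (card (B \<times> grid_range j)) * (C' * gap j powr (1 - s))
            = real k * real (card (grid_range j)) * (C' * gap j powr (1 - s))"
          by (simp add: card_cartesian_product)
        also have "\<dots> \<le> real k * (6 * (len 0 / len j)) * (C' * gap j powr (1 - s))"
          using C'(1) by (intro mult_right_mono mult_left_mono card_grid_range) auto
        also have "\<dots> = 6 * real k * len 0 * C' * (gap j powr (1 - s) / len j)" by simp
        also have "gap j powr (1 - s) / len j = len j powr (\<beta> * (1 - s) - 1)"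
        proof -
          have g: "gap j powr (1 - s) = len j powr (\<beta> * (1 - s))" by (simp only: gap_def powr_powr)
          have "len j powr (\<beta> * (1 - s) - 1) = len j powr (\<beta> * (1 - s)) / len j powr 1" by (rule powr_diff)
          then show ?thesis unfolding g using len_pos[of j] by simp
        qed
        finally show "real (card (B \<times> grid_range j)) * (C' * gap j powr (1 - s))
            \<le> 6 * real k * len 0 * C' * len j powr (\<beta> * (1 - s) - 1)" .
      qed
      finally show "(\<Sum>p\<in>B \<times> grid_range j. \<integral>\<^sup>+z. indicator base z * h j (snd p) (z \<bullet> fst p) \<partial>?M)
          \<le> ennreal (6 * real k * len 0 * C' * len j powr (\<beta> * (1 - s) - 1))" .
    qed
    also have "\<dots> < \<infinity>"
    proof -
      have "summable (\<lambda>j. 6 * real k * len 0 * C' * len j powr (\<beta> * (1 - s) - 1))"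
        using pos by (intro summable_mult summable_len_powr) simp
      then have "(\<Sum>j. ennreal (6 * real k * len 0 * C' * len j powr (\<beta> * (1 - s) - 1))) \<noteq> top"
        using C'(1) len_pos[of 0] by (subst suminf_ennreal2) auto
      then show ?thesis by (simp add: less_top)
    qed
    finally show ?thesis .
  qed
  have base_part: "(\<integral>\<^sup>+x. indicator (base - core) x * (\<integral>\<^sup>+y. N x y \<partial>?M) \<partial>?M) < \<infinity>"
  proof -
    have "AE x in ?M. indicator (base - core) x * (\<integral>\<^sup>+y. N x y \<partial>?M) \<le> ennreal C * H x"
      using AE_plane_span by eventually_elim (rule in_base)
    then have "(\<integral>\<^sup>+x. indicator (base - core) x * (\<integral>\<^sup>+y. N x y \<partial>?M) \<partial>?M) \<le> (\<integral>\<^sup>+x. ennreal C * H x \<partial>?M)"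
      by (rule nn_integral_mono_AE)
    also have "\<dots> = ennreal C * (\<integral>\<^sup>+x. H x \<partial>?M)"
      unfolding H_def by (intro nn_integral_cmult) measurable
    also have "\<dots> < \<infinity>" using H_int by (simp add: ennreal_mult_less_top)
    finally show ?thesis .
  qed
  \<comment> \<open>The gaps of generation 0 at the end points of the base interval separate the two sets.\<close>
  have far: "gap 0 \<le> dist x y" if xy: "x \<notin> base" "y \<in> core" for x y
  proof -
    obtain b where b: "b \<in> B" "x \<bullet> b < 0 \<or> len 0 \<le> x \<bullet> b" using xy(1) by (auto simp: base_def not_le)
    have "0 \<le> y \<bullet> b" "y \<bullet> b \<le> len 0" "gap 0 \<le> \<bar>y \<bullet> b - len 0 * of_int 0\<bar>" "gap 0 \<le> \<bar>y \<bullet> b - len 0 * of_int 1\<bar>"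
      using xy(2) b(1) unfolding core_def cantor_def by blast+
    then have "gap 0 \<le> \<bar>x \<bullet> b - y \<bullet> b\<bar>" using b(2) gap_pos[of 0] by auto
    also have "\<dots> \<le> dist x y" using abs_inner_basis_le[OF b(1), of "x - y"] by (simp add: inner_diff_left dist_norm)
    finally show ?thesis .
  qed
  have far_part: "(\<integral>\<^sup>+x. \<integral>\<^sup>+y. indicator (- base) x * N x y \<partial>?M \<partial>?M) < \<infinity>"
  proof -
    have "(\<integral>\<^sup>+x. \<integral>\<^sup>+y. indicator (- base) x * N x y \<partial>?M \<partial>?M) = (\<integral>\<^sup>+y. \<integral>\<^sup>+x. indicator (- base) x * N x y \<partial>?M \<partial>?M)"
      by (rule energy.pairs.Fubini') measurable
    also have "\<dots> \<le> (\<integral>\<^sup>+y. ennreal (C * gap 0 powr (- s)) * indicator core y \<partial>?M)"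
    proof (rule nn_integral_mono)
      fix y
      have "(\<integral>\<^sup>+x. indicator (- base) x * N x y \<partial>?M)
          \<le> (\<integral>\<^sup>+x. indicator {x. gap 0 \<le> dist y x} x * ennreal (dist y x powr (- s - real k)) \<partial>?M)" if "y \<in> core"
        using far that by (intro nn_integral_mono) (auto simp: N_def indicator_def dist_commute)
      also have "\<dots> \<le> ennreal (C * gap 0 powr (- s))" by (rule C(2)[OF gap_pos])
      finally show "(\<integral>\<^sup>+x. indicator (- base) x * N x y \<partial>?M) \<le> ennreal (C * gap 0 powr (- s)) * indicator core y"
        by (cases "y \<in> core") (auto simp: N_def)
    qed
    also have "\<dots> = ennreal (C * gap 0 powr (- s)) * emeasure ?M core"
      by (intro nn_integral_cmult_indicator) simp
    also have "\<dots> < \<infinity>" using emeasure_core_finite by (simp add: ennreal_mult_less_top)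
    finally show ?thesis .
  qed
  have Nx: "(\<lambda>y. N x y) \<in> borel_measurable ?M" for x
    using measurable_Pair2[OF Nm, of x] by simp
  have mN: "(\<lambda>x. \<integral>\<^sup>+y. N x y \<partial>?M) \<in> borel_measurable ?M" by (rule plane.borel_measurable_nn_integral[OF Nm])
  have "(\<integral>\<^sup>+x. \<integral>\<^sup>+y. indicator (- core) x * N x y \<partial>?M \<partial>?M)
      = (\<integral>\<^sup>+x. indicator (base - core) x * (\<integral>\<^sup>+y. N x y \<partial>?M) + indicator (- base) x * (\<integral>\<^sup>+y. N x y \<partial>?M) \<partial>?M)"
  proof (rule nn_integral_cong)
    fix x
    have "indicator (- core) x = (indicator (base - core) x + indicator (- base) x :: ennreal)"
      using core_base[of x] by (auto simp: indicator_def)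
    then show "(\<integral>\<^sup>+y. indicator (- core) x * N x y \<partial>?M)
        = indicator (base - core) x * (\<integral>\<^sup>+y. N x y \<partial>?M) + indicator (- base) x * (\<integral>\<^sup>+y. N x y \<partial>?M)"
      by (subst nn_integral_cmult[OF Nx]) (simp only: distrib_right)
  qed
  also have "\<dots> = (\<integral>\<^sup>+x. indicator (base - core) x * (\<integral>\<^sup>+y. N x y \<partial>?M) \<partial>?M)
      + (\<integral>\<^sup>+x. indicator (- base) x * (\<integral>\<^sup>+y. N x y \<partial>?M) \<partial>?M)"
    by (intro nn_integral_add borel_measurable_times_ennreal mN) auto
  also have "(\<integral>\<^sup>+x. indicator (- base) x * (\<integral>\<^sup>+y. N x y \<partial>?M) \<partial>?M) = (\<integral>\<^sup>+x. \<integral>\<^sup>+y. indicator (- base) x * N x y \<partial>?M \<partial>?M)"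
    by (simp only: nn_integral_cmult[OF Nx])
  finally show ?thesis using base_part far_part unfolding N_def by (simp add: ennreal_add_less_top)
qed

lemma core_perimeter_finite:
  assumes s: "0 < s" "s < 1" and pos: "1 < \<beta> * (1 - s)"
  shows "(\<integral>\<^sup>+x. \<integral>\<^sup>+(y::'a). ennreal (\<bar>indicator core x - indicator core y :: real\<bar> / dist x y powr (s + real k))
     \<partial>plane_measure B \<partial>plane_measure B) < \<infinity>"
proof -
  let ?M = "plane_measure B"
  define N where "N x y = indicator (- core) x * (indicator core y * ennreal (dist x y powr (- s - real k)))" for x y
  have Nm [measurable]: "case_prod N \<in> borel_measurable (?M \<Otimes>\<^sub>M ?M)" unfolding N_def by measurable
  have Nm2 [measurable]: "(\<lambda>(x, y). N y x) \<in> borel_measurable (?M \<Otimes>\<^sub>M ?M)" unfolding N_def by measurable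
  have Nx: "(\<lambda>y. N x y) \<in> borel_measurable ?M" "(\<lambda>y. N y x) \<in> borel_measurable ?M" for x
    using measurable_Pair2[OF Nm, of x] measurable_Pair2[OF Nm2, of x] by simp_all
  have fin: "(\<integral>\<^sup>+x. \<integral>\<^sup>+y. N x y \<partial>?M \<partial>?M) < \<infinity>" unfolding N_def by (rule core_half_perimeter_finite[OF assms])
  have "(\<integral>\<^sup>+x. \<integral>\<^sup>+y. ennreal (\<bar>indicator core x - indicator core y :: real\<bar> / dist x y powr (s + real k)) \<partial>?M \<partial>?M)
      = (\<integral>\<^sup>+x. (\<integral>\<^sup>+y. N x y \<partial>?M) + (\<integral>\<^sup>+y. N y x \<partial>?M) \<partial>?M)"
  proof (rule nn_integral_cong)
    fix x :: 'a
    have eq: "dist x y powr (- s - real k) = 1 / dist x y powr (s + real k)" for y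
      using powr_minus_divide[of "dist x y" "s + real k"] by simp
    have "ennreal (\<bar>indicator core x - indicator core y :: real\<bar> / dist x y powr (s + real k)) = N x y + N y x" for y
      by (cases "x \<in> core"; cases "y \<in> core") (simp_all add: N_def eq dist_commute[of y x])
    then show "(\<integral>\<^sup>+y. ennreal (\<bar>indicator core x - indicator core y :: real\<bar> / dist x y powr (s + real k)) \<partial>?M)
        = (\<integral>\<^sup>+y. N x y \<partial>?M) + (\<integral>\<^sup>+y. N y x \<partial>?M)"
      by (simp only: nn_integral_add[OF Nx])
  qed
  also have "\<dots> = (\<integral>\<^sup>+x. \<integral>\<^sup>+y. N x y \<partial>?M \<partial>?M) + (\<integral>\<^sup>+x. \<integral>\<^sup>+y. N y x \<partial>?M \<partial>?M)"
    by (intro nn_integral_add plane.borel_measurable_nn_integral Nm Nm2)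
  also have "(\<integral>\<^sup>+x. \<integral>\<^sup>+y. N y x \<partial>?M \<partial>?M) = (\<integral>\<^sup>+x. \<integral>\<^sup>+y. N x y \<partial>?M \<partial>?M)"
    using energy.pairs.Fubini'[of "\<lambda>x y. N y x"] Nm2 by simp
  finally show ?thesis using fin by (simp add: ennreal_add_less_top)
qed

end


section \<open>The surface\<close>

context cantor_graph
begin

abbreviation surface :: "'a set" where "surface \<equiv> graph_over (span B) limit_map"

text \<open>The set \<open>E\<close> of the theorem.\<close>

definition lift :: "'a set" where "lift = graph.embed ` core"

lemma embed_Lipschitz: "\<exists>L>0. \<forall>x y. dist (graph.embed x) (graph.embed y) \<le> L * dist x y"
proof -
  obtain C where C: "\<And>x. norm (limit_deriv x) \<le> C" using ex_norm_limit_deriv_bound by blast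
  have C0: "0 \<le> C" using C[of 0] norm_ge_zero order_trans by blast
  have f: "norm (limit_map x - limit_map y) \<le> C * norm (x - y)" for x y
    using limit_map_has_derivative C
    by (intro differentiable_bound[of UNIV limit_map "\<lambda>x. blinfun_apply (limit_deriv x)"])
       (auto simp flip: norm_blinfun.rep_eq)
  have "dist (graph.embed x) (graph.embed y) \<le> (1 + C) * dist x y" for x y
  proof -
    have "norm ((x - y) + (limit_map x - limit_map y)) \<le> norm (x - y) + C * norm (x - y)"
      using norm_triangle_ineq[of "x - y" "limit_map x - limit_map y"] f[of x y] by linarith
    then show ?thesis by (simp add: graph.embed_def dist_norm algebra_simps)
  qed
  then show ?thesis using C0 by (intro exI[of _ "1 + C"]) auto
qed

lemma surface_sets: "surface \<in> sets borel"
  by (rule borel_closed[OF graph.closed_graph])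

text \<open>The comparison of the measures, turned into one of integrals. The Hausdorff measure lives on a larger
  sigma-algebra and is first restricted to the Borel sets.\<close>

lemma surface_integral_le:
  "\<exists>c\<ge>0. \<forall>g\<in>borel_measurable borel.
     (\<integral>\<^sup>+x. g x \<partial>restrict_space (hausdorff k) surface) \<le> ennreal c * (\<integral>\<^sup>+z. g (graph.embed z) \<partial>plane_measure B)"
proof -
  obtain L where L: "0 < L" "\<And>x y. dist (graph.embed x) (graph.embed y) \<le> L * dist x y"
    using embed_Lipschitz by blast
  define c where "c = unit_ball_vol k * (L * k / 2) ^ k"
  have c0: "0 \<le> c" using L(1) by (simp add: c_def)
  let ?H = "restrict_space (hausdorff k) surface"
  define \<nu> where "\<nu> = distr ?H borel (\<lambda>x. x)"
  define \<mu> where "\<mu> = scale_measure (ennreal c) (distr (plane_measure B) borel graph.embed)"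
  have S: "surface \<in> sets (hausdorff k)" using surface_sets sets_borel_le_hausdorff by blast
  have idm: "(\<lambda>x. x) \<in> ?H \<rightarrow>\<^sub>M borel"
  proof (rule measurable_restrict_space1)
    show "(\<lambda>x. x) \<in> hausdorff k \<rightarrow>\<^sub>M borel"
      using sets_borel_le_hausdorff[of k] by (auto simp: measurable_def)
  qed
  have embed_m: "graph.embed \<in> plane_measure B \<rightarrow>\<^sub>M borel"
    by (simp add: borel_measurable_continuous_onI graph.continuous_embed cong: measurable_cong_sets)
  have "\<nu> \<le> \<mu>"
  proof (subst le_measure)
    show "sets \<nu> = sets \<mu>" by (simp add: \<nu>_def \<mu>_def)
    show "\<forall>A\<in>sets \<nu>. emeasure \<nu> A \<le> emeasure \<mu> A"
    proof
      fix A assume "A \<in> sets \<nu>"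
      then have A: "A \<in> sets borel" by (simp add: \<nu>_def)
      have "emeasure \<nu> A = emeasure ?H (A \<inter> surface)"
        unfolding \<nu>_def by (subst emeasure_distr[OF idm A]) (simp add: space_restrict_space)
      also have "\<dots> = emeasure (hausdorff k) (A \<inter> surface)"
        using S by (subst emeasure_restrict_space) auto
      also have "\<dots> = hausdorff_outer k (A \<inter> graph.embed ` span B)"
        using A surface_sets sets_borel_le_hausdorff[of k]
        by (subst emeasure_hausdorff) (auto simp: graph.graph_over_embed)
      also have "\<dots> \<le> ennreal c * emeasure (plane_measure B) (graph.embed -` A)"
        unfolding c_def using L graph.continuous_embed A
        by (intro hausdorff_graph_le[where p=proj] graph.proj_embed)
           (auto intro!: linear_continuous_on blinfun.bounded_linear_right)
      also have "\<dots> = emeasure \<mu> A"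
        using A embed_m by (simp add: \<mu>_def emeasure_distr)
      finally show "emeasure \<nu> A \<le> emeasure \<mu> A" .
    qed
  qed
  then have "(\<integral>\<^sup>+x. g x \<partial>?H) \<le> ennreal c * (\<integral>\<^sup>+z. g (graph.embed z) \<partial>plane_measure B)"
    if g: "g \<in> borel_measurable borel" for g
  proof -
    assume le: "\<nu> \<le> \<mu>"
    have "(\<integral>\<^sup>+x. g x \<partial>?H) = (\<integral>\<^sup>+x. g x \<partial>\<nu>)" unfolding \<nu>_def by (rule nn_integral_distr[OF idm, symmetric]) (simp add: g)
    also have "\<dots> \<le> (\<integral>\<^sup>+x. g x \<partial>\<mu>)" using le by (intro nn_integral_mono_measure) (auto simp: \<nu>_def \<mu>_def)
    also have "\<dots> = ennreal c * (\<integral>\<^sup>+x. g x \<partial>distr (plane_measure B) borel graph.embed)"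
      unfolding \<mu>_def by (rule nn_integral_scale_measure) (simp add: g)
    also have "(\<integral>\<^sup>+x. g x \<partial>distr (plane_measure B) borel graph.embed) = (\<integral>\<^sup>+z. g (graph.embed z) \<partial>plane_measure B)"
      by (rule nn_integral_distr[OF embed_m]) (simp add: g)
    finally show ?thesis .
  qed
  then show ?thesis using c0 by blast
qed

lemma lift_sets: "lift \<in> sets borel"
  unfolding lift_def by (intro borel_compact compact_continuous_image compact_core graph.continuous_embed)

lemma embed_in_lift_iff: "z \<in> span B \<Longrightarrow> graph.embed z \<in> lift \<longleftrightarrow> z \<in> core"
proof
  assume z: "z \<in> span B" and "graph.embed z \<in> lift"
  then obtain w where w: "w \<in> core" "graph.embed z = graph.embed w"
    unfolding lift_def by blast
  then have ws: "w \<in> span B" by (simp add: core_def)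
  have "z = proj (graph.embed w)" unfolding w(2)[symmetric] by (rule graph.proj_embed[OF z, symmetric])
  also have "\<dots> = w" by (rule graph.proj_embed[OF ws])
  finally show "z \<in> core" using w(1) by simp
qed (simp add: lift_def)

lemma lift_subset_surface: "lift \<subseteq> surface"
  unfolding lift_def graph.graph_over_embed by (auto simp: core_def)

lemma emeasure_lift_pos:
  assumes "12 * (\<Sum>j. len j powr (\<beta> - 1)) < 1"
  shows "0 < emeasure (hausdorff k) lift"
proof -
  have "proj ` lift = core"
    unfolding lift_def image_image using graph.proj_embed by (force simp: core_def)
  then have "ennreal (unit_ball_vol k / (2 ^ k * 2 ^ k)) * emeasure (plane_measure B) core \<le> hausdorff_outer k lift"
    using norm_proj_le
    by (intro hausdorff_outer_ge[where p=proj] plane_measure_cball)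
       (auto simp: dist_norm core_sets simp flip: blinfun.diff_right)
  moreover have "0 < ennreal (unit_ball_vol k / (2 ^ k * 2 ^ k)) * emeasure (plane_measure B) core"
    using emeasure_core_pos[OF assms] by (simp add: ennreal_zero_less_mult_iff)
  moreover have "emeasure (hausdorff k) lift = hausdorff_outer k lift"
    using lift_sets sets_borel_le_hausdorff by (intro emeasure_hausdorff) blast
  ultimately show ?thesis by simp
qed

text \<open>The projection onto the plane does not increase distances, so the kernel on the surface is at most
  the one on the plane; this reduces the claim to the fractional perimeter of the core.\<close>

lemma lift_frac_sobolev:
  assumes s: "0 < s" "s < 1" and pos: "1 < \<beta> * (1 - s)"
  shows "frac_sobolev_surface surface k s 1 (indicator lift)"
  unfolding frac_sobolev_surface_def frac_sobolev_def
proof (intro conjI)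
  let ?H = "restrict_space (hausdorff k) surface" and ?M = "plane_measure B"
  let ?\<iota> = "indicator lift :: 'a \<Rightarrow> real"
  obtain c where c: "0 \<le> c" and le: "\<And>g. g \<in> borel_measurable borel \<Longrightarrow>
     (\<integral>\<^sup>+x. g x \<partial>?H) \<le> ennreal c * (\<integral>\<^sup>+z. g (graph.embed z) \<partial>?M)"
    using surface_integral_le by blast
  have [measurable]: "lift \<in> sets borel" by (rule lift_sets)
  have lift_H: "lift \<in> sets (hausdorff k)" using lift_sets sets_borel_le_hausdorff by blast
  then show "?\<iota> \<in> borel_measurable ?H" by (intro measurable_restrict_space1 borel_measurable_indicator)
  have embed_m [measurable]: "graph.embed \<in> borel_measurable borel"
    by (rule borel_measurable_continuous_onI[OF graph.continuous_embed])
  have ind: "AE z in ?M. ?\<iota> (graph.embed z) = indicator core z"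
    using AE_plane_span by eventually_elim (simp add: indicator_def embed_in_lift_iff)
  have "(\<integral>\<^sup>+x. ennreal (norm (?\<iota> x) powr 1) \<partial>?H) \<le> ennreal c * (\<integral>\<^sup>+z. ennreal (norm (?\<iota> (graph.embed z)) powr 1) \<partial>?M)"
    by (rule le) measurable
  also have "(\<integral>\<^sup>+z. ennreal (norm (?\<iota> (graph.embed z)) powr 1) \<partial>?M) = (\<integral>\<^sup>+z. indicator core z \<partial>?M)"
    using ind by (intro nn_integral_cong_AE) (auto simp: indicator_def)
  also have "\<dots> = emeasure ?M core" by (simp add: core_sets)
  finally show "(\<integral>\<^sup>+x. ennreal (norm (?\<iota> x) powr 1) \<partial>?H) < \<infinity>"
    using emeasure_core_finite by (auto simp: ennreal_mult_less_top intro: le_less_trans)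
  define G where "G x y = ennreal (norm (?\<iota> x - ?\<iota> y) powr 1 / dist x y powr (s * 1 + real k))" for x y
  have Gm [measurable]: "case_prod G \<in> borel_measurable (borel \<Otimes>\<^sub>M borel)" unfolding G_def by measurable
  have G1: "(\<lambda>y. G x y) \<in> borel_measurable borel" for x
    using measurable_Pair2[OF Gm, of x] by simp
  define \<Phi> where "\<Phi> x = (\<integral>\<^sup>+w. G x (graph.embed w) \<partial>?M)" for x
  have "(\<lambda>(x, w). G x (graph.embed w)) \<in> borel_measurable (borel \<Otimes>\<^sub>M ?M)"
    unfolding G_def by measurable
  from plane.borel_measurable_nn_integral[OF this]
  have \<Phi>m: "\<Phi> \<in> borel_measurable borel" unfolding \<Phi>_def[abs_def] .
  have "(\<integral>\<^sup>+x. \<integral>\<^sup>+y. G x y \<partial>?H \<partial>?H) \<le> (\<integral>\<^sup>+x. ennreal c * \<Phi> x \<partial>?H)"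
    unfolding \<Phi>_def by (intro nn_integral_mono le G1)
  also have "\<dots> \<le> ennreal c * (\<integral>\<^sup>+z. ennreal c * \<Phi> (graph.embed z) \<partial>?M)"
    using \<Phi>m by (intro le) simp
  also have "\<dots> \<le> ennreal c * (\<integral>\<^sup>+z. ennreal c *
      (\<integral>\<^sup>+w. ennreal (\<bar>indicator core z - indicator core w :: real\<bar> / dist z w powr (s + real k)) \<partial>?M) \<partial>?M)"
  proof (intro mult_left_mono nn_integral_mono_AE)
    show "AE z in ?M. ennreal c * \<Phi> (graph.embed z)
        \<le> ennreal c * (\<integral>\<^sup>+w. ennreal (\<bar>indicator core z - indicator core w :: real\<bar> / dist z w powr (s + real k)) \<partial>?M)"
      using AE_plane_span ind
    proof eventually_elim
      case (elim z)
      note z = elim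
      have "\<Phi> (graph.embed z) \<le> (\<integral>\<^sup>+w. ennreal (\<bar>indicator core z - indicator core w :: real\<bar> / dist z w powr (s + real k)) \<partial>?M)"
        unfolding \<Phi>_def
      proof (rule nn_integral_mono_AE)
        show "AE w in ?M. G (graph.embed z) (graph.embed w)
            \<le> ennreal (\<bar>indicator core z - indicator core w :: real\<bar> / dist z w powr (s + real k))"
          using AE_plane_span ind
        proof eventually_elim
          case (elim w)
          show ?case
          proof (cases "z = w")
            case False
            have "dist z w powr (s + real k) \<le> dist (graph.embed z) (graph.embed w) powr (s + real k)"
              using graph.dist_embed_ge[of z w] z elim s by (intro powr_mono2) auto
            moreover have "0 < dist (graph.embed z) (graph.embed w)" "0 < dist z w"
              using graph.dist_embed_ge[of z w] z elim False by (auto simp: order.strict_trans2)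
            ultimately show ?thesis
              unfolding G_def using z elim by (auto intro!: ennreal_leI divide_left_mono)
          qed (simp add: G_def)
        qed
      qed
      then show ?case by (rule mult_left_mono) simp
    qed
  qed auto
  also have "\<dots> = ennreal c * (ennreal c * (\<integral>\<^sup>+z.
      (\<integral>\<^sup>+w. ennreal (\<bar>indicator core z - indicator core w :: real\<bar> / dist z w powr (s + real k)) \<partial>?M) \<partial>?M))"
  proof -
    have "(\<lambda>(z, w). ennreal (\<bar>indicator core z - indicator core w :: real\<bar> / dist z w powr (s + real k)))
        \<in> borel_measurable (?M \<Otimes>\<^sub>M ?M)" by measurable
    from plane.borel_measurable_nn_integral[OF this] show ?thesis by (subst nn_integral_cmult) simp_all
  qed
  also have "\<dots> < \<infinity>"
    using core_perimeter_finite[OF assms] by (simp add: ennreal_mult_less_top)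
  finally show "(\<integral>\<^sup>+x. \<integral>\<^sup>+y. ennreal (norm (?\<iota> x - ?\<iota> y) powr 1 / dist x y powr (s * 1 + real k)) \<partial>?H \<partial>?H) < \<infinity>"
    unfolding G_def .
qed

lemma limit_deriv_off_base: "z \<notin> base \<Longrightarrow> limit_deriv z = 0"
  by (simp add: limit_deriv_def off_base_dbump)

lemma limit_deriv_frac_sobolev_flat:
  assumes leb: "lebesgue_subspace (span B) = completion (plane_measure B)"
    and \<alpha>: "0 < \<alpha>" "\<alpha> < 1" and q: "1 \<le> q"
    and inf: "q = \<infinity> \<Longrightarrow> 0 < 2 - \<beta> - \<alpha> * \<beta>"
    and fin: "q \<noteq> \<infinity> \<Longrightarrow> 0 < enn2real q * (2 - \<beta> - \<alpha> * \<beta>) + \<beta> - 1"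
  shows "frac_sobolev_flat (span B) (span B) \<alpha> q limit_deriv"
proof (cases "q = \<infinity>")
  case True
  obtain C where "\<And>x. norm (limit_deriv x) \<le> C" using ex_norm_limit_deriv_bound by blast
  then have "bounded (limit_deriv ` span B)" by (auto simp: bounded_iff)
  then show ?thesis
    using True limit_deriv_Hoelder[OF \<alpha> inf[OF True]] unfolding frac_sobolev_flat_def by auto
next
  case False
  let ?M = "plane_measure B" and ?Q = "enn2real q"
  let ?R = "restrict_space (completion ?M) (span B)"
  have Q: "1 \<le> ?Q"
    using q False enn2real_mono[of 1 q] by (auto simp: less_top)
  have span_sets: "span B \<inter> space (completion ?M) \<in> sets (completion ?M)"
    by (simp add: borel_closed closed_subspace)
  have R_le: "(\<integral>\<^sup>+x. g x \<partial>?R) \<le> (\<integral>\<^sup>+x. g x \<partial>?M)" for g :: "'a \<Rightarrow> ennreal"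
  proof -
    have "(\<integral>\<^sup>+x. g x \<partial>?R) = (\<integral>\<^sup>+x. g x * indicator (span B) x \<partial>completion ?M)"
      by (rule nn_integral_restrict_space[OF span_sets])
    also have "\<dots> \<le> (\<integral>\<^sup>+x. g x \<partial>completion ?M)" by (intro nn_integral_mono) (auto simp: indicator_def)
    finally show ?thesis by (simp add: nn_integral_completion)
  qed
  have dim: "dim (span B) = k" using independent_basis by (simp add: dim_eq_card_independent)
  have "limit_deriv \<in> borel_measurable ?M"
    by (simp add: borel_measurable_continuous_onI continuous_limit_deriv cong: measurable_cong_sets)
  then have meas: "limit_deriv \<in> borel_measurable ?R"
    by (intro measurable_restrict_space1 measurable_completion)
  obtain C where C: "\<And>x. norm (limit_deriv x) \<le> C" using ex_norm_limit_deriv_bound by blast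
  have "(\<integral>\<^sup>+x. ennreal (norm (limit_deriv x) powr ?Q) \<partial>?R) \<le> (\<integral>\<^sup>+x. ennreal (norm (limit_deriv x) powr ?Q) \<partial>?M)"
    by (rule R_le)
  also have "\<dots> \<le> (\<integral>\<^sup>+x. ennreal (C powr ?Q) * indicator base x \<partial>?M)"
    using C Q by (intro nn_integral_mono) (auto simp: indicator_def limit_deriv_off_base intro!: ennreal_leI powr_mono2)
  also have "\<dots> = ennreal (C powr ?Q) * emeasure ?M base" by (intro nn_integral_cmult_indicator) simp
  also have "\<dots> < \<infinity>"
    using le_less_trans[OF emeasure_base_le, of top] by (simp add: ennreal_mult_less_top)
  finally have Lq: "(\<integral>\<^sup>+x. ennreal (norm (limit_deriv x) powr ?Q) \<partial>?R) < \<infinity>" .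
  have "(\<integral>\<^sup>+x. \<integral>\<^sup>+y. ennreal (norm (limit_deriv x - limit_deriv y) powr ?Q / dist x y powr (\<alpha> * ?Q + real k)) \<partial>?R \<partial>?R)
      \<le> (\<integral>\<^sup>+x. \<integral>\<^sup>+y. ennreal (norm (limit_deriv x - limit_deriv y) powr ?Q / dist x y powr (\<alpha> * ?Q + real k)) \<partial>?M \<partial>?M)"
    by (rule order_trans[OF nn_integral_mono[OF R_le] R_le])
  also have "\<dots> < \<infinity>" by (rule limit_deriv_energy_finite[OF \<alpha> Q fin[OF False]])
  finally show ?thesis
    using False meas Lq unfolding frac_sobolev_flat_def frac_sobolev_def leb dim by simp
qed

text \<open>The smallness of the base cube keeps the graph above the core in the ball where \<open>A\<close> describes the
  distribution.\<close>

lemma lift_subset_tangency_set: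
  assumes V: "\<And>x. x \<in> cball 0 r \<Longrightarrow> V x = (\<lambda>w. w + blinfun_apply (A x) w) ` span B"
    and r: "(1 + 4 * \<Lambda>) * real k * len 0 \<le> r"
  shows "lift \<subseteq> tangency_set surface V"
proof
  fix x assume x: "x \<in> lift"
  then obtain z where z: "z \<in> core" "x = graph.embed z" by (auto simp: lift_def)
  have zs: "z \<in> span B" using z by (simp add: core_def)
  have "norm z = norm (\<Sum>b\<in>B. (z \<bullet> b) *\<^sub>R b)" using core_proj[OF z(1)] by (simp add: proj_apply)
  also have "\<dots> \<le> real k * len 0" using z(1) by (intro norm_comb_le) (auto simp: core_def cantor_def)
  finally have "norm x \<le> real k * len 0 + 4 * \<Lambda> * real k * len 0"
    using norm_triangle_ineq[of z "limit_map z"] norm_limit_map_le[of z] z(2) by (simp add: graph.embed_def)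
  also have "\<dots> \<le> r" using r by (simp add: algebra_simps)
  finally have "x \<in> cball 0 r" by simp
  then have "V x = (\<lambda>w. w + blinfun_apply (A x) w) ` span B" by (rule V)
  also have "A x = limit_deriv z" using limit_deriv_core[OF z(1)] z(2) by (simp add: graph.embed_def)
  also have "(\<lambda>w. w + limit_deriv z w) ` span B = tangent_space surface x"
    unfolding z(2) by (rule graph.tangent_space_graph[OF zs, symmetric])
  finally show "x \<in> tangency_set surface V"
    using x lift_subset_surface by (auto simp: tangency_set_def)
qed

end

section \<open>Choice of the parameters and conclusion\<close>

text \<open>Here \<open>p = 1 / q\<close>. The last condition is the positivity of the energy exponent divided by \<open>q\<close>. It is
  linear in \<open>\<beta>\<close>, and at \<open>\<beta> = 1 / (1 - s)\<close> it is equivalent to the hypothesis on \<open>\<alpha>\<close>, so it still holds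
  slightly above this value.\<close>

lemma ex_gap_exponent:
  fixes s \<alpha> p :: real
  assumes s: "0 < s" "s < 1/2" and p: "0 \<le> p" "p \<le> 1" and \<alpha>: "0 < \<alpha>" "\<alpha> < 1 - (2 - p) * s"
  shows "\<exists>\<beta>. 1 < \<beta> \<and> \<beta> < 2 \<and> 1 < \<beta> * (1 - s) \<and> 0 < 2 - p - \<beta> * (1 + \<alpha> - p)"
proof -
  have 1: "0 < 1 - s" "0 < 1 + \<alpha> - p" using s p \<alpha> by auto
  have "1 / (1 - s) < 2" using s by (simp add: field_simps)
  moreover have "1 / (1 - s) < (2 - p) / (1 + \<alpha> - p)"
    using 1 \<alpha> by (simp add: field_simps)
  ultimately obtain \<beta> where \<beta>: "1 / (1 - s) < \<beta>" "\<beta> < min 2 ((2 - p) / (1 + \<alpha> - p))"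
    using dense[of "1 / (1 - s)" "min 2 ((2 - p) / (1 + \<alpha> - p))"] by auto
  have "1 < 1 / (1 - s)" using s by (simp add: field_simps)
  then have "1 < \<beta>" using \<beta>(1) by linarith
  moreover have "1 < \<beta> * (1 - s)" using \<beta>(1) 1(1) by (simp add: field_simps)
  moreover have "0 < 2 - p - \<beta> * (1 + \<alpha> - p)" using \<beta>(2) 1(2) by (simp add: field_simps)
  ultimately show ?thesis using \<beta>(2) by auto
qed

text \<open>Both quantities tend to zero as the base cube shrinks.\<close>

lemma ex_level:
  fixes c D r :: real
  assumes "0 < c" "0 < r"
  shows "\<exists>m. D * (1 / 2 ^ m) \<le> r \<and> 12 * (\<Sum>j. (1 / 2 ^ (m + j)) powr c) < 1"
proof -
  define \<theta> where "\<theta> = (1 / 2 :: real) powr c"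
  have \<theta>: "0 < \<theta>" "\<theta> < 1" using powr_less_mono2[OF assms(1), of "1/2" 1] by (simp_all add: \<theta>_def)
  have pow: "(1 / 2 ^ n) powr c = \<theta> ^ n" for n :: nat
  proof -
    have "(1 / 2 ^ n :: real) = (1 / 2) ^ n" by (simp add: power_divide)
    also have "\<dots> = (1 / 2) powr real n" by (simp add: powr_realpow)
    finally show ?thesis by (simp add: \<theta>_def powr_powr mult.commute flip: powr_realpow)
  qed
  have sum: "(\<Sum>j. (1 / 2 ^ (m + j)) powr c) = \<theta> ^ m * (1 / (1 - \<theta>))" for m
  proof -
    have "(\<lambda>j. \<theta> ^ m * \<theta> ^ j) sums (\<theta> ^ m * (1 / (1 - \<theta>)))" using \<theta> by (intro sums_mult geometric_sums) auto
    moreover have "(\<lambda>j. (1 / 2 ^ (m + j)) powr c) = (\<lambda>j. \<theta> ^ m * \<theta> ^ j)"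
      by (rule ext) (unfold pow, rule power_add)
    ultimately show ?thesis by (simp add: sums_iff)
  qed
  have "(\<lambda>m. D * (1 / 2) ^ m) \<longlonglongrightarrow> D * 0" by (intro tendsto_mult tendsto_const LIMSEQ_realpow_zero) auto
  then have e1: "\<forall>\<^sub>F m in sequentially. D * (1 / 2) ^ m < r" using assms(2) by (intro order_tendstoD) auto
  have "(\<lambda>m. 12 * (\<theta> ^ m * (1 / (1 - \<theta>)))) \<longlonglongrightarrow> 12 * (0 * (1 / (1 - \<theta>)))"
    using \<theta> by (intro tendsto_mult tendsto_const LIMSEQ_realpow_zero) auto
  then have e2: "\<forall>\<^sub>F m in sequentially. 12 * (\<theta> ^ m * (1 / (1 - \<theta>))) < 1" by (intro order_tendstoD) auto
  from eventually_happens[OF eventually_conj[OF e1 e2]] obtain m where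
    "D * (1 / 2) ^ m < r" "12 * (\<theta> ^ m * (1 / (1 - \<theta>))) < 1" by auto
  then show ?thesis unfolding sum by (intro exI[of _ m]) (auto simp: power_divide)
qed

theorem theorem1p1p5:
  fixes V :: "real ^ 'n \<Rightarrow> (real ^ 'n) set"
    and k :: nat and q :: ennreal and s \<alpha> :: real
  assumes "C1_distribution k V"
    and "1 \<le> q"
    and "0 < s" and "s < 1" and "0 < \<alpha>" and "\<alpha> < 1"
    and "s < 1 / 2"
    and "\<alpha> < 1 - (2 - enn2real (1 / q)) * s"
  shows "\<exists>S E. Y_submanifold k \<alpha> q S \<and> E \<in> sets borel \<and>
           frac_sobolev_surface S k s 1 (indicator E) \<and>
           E \<subseteq> tangency_set S V \<and> emeasure (hausdorff k) E > 0"
proof -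
  have V0: "subspace (V 0)" "dim (V 0) = k" using assms(1) by (auto simp: C1_distribution_def)
  from lebesgue_subspace_plane_measure[OF V0(1)] obtain B where "orthonormal B \<and> span B = V 0 \<and>
      card B = dim (V 0) \<and> lebesgue_subspace (V 0) = completion (plane_measure B)"
    by (elim exE) (rule that)
  then have B: "orthonormal B" "span B = V 0" "card B = k" "lebesgue_subspace (V 0) = completion (plane_measure B)"
    using V0(2) by simp_all
  interpret plane: orthonormal_set B by standard (rule B(1))
  obtain r \<Lambda> A where r: "0 < r" and \<Lambda>: "0 < \<Lambda>" and A: "\<forall>x y. norm (A x - A y) \<le> \<Lambda> * norm (x - y)" "\<forall>x. norm (A x) \<le> \<Lambda>"
     "\<forall>x w. blinfun_apply (A x) w \<in> orthogonal_comp (span B)" "\<forall>x w. blinfun_apply (A x) (plane.proj w) = blinfun_apply (A x) w"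
     and AV: "\<forall>x\<in>cball 0 r. V x = (\<lambda>w. w + blinfun_apply (A x) w) ` span B"
    using plane.distribution_slopes[OF assms(1) B(2)[symmetric]] by (elim exE conjE) (rule that; assumption)
  define p where "p = enn2real (1 / q)"
  have p_inf: "p = 0" if "q = \<infinity>" using that by (simp add: p_def)
  have p_fin: "p = 1 / enn2real q" "1 \<le> enn2real q" if "q \<noteq> \<infinity>"
  proof -
    obtain x where x: "q = ennreal x" "0 \<le> x" using \<open>q \<noteq> \<infinity>\<close> by (cases q) auto
    then have "1 \<le> x" using assms(2) by simp
    then show "p = 1 / enn2real q" "1 \<le> enn2real q"
      using x by (simp_all add: p_def divide_ennreal flip: ennreal_1)
  qed
  have p: "0 \<le> p" "p \<le> 1" using p_inf p_fin by (cases "q = \<infinity>"; simp)+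
  obtain \<beta> where \<beta>: "1 < \<beta>" "\<beta> < 2" "1 < \<beta> * (1 - s)" "0 < 2 - p - \<beta> * (1 + \<alpha> - p)"
    using ex_gap_exponent[of s p \<alpha>] assms p unfolding p_def by auto
  obtain m where m: "(1 + 4 * \<Lambda>) * real (card B) * (1 / 2 ^ m) \<le> r" "12 * (\<Sum>j. (1 / 2 ^ (m + j)) powr (\<beta> - 1)) < 1"
    using ex_level[of "\<beta> - 1" r "(1 + 4 * \<Lambda>) * real (card B)"] \<beta>(1) r by auto
  interpret cg: cantor_graph B A \<Lambda> m \<beta>
    by standard (use \<Lambda> A \<beta> in auto)
  have "frac_sobolev_flat (span B) (span B) \<alpha> q cg.limit_deriv"
  proof (rule cg.limit_deriv_frac_sobolev_flat[OF _ assms(5,6,2)])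
    show "lebesgue_subspace (span B) = completion (plane_measure B)" using B by simp
    show "0 < 2 - \<beta> - \<alpha> * \<beta>" if "q = \<infinity>" using \<beta>(4) p_inf[OF that] by (simp add: algebra_simps)
    show "0 < enn2real q * (2 - \<beta> - \<alpha> * \<beta>) + \<beta> - 1" if "q \<noteq> \<infinity>"
    proof -
      have "0 < enn2real q * (2 - p - \<beta> * (1 + \<alpha> - p))" using \<beta>(4) p_fin(2)[OF that] by simp
      also have "\<dots> = enn2real q * (2 - \<beta> - \<alpha> * \<beta>) + (enn2real q * p) * (\<beta> - 1)" by (simp add: algebra_simps)
      also have "enn2real q * p = 1" using p_fin[OF that] by simp
      finally show ?thesis by simp
    qed
  qed
  then have "Y_submanifold k \<alpha> q cg.surface" using cg.graph.Y_submanifold_graph B(3) by simp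
  moreover have "frac_sobolev_surface cg.surface k s 1 (indicator cg.lift)"
    using cg.lift_frac_sobolev[OF assms(3,4) \<beta>(3)] B(3) by simp
  moreover have "cg.lift \<subseteq> tangency_set cg.surface V"
    using AV m(1) by (intro cg.lift_subset_tangency_set[of r]) (auto simp: cg.len_def)
  moreover have "0 < emeasure (hausdorff k) cg.lift"
    using cg.emeasure_lift_pos m(2) B(3) by (simp add: cg.len_def)
  ultimately show ?thesis using cg.lift_sets by blast
qed


end
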